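(* Let $(Y_1,Z_1,W_1),\dots,(Y_n,Z_n,W_n)$ be an i.i.d. sample of $(Y,Z,W)$ from the model $Y=\varphi(Z)+U$, $\mathbb E[U\mid W]=0$, with $P_{U|W}\in\mathcal U_\sigma$ and with joint distribution of $(Z,W)$ fulfilling Assumption 3 (written out in the context). Let $\varphi\in\mathcal F_\gamma$ and $h\in\mathcal F_{1/\gamma}$. Let the dimension parameter $m_n$ satisfy $m_n^{-1}=o(1)$, $m_n=o(n)$, $$\big\|[h]_{\underline{m_n}}^t[T]_{\underline{m_n}}^{-1}\big\|^2=o(n)\quad\text{and}\quad m_n^3\big\|[T]_{\underline{m_n}}^{-1}\big\|^2=O(n)\qquad\text{as }n\to\infty .$$ If $\|\varphi-\varphi_m\|_\gamma=o(1)$ as $m\to\infty$, then $\mathbb E|\widehat\ell_{m_n}-\ell_h(\varphi)|^2=o(1)$ as $n\to\infty$.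
   Context: Model: $Y=\varphi(Z)+U$ with $\mathbb E[U\mid W]=0$ (in general $\mathbb E[U\mid Z]\neq0$). $L^2_Z$, $L^2_W$ are the spaces of square integrable functions of $Z$ and of $W$ with usual inner products $\langle\cdot,\cdot\rangle_Z$, $\langle\cdot,\cdot\rangle_W$. $T:L^2_Z\to L^2_W$, $T\phi=\mathbb E[\phi(Z)\mid W]$, is assumed compact and injective, and $g:=\mathbb E[Y\mid W]=T\varphi\in L^2_W$. $\{e_j\}_{j\ge1}$ and $\{f_l\}_{l\ge1}$ are fixed orthonormal bases of $L^2_Z$ and $L^2_W$; $[\phi]_j=\langle\phi,e_j\rangle_Z$, $[\psi]_l=\langle\psi,f_l\rangle_W$, and $[\phi]_{\underline m}$, $[\psi]_{\underline m}$ are the $m$-vectors of the first $m$ coefficients. $[T]_{\underline m}$ is the $m\times m$ matrix with entries $[T]_{l,j}=\langle Te_j,f_l\rangle_W$, i.e. $[T]_{\underline m}=\mathbb E\,[f(W)]_{\underline m}[e(Z)]_{\underline m}^t$ with $[e(Z)]_{\underline m}=(e_1(Z),\dots,e_m(Z))^t$, $[f(W)]_{\underline m}=(f_1(W),\dots,f_m(W))^t$; it is assumed nonsingular for all $m\ge1$. $\|\cdot\|$ denotes the Euclidean norm of vectors and the spectral norm of matrices. $\varphi_m:=\sum_{j=1}^m[\varphi_m]_je_j$ with $[\varphi_m]_{\underline m}=[T]_{\underline m}^{-1}[g]_{\underline m}$. For a positive sequence $w$, $\|\phi\|_w^2=\sum_jw_j[\phi]_j^2$, $\mathcal F_w$ is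 the corresponding (completed) weighted space, identified with coefficient sequences of finite norm; $1/\gamma=(\gamma_j^{-1})_j$. For $h\in\mathcal F_{1/\gamma}$, $\phi\in\mathcal F_\gamma$: $\ell_h(\phi)=\sum_j[h]_j[\phi]_j$. The sequence $\gamma$ is strictly positive and nondecreasing with $\gamma_1=1$ and $j^3\gamma_j^{-1}\to0$ as $j\to\infty$. Estimator: $[\widehat T]_{\underline m}=\frac1n\sum_{i=1}^n[f(W_i)]_{\underline m}[e(Z_i)]_{\underline m}^t$, $[\widehat g]_{\underline m}=\frac1n\sum_{i=1}^nY_i[f(W_i)]_{\underline m}$, and $\widehat\ell_m=[h]_{\underline m}^t[\widehat T]_{\underline m}^{-1}[\widehat g]_{\underline m}$ if $[\widehat T]_{\underline m}$ is nonsingular and $\|[\widehat T]_{\underline m}^{-1}\|\le\sqrt n$, and $\widehat\ell_m=0$ otherwise. $\mathcal U_\sigma$ ($\sigma>0$): the conditional distributions $P_{U|W}$ of $U$ given $W$ with $\mathbb E[U\mid W]=0$ and $\mathbb E[U^4\mid W]\le\sigma^4$. Assumption 3: there is $\eta\ge1$ such that (i) $\sup_j\mathbb E[e_j^2(Z)\mid W]\le\eta^2$ and $\sup_l\mathbb E[f_l^4(W)]\le\eta^4$; (ii) $\sup_{j,l}\mathbb E|e_j(Z)f_l(W)-\mathbb E[e_j(Z)f_l(W)]|^k\le\eta^kk!$ for $k=3,4,\dots$. *)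

theory Defs
  imports
    "HOL-Probability.Probability"
    "HOL-Library.Landau_Symbols"
    "Jordan_Normal_Form.Gauss_Jordan_Elimination"
begin

unbundle no vec_syntax

text \<open>
  All sequences and coordinates are indexed from 0: the objects written
  \<open>e\<^sub>j\<close>, \<open>f\<^sub>l\<close>, \<open>\<gamma>\<^sub>j\<close>, \<open>[h]\<^sub>j\<close> with \<open>j, l \<ge> 1\<close> on paper are
  \<open>e (j - 1)\<close>, \<open>f (l - 1)\<close>, \<open>\<gamma> (j - 1)\<close>, \<open>h (j - 1)\<close> here, and the first \<open>m\<close>
  coordinates are those below \<open>m\<close>.
\<close>

section \<open>Square integrable functions\<close>

text \<open>Elements are functions, not classes modulo almost everywhere equality.\<close>

definition L2_space :: "'b measure \<Rightarrow> ('b \<Rightarrow> real) set" where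
  "L2_space P = {\<phi> \<in> borel_measurable P. integrable P (\<lambda>x. (\<phi> x)\<^sup>2)}"

definition L2_inner :: "'b measure \<Rightarrow> ('b \<Rightarrow> real) \<Rightarrow> ('b \<Rightarrow> real) \<Rightarrow> real" where
  "L2_inner P \<phi> \<psi> = (\<integral>x. \<phi> x * \<psi> x \<partial>P)"

definition L2_norm :: "'b measure \<Rightarrow> ('b \<Rightarrow> real) \<Rightarrow> real" where
  "L2_norm P \<phi> = sqrt (L2_inner P \<phi> \<phi>)"

definition orthonormal_basis :: "'b measure \<Rightarrow> (nat \<Rightarrow> 'b \<Rightarrow> real) \<Rightarrow> bool" where
  "orthonormal_basis P e \<longleftrightarrow>
     (\<forall>j. e j \<in> L2_space P) \<and>
     (\<forall>i j. L2_inner P (e i) (e j) = (if i = j then 1 else 0)) \<and>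
     (\<forall>\<phi> \<in> L2_space P.
        (\<lambda>k. L2_norm P (\<lambda>x. \<phi> x - (\<Sum>j<k. L2_inner P \<phi> (e j) * e j x))) \<longlonglongrightarrow> 0)"

definition compact_L2_operator ::
    "'b measure \<Rightarrow> 'c measure \<Rightarrow> (('b \<Rightarrow> real) \<Rightarrow> ('c \<Rightarrow> real)) \<Rightarrow> bool" where
  "compact_L2_operator P Q T \<longleftrightarrow>
     (\<forall>\<phi> :: nat \<Rightarrow> 'b \<Rightarrow> real.
        (\<forall>k. \<phi> k \<in> L2_space P) \<and> (\<exists>B. \<forall>k. L2_norm P (\<phi> k) \<le> B) \<longrightarrow>
        (\<exists>r \<psi>. strict_mono (r :: nat \<Rightarrow> nat) \<and> \<psi> \<in> L2_space Q \<and>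
           (\<lambda>k. L2_norm Q (\<lambda>x. T (\<phi> (r k)) x - \<psi> x)) \<longlonglongrightarrow> 0))"

definition injective_L2_operator ::
    "'b measure \<Rightarrow> 'c measure \<Rightarrow> (('b \<Rightarrow> real) \<Rightarrow> ('c \<Rightarrow> real)) \<Rightarrow> bool" where
  "injective_L2_operator P Q T \<longleftrightarrow>
     (\<forall>\<phi> \<in> L2_space P. \<forall>\<psi> \<in> L2_space P.
        (AE x in Q. T \<phi> x = T \<psi> x) \<longrightarrow> (AE x in P. \<phi> x = \<psi> x))"

section \<open>Weighted spaces of coefficient sequences\<close>

definition weighted_space :: "(nat \<Rightarrow> real) \<Rightarrow> (nat \<Rightarrow> real) set" where
  "weighted_space w = {c. summable (\<lambda>j. w j * (c j)\<^sup>2)}"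

definition weighted_norm :: "(nat \<Rightarrow> real) \<Rightarrow> (nat \<Rightarrow> real) \<Rightarrow> real" where
  "weighted_norm w c = sqrt (\<Sum>j. w j * (c j)\<^sup>2)"

definition basis_coeff :: "'b measure \<Rightarrow> (nat \<Rightarrow> 'b \<Rightarrow> real) \<Rightarrow> ('b \<Rightarrow> real) \<Rightarrow> nat \<Rightarrow> real" where
  "basis_coeff P e \<phi> j = L2_inner P \<phi> (e j)"

text \<open>The representer \<open>h\<close> is only a coefficient sequence; it need not come from a
  square integrable function.\<close>

definition linear_functional ::
    "'b measure \<Rightarrow> (nat \<Rightarrow> 'b \<Rightarrow> real) \<Rightarrow> (nat \<Rightarrow> real) \<Rightarrow> ('b \<Rightarrow> real) \<Rightarrow> real" where
  "linear_functional P e h \<phi> = (\<Sum>j. h j * basis_coeff P e \<phi> j)"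

section \<open>Vectors and matrices\<close>

definition euclidean_norm :: "real vec \<Rightarrow> real" where
  "euclidean_norm v = sqrt (\<Sum>i<dim_vec v. (v $ i)\<^sup>2)"

definition spectral_norm :: "real mat \<Rightarrow> real" where
  "spectral_norm A =
     (SUP v \<in> {v \<in> carrier_vec (dim_col A). euclidean_norm v \<le> 1}. euclidean_norm (A *\<^sub>v v))"

text \<open>Only meaningful for invertible matrices.\<close>

definition inverse_mat :: "real mat \<Rightarrow> real mat" where
  "inverse_mat A = the (mat_inverse A)"

text \<open>The column vector whose transpose is the row vector \<open>v\<^sup>t A\<close>.\<close>

definition row_times_mat :: "real vec \<Rightarrow> real mat \<Rightarrow> real vec" where
  "row_times_mat v A = transpose_mat A *\<^sub>v v"

section \<open>Conditioning on the instrument\<close>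

definition sigma_of :: "'a measure \<Rightarrow> ('a \<Rightarrow> 'w) \<Rightarrow> 'w measure \<Rightarrow> 'a measure" where
  "sigma_of M W MW = vimage_algebra (space M) W MW"

text \<open>A version of the regression function \<open>w \<mapsto> E[X | W = w]\<close>.  It is unique up to
  null sets of the law of \<open>W\<close>, and exists by the factorization of \<open>\<sigma>(W)\<close>-measurable
  functions through \<open>W\<close>.\<close>

definition cond_exp_fun ::
    "'a measure \<Rightarrow> ('a \<Rightarrow> 'w) \<Rightarrow> 'w measure \<Rightarrow> ('a \<Rightarrow> real) \<Rightarrow> 'w \<Rightarrow> real" where
  "cond_exp_fun M W MW X =
     (SOME \<psi>. \<psi> \<in> borel_measurable MW \<and>
        (AE \<omega> in M. \<psi> (W \<omega>) = real_cond_exp M (sigma_of M W MW) X \<omega>))"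

definition cond_exp_operator ::
    "'a measure \<Rightarrow> ('a \<Rightarrow> 'z) \<Rightarrow> ('a \<Rightarrow> 'w) \<Rightarrow> 'w measure \<Rightarrow> ('z \<Rightarrow> real) \<Rightarrow> 'w \<Rightarrow> real" where
  "cond_exp_operator M Z W MW \<phi> = cond_exp_fun M W MW (\<lambda>\<omega>. \<phi> (Z \<omega>))"

text \<open>The class \<open>\<U>\<^sub>\<sigma>\<close>, a property of the conditional law of \<open>U\<close> given \<open>W\<close>.  Integrability
  of \<open>U\<close> is stated because \<open>real_cond_exp\<close> is arbitrary otherwise; the fourth moment
  is taken in the extended nonnegative reals.\<close>

definition error_class ::
    "'a measure \<Rightarrow> ('a \<Rightarrow> 'w) \<Rightarrow> 'w measure \<Rightarrow> ('a \<Rightarrow> real) \<Rightarrow> real \<Rightarrow> bool" where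
  "error_class M W MW U \<sigma> \<longleftrightarrow>
     integrable M U \<and>
     (AE \<omega> in M. real_cond_exp M (sigma_of M W MW) U \<omega> = 0) \<and>
     (AE \<omega> in M. nn_cond_exp M (sigma_of M W MW) (\<lambda>\<omega>. ennreal (U \<omega> ^ 4)) \<omega> \<le> ennreal (\<sigma> ^ 4))"

definition moment_assumption ::
    "'a measure \<Rightarrow> ('a \<Rightarrow> 'z) \<Rightarrow> ('a \<Rightarrow> 'w) \<Rightarrow> 'w measure \<Rightarrow>
     (nat \<Rightarrow> 'z \<Rightarrow> real) \<Rightarrow> (nat \<Rightarrow> 'w \<Rightarrow> real) \<Rightarrow> real \<Rightarrow> bool" where
  "moment_assumption M Z W MW e f \<eta> \<longleftrightarrow>
     \<eta> \<ge> 1 \<and>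
     (\<forall>j. AE \<omega> in M.
        nn_cond_exp M (sigma_of M W MW) (\<lambda>\<omega>. ennreal ((e j (Z \<omega>))\<^sup>2)) \<omega> \<le> ennreal (\<eta>\<^sup>2)) \<and>
     (\<forall>l. (\<integral>\<^sup>+ \<omega>. ennreal (f l (W \<omega>) ^ 4) \<partial>M) \<le> ennreal (\<eta> ^ 4)) \<and>
     (\<forall>k\<ge>3. \<forall>j l.
        (\<integral>\<^sup>+ \<omega>. ennreal (\<bar>e j (Z \<omega>) * f l (W \<omega>) - (\<integral>\<omega>'. e j (Z \<omega>') * f l (W \<omega>') \<partial>M)\<bar> ^ k) \<partial>M)
          \<le> ennreal (\<eta> ^ k * fact k))"

section \<open>Galerkin approximation\<close>

definition operator_matrix ::
    "'w measure \<Rightarrow> (nat \<Rightarrow> 'z \<Rightarrow> real) \<Rightarrow> (nat \<Rightarrow> 'w \<Rightarrow> real) \<Rightarrow>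
     (('z \<Rightarrow> real) \<Rightarrow> 'w \<Rightarrow> real) \<Rightarrow> nat \<Rightarrow> real mat" where
  "operator_matrix PW e f T m = Matrix.mat m m (\<lambda>(l, j). L2_inner PW (T (e j)) (f l))"

definition galerkin_solution ::
    "'w measure \<Rightarrow> (nat \<Rightarrow> 'z \<Rightarrow> real) \<Rightarrow> (nat \<Rightarrow> 'w \<Rightarrow> real) \<Rightarrow>
     (('z \<Rightarrow> real) \<Rightarrow> 'w \<Rightarrow> real) \<Rightarrow> ('w \<Rightarrow> real) \<Rightarrow> nat \<Rightarrow> 'z \<Rightarrow> real" where
  "galerkin_solution PW e f T g m z =
     (let c = inverse_mat (operator_matrix PW e f T m) *\<^sub>v Matrix.vec m (basis_coeff PW f g)
      in \<Sum>j<m. c $ j * e j z)"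

section \<open>Estimator\<close>

text \<open>The arguments \<open>y\<close>, \<open>z\<close>, \<open>w\<close> are the observed values; the sample of size \<open>n\<close> consists
  of those with index below \<open>n\<close>.\<close>

definition sample_matrix ::
    "(nat \<Rightarrow> 'z \<Rightarrow> real) \<Rightarrow> (nat \<Rightarrow> 'w \<Rightarrow> real) \<Rightarrow> nat \<Rightarrow> nat \<Rightarrow>
     (nat \<Rightarrow> 'z) \<Rightarrow> (nat \<Rightarrow> 'w) \<Rightarrow> real mat" where
  "sample_matrix e f m n z w =
     Matrix.mat m m (\<lambda>(l, j). (1 / real n) * (\<Sum>i<n. f l (w i) * e j (z i)))"

definition sample_vector ::
    "(nat \<Rightarrow> 'w \<Rightarrow> real) \<Rightarrow> nat \<Rightarrow> nat \<Rightarrow> (nat \<Rightarrow> real) \<Rightarrow> (nat \<Rightarrow> 'w) \<Rightarrow> real vec" where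
  "sample_vector f m n y w = Matrix.vec m (\<lambda>l. (1 / real n) * (\<Sum>i<n. y i * f l (w i)))"

definition estimator ::
    "(nat \<Rightarrow> 'z \<Rightarrow> real) \<Rightarrow> (nat \<Rightarrow> 'w \<Rightarrow> real) \<Rightarrow> (nat \<Rightarrow> real) \<Rightarrow> nat \<Rightarrow> nat \<Rightarrow>
     (nat \<Rightarrow> real) \<Rightarrow> (nat \<Rightarrow> 'z) \<Rightarrow> (nat \<Rightarrow> 'w) \<Rightarrow> real" where
  "estimator e f h m n y z w =
     (let A = sample_matrix e f m n z w in
      if invertible_mat A \<and> spectral_norm (inverse_mat A) \<le> sqrt (real n)
      then Matrix.vec m h \<bullet> (inverse_mat A *\<^sub>v sample_vector f m n y w)
      else 0)"

end

theory Submission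
  imports Defs "Jordan_Normal_Form.Determinant"
begin

text \<open>
  Write \<open>\<Xi>\<close> for the error of the sample matrix, \<open>c = [T]\<^sup>-\<^sup>1 [g]\<close> for the Galerkin coefficients,
  \<open>V\<close> for the sample vector minus the sample matrix applied to \<open>c\<close>, and \<open>a = ([T]\<^sup>-\<^sup>1)\<^sup>t [h]\<close>.  By the choice
  of \<open>c\<close> the vector \<open>V\<close> is an average of centred terms.  Where the sample matrix is inverted, with
  \<open>v\<close> the solution of (sample matrix) \<open>v = V\<close>, the estimator differs from \<open>[h] \<bullet> c\<close> by
  \<open>a \<bullet> V - a \<bullet> \<Xi> v\<close>.  The first term has second moment of order \<open>\<parallel>a\<parallel>\<^sup>2 / n\<close>.

  For the second one let \<open>s = \<parallel>[T]\<^sup>-\<^sup>1\<parallel>\<close>.  If \<open>\<parallel>\<Xi>\<parallel> s \<le> 1 / 2\<close> then \<open>\<parallel>v\<parallel> \<le> 2 s \<parallel>V\<parallel>\<close>; otherwise only the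
  threshold \<open>\<parallel>v\<parallel>\<^sup>2 \<le> n \<parallel>V\<parallel>\<^sup>2\<close> is available, but then \<open>1 \<le> (4 s\<^sup>2 \<parallel>\<Xi>\<parallel>\<^sup>2)\<^sup>3\<close>.  Since \<open>\<parallel>\<Xi>\<parallel>\<^sup>2\<close> is of order
  \<open>m\<^sup>2 / n\<close> in all moments and \<open>\<parallel>V\<parallel>\<^sup>2\<close> is of order \<open>m / n\<close>, both cases contribute \<open>\<parallel>a\<parallel>\<^sup>2 / n\<close> times a
  power of \<open>m\<^sup>3 s\<^sup>2 / n = O(1)\<close>.  The same trick bounds the probability that the estimator is
  set to zero by \<open>O(1 / m)\<close>.

  The moments of \<open>V\<close> are controlled because \<open>\<phi> - \<phi>\<^sub>m\<close> is dominated by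
  \<open>\<parallel>\<phi> - \<phi>\<^sub>m\<parallel>\<^sub>\<gamma> (\<Sum>\<^sub>j e\<^sub>j\<^sup>2 / \<gamma>\<^sub>j)\<^sup>1\<^sup>/\<^sup>2\<close> almost everywhere and \<open>\<Sum>\<^sub>j 1 / \<gamma>\<^sub>j < \<infinity>\<close>.
\<close>

section \<open>Matrices and their perturbation\<close>

text \<open>The squared Hilbert-Schmidt norm. It dominates the squared spectral norm and, being a
  plain sum over entries, has moments that reduce to those of single sample averages.\<close>

definition frobenius_sq :: "real mat \<Rightarrow> real" where
  "frobenius_sq A = (\<Sum>i<dim_row A. \<Sum>j<dim_col A. (A $$ (i, j))\<^sup>2)"

lemma frobenius_sq_nonneg: "frobenius_sq A \<ge> 0"
  by (simp add: frobenius_sq_def sum_nonneg)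

section \<open>Euclidean, Frobenius and spectral norms\<close>

lemma euclidean_norm_nonneg: "euclidean_norm v \<ge> 0"
  by (simp add: euclidean_norm_def sum_nonneg)

lemma euclidean_norm_sq: "(euclidean_norm v)\<^sup>2 = (\<Sum>i<dim_vec v. (v $ i)\<^sup>2)"
  by (simp add: euclidean_norm_def sum_nonneg)

lemma euclidean_norm_eq_0D:
  assumes "v \<in> carrier_vec n" "euclidean_norm v = 0"
  shows "v = 0\<^sub>v n"
proof -
  have "(\<Sum>i<n. (v $ i)\<^sup>2) = 0"
    using euclidean_norm_sq[of v] assms by auto
  then have "\<forall>i\<in>{..<n}. (v $ i)\<^sup>2 = 0"
    by (subst (asm) sum_nonneg_eq_0_iff) auto
  then show ?thesis using assms by auto
qed

lemma euclidean_norm_smult: "euclidean_norm (c \<cdot>\<^sub>v v) = \<bar>c\<bar> * euclidean_norm v"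
  by (simp add: euclidean_norm_def power_mult_distrib sum_distrib_left[symmetric] real_sqrt_mult)

lemma scalar_prod_sq_le:
  assumes "dim_vec v = dim_vec w"
  shows "(v \<bullet> w)\<^sup>2 \<le> (euclidean_norm v)\<^sup>2 * (euclidean_norm w)\<^sup>2"
  unfolding scalar_prod_def euclidean_norm_sq
  using assms Cauchy_Schwarz_ineq_sum[of "\<lambda>i. v $ i" "\<lambda>i. w $ i" "{..<dim_vec v}"]
  by (simp add: atLeast0LessThan)

lemma euclidean_norm_diff_le:
  assumes "v \<in> carrier_vec n" "w \<in> carrier_vec n"
  shows "euclidean_norm (v - w) \<le> euclidean_norm v + euclidean_norm w"
proof -
  have "euclidean_norm u = L2_set (\<lambda>i. u $ i) {..<n}" if "u \<in> carrier_vec n" for u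
    using that by (simp add: euclidean_norm_def L2_set_def)
  moreover have "L2_set (\<lambda>i. (v - w) $ i) {..<n} = L2_set (\<lambda>i. v $ i + (- (w $ i))) {..<n}"
    by (rule L2_set_cong) (use assms in auto)
  moreover have "L2_set (\<lambda>i. - (w $ i)) {..<n} = L2_set (\<lambda>i. w $ i) {..<n}"
    by (simp add: L2_set_def)
  ultimately show ?thesis
    using assms L2_set_triangle_ineq[of "\<lambda>i. v $ i" "\<lambda>i. - (w $ i)" "{..<n}"] by simp
qed

text \<open>Cauchy-Schwarz, applied to every row of \<open>A\<close>.\<close>

lemma euclidean_norm_mult_le_frobenius:
  assumes "A \<in> carrier_mat r n" "v \<in> carrier_vec n"
  shows "(euclidean_norm (A *\<^sub>v v))\<^sup>2 \<le> frobenius_sq A * (euclidean_norm v)\<^sup>2"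
proof -
  have "(euclidean_norm (A *\<^sub>v v))\<^sup>2 = (\<Sum>i<r. (row A i \<bullet> v)\<^sup>2)"
    using assms by (simp add: euclidean_norm_sq)
  also have "\<dots> \<le> (\<Sum>i<r. (euclidean_norm (row A i))\<^sup>2 * (euclidean_norm v)\<^sup>2)"
    by (intro sum_mono scalar_prod_sq_le) (use assms in auto)
  also have "\<dots> = frobenius_sq A * (euclidean_norm v)\<^sup>2"
    using assms by (simp add: euclidean_norm_sq frobenius_sq_def sum_distrib_right)
  finally show ?thesis .
qed

text \<open>The supremum in \<open>spectral_norm\<close> is taken over reals, so it is an upper
  bound only once boundedness is known; the Frobenius estimate supplies that. Scaling carries the
  bound from the unit ball to all vectors, vectors of norm zero being treated apart.\<close>

lemma euclidean_norm_mult_le_spectral: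
  assumes A: "A \<in> carrier_mat r n" and v: "v \<in> carrier_vec n"
  shows "euclidean_norm (A *\<^sub>v v) \<le> spectral_norm A * euclidean_norm v"
proof (cases "euclidean_norm v = 0")
  case True
  then have "v = 0\<^sub>v n" by (rule euclidean_norm_eq_0D[OF v])
  then show ?thesis
    using True euclidean_norm_mult_le_frobenius[OF A v] by simp
next
  case False
  define c where "c = euclidean_norm v"
  have c: "c > 0" using False euclidean_norm_nonneg[of v] by (simp add: c_def)
  define u where "u = (1 / c) \<cdot>\<^sub>v v"
  have u: "u \<in> carrier_vec n" "euclidean_norm u = 1"
    using c v by (auto simp: u_def euclidean_norm_smult c_def)
  have vu: "v = c \<cdot>\<^sub>v u" using c v by (auto simp: u_def smult_smult_assoc)
  have bdd: "bdd_above ((\<lambda>w. euclidean_norm (A *\<^sub>v w)) ` {w \<in> carrier_vec (dim_col A). euclidean_norm w \<le> 1})"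
  proof (rule bdd_aboveI2)
    fix w assume "w \<in> {w \<in> carrier_vec (dim_col A). euclidean_norm w \<le> 1}"
    then have w: "w \<in> carrier_vec n" "euclidean_norm w \<le> 1" using A by auto
    have "(euclidean_norm (A *\<^sub>v w))\<^sup>2 \<le> frobenius_sq A * (euclidean_norm w)\<^sup>2"
      by (rule euclidean_norm_mult_le_frobenius[OF A w(1)])
    also have "\<dots> \<le> frobenius_sq A * 1"
      using w(2) by (intro mult_left_mono frobenius_sq_nonneg power_le_one euclidean_norm_nonneg)
    finally show "euclidean_norm (A *\<^sub>v w) \<le> sqrt (frobenius_sq A)"
      by (simp add: real_le_rsqrt)
  qed
  have "euclidean_norm (A *\<^sub>v u) \<le> spectral_norm A"
    unfolding spectral_norm_def by (rule cSUP_upper[OF _ bdd]) (use u A in auto)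
  moreover have "A *\<^sub>v v = c \<cdot>\<^sub>v (A *\<^sub>v u)"
    unfolding vu by (rule mult_mat_vec[OF A u(1)])
  ultimately show ?thesis
    using c by (simp add: euclidean_norm_smult mult.commute flip: c_def)
qed

lemma spectral_norm_leI:
  assumes "A \<in> carrier_mat r n"
    and "\<And>v. v \<in> carrier_vec n \<Longrightarrow> euclidean_norm (A *\<^sub>v v) \<le> c * euclidean_norm v" and "c \<ge> 0"
  shows "spectral_norm A \<le> c"
  unfolding spectral_norm_def
proof (rule cSUP_least)
  have "euclidean_norm (0\<^sub>v n) = 0" by (simp add: euclidean_norm_def)
  then show "{v \<in> carrier_vec (dim_col A). euclidean_norm v \<le> 1} \<noteq> {}"
    using assms(1) by (auto intro!: exI[of _ "0\<^sub>v n"])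
next
  fix v assume "v \<in> {v \<in> carrier_vec (dim_col A). euclidean_norm v \<le> 1}"
  then show "euclidean_norm (A *\<^sub>v v) \<le> c"
    using assms(1) assms(2)[of v] mult_left_mono[of "euclidean_norm v" 1 c] assms(3) by auto
qed

lemma spectral_norm_nonneg:
  assumes "A \<in> carrier_mat r n" "n > 0"
  shows "spectral_norm A \<ge> 0"
proof -
  have "euclidean_norm (unit_vec n 0 :: real vec) = 1"
    using assms(2) by (simp add: euclidean_norm_def unit_vec_def if_distrib[of "\<lambda>x. x ^ 2"] cong: if_cong)
  then show ?thesis
    using euclidean_norm_mult_le_spectral[OF assms(1), of "unit_vec n 0"] euclidean_norm_nonneg[of "A *\<^sub>v unit_vec n 0"]
    by simp
qed

section \<open>Inverse matrices\<close>

lemma inverse_mat: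
  assumes A: "A \<in> carrier_mat n n" and inv: "invertible_mat A"
  shows "inverse_mat A \<in> carrier_mat n n" "A * inverse_mat A = 1\<^sub>m n" "inverse_mat A * A = 1\<^sub>m n"
proof -
  \<comment> \<open>\<open>invertible_mat\<close> leaves the shape of its witness open, so the
    dimensions of \<open>B\<close> are read off the two products. Then \<open>A\<close> is a unit of
    the matrix ring, and \<open>mat_inverse\<close> cannot return \<open>None\<close>.\<close>
  obtain B where B: "A * B = 1\<^sub>m n" "B * A = 1\<^sub>m (dim_row B)"
    using inv A by (auto simp: invertible_mat_def inverts_mat_def)
  have "dim_col B = n" using arg_cong[OF B(1), of dim_col] by simp
  moreover have "dim_row B = n" using arg_cong[OF B(2), of dim_col] A by simp
  ultimately have "A \<in> Units (ring_mat TYPE(real) n ())"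
    using A B by (auto simp: Units_def ring_mat_simps intro!: bexI[of _ B])
  then obtain C where "mat_inverse A = Some C"
    using mat_inverse(1)[OF A] by fastforce
  then show "inverse_mat A \<in> carrier_mat n n" "A * inverse_mat A = 1\<^sub>m n" "inverse_mat A * A = 1\<^sub>m n"
    using mat_inverse(2)[OF A] by (auto simp: inverse_mat_def)
qed

lemma inverse_mat_mult_vec:
  assumes A: "A \<in> carrier_mat n n" and inv: "invertible_mat A" and v: "v \<in> carrier_vec n"
  shows "inverse_mat A *\<^sub>v v \<in> carrier_vec n" "A *\<^sub>v (inverse_mat A *\<^sub>v v) = v" "inverse_mat A *\<^sub>v (A *\<^sub>v v) = v"
proof -
  note I = inverse_mat[OF A inv]
  show "inverse_mat A *\<^sub>v v \<in> carrier_vec n" using I(1) v by simp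
  show "A *\<^sub>v (inverse_mat A *\<^sub>v v) = v"
    using assoc_mult_mat_vec[OF A I(1) v] I(2) v by simp
  show "inverse_mat A *\<^sub>v (A *\<^sub>v v) = v"
    using assoc_mult_mat_vec[OF I(1) A v] I(3) v by simp
qed

section \<open>Stability of inversion under perturbation\<close>

lemma invertible_matI:
  fixes A :: "real mat"
  assumes A: "A \<in> carrier_mat n n" and inj: "\<And>v. v \<in> carrier_vec n \<Longrightarrow> A *\<^sub>v v = 0\<^sub>v n \<Longrightarrow> v = 0\<^sub>v n"
  shows "invertible_mat A"
proof -
  have "det A \<noteq> 0" using det_0_iff_vec_prod_zero_field[OF A] inj by auto
  then have "A \<in> Units (ring_mat TYPE(real) n ())" by (rule det_non_zero_imp_unit[OF A])
  then show ?thesis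
    using A by (auto simp: Units_def ring_mat_simps invertible_mat_def inverts_mat_def)
qed

text \<open>Write \<open>v\<close> as A^-1 (B v) minus A^-1 ((B - A) v). By \<open>small\<close>,
  whose 1/4 is the square of 1/2, the second term has at most half the norm of \<open>v\<close> and
  is absorbed on the left.\<close>

lemma euclidean_norm_perturbed_le:
  assumes A: "A \<in> carrier_mat n n" and inv: "invertible_mat A" and B: "B \<in> carrier_mat n n"
    and n: "n > 0"
    and small: "frobenius_sq (B - A) * (spectral_norm (inverse_mat A))\<^sup>2 \<le> 1 / 4"
    and v: "v \<in> carrier_vec n"
  shows "euclidean_norm v \<le> 2 * spectral_norm (inverse_mat A) * euclidean_norm (B *\<^sub>v v)"
proof -
  define s where "s = spectral_norm (inverse_mat A)"
  define D where "D = B - A"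
  have D: "D \<in> carrier_mat n n" using A B by (auto simp: D_def)
  note I = inverse_mat[OF A inv]
  have s: "s \<ge> 0" unfolding s_def by (rule spectral_norm_nonneg[OF I(1) n])
  have "euclidean_norm (inverse_mat A *\<^sub>v (D *\<^sub>v v)) \<le> s * euclidean_norm (D *\<^sub>v v)"
    unfolding s_def by (rule euclidean_norm_mult_le_spectral[OF I(1)]) (use D v in simp)
  also have "\<dots> \<le> 1 / 2 * euclidean_norm v"
  proof (rule power2_le_imp_le)
    have "(s * euclidean_norm (D *\<^sub>v v))\<^sup>2 \<le> s\<^sup>2 * (frobenius_sq D * (euclidean_norm v)\<^sup>2)"
      unfolding power_mult_distrib by (intro mult_left_mono euclidean_norm_mult_le_frobenius[OF D v]) auto
    also have "\<dots> = (frobenius_sq D * s\<^sup>2) * (euclidean_norm v)\<^sup>2" by simp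
    also have "\<dots> \<le> 1 / 4 * (euclidean_norm v)\<^sup>2"
      using small by (intro mult_right_mono) (auto simp: D_def s_def)
    finally show "(s * euclidean_norm (D *\<^sub>v v))\<^sup>2 \<le> (1 / 2 * euclidean_norm v)\<^sup>2"
      by (simp add: power_mult_distrib power_divide)
  qed (simp add: euclidean_norm_nonneg)
  finally have half: "euclidean_norm (inverse_mat A *\<^sub>v (D *\<^sub>v v)) \<le> 1 / 2 * euclidean_norm v" .
  have "D *\<^sub>v v = B *\<^sub>v v - A *\<^sub>v v"
    unfolding D_def by (rule minus_mult_distrib_mat_vec[OF B A v])
  then have "inverse_mat A *\<^sub>v (D *\<^sub>v v) = inverse_mat A *\<^sub>v (B *\<^sub>v v) - v"
    using mult_minus_distrib_mat_vec[OF I(1), of "B *\<^sub>v v" "A *\<^sub>v v"] A B v inverse_mat_mult_vec(3)[OF A inv v] by simp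
  then have "v = inverse_mat A *\<^sub>v (B *\<^sub>v v) - inverse_mat A *\<^sub>v (D *\<^sub>v v)"
    using I(1) v by (intro eq_vecI) auto
  then have "euclidean_norm v \<le> euclidean_norm (inverse_mat A *\<^sub>v (B *\<^sub>v v)) + euclidean_norm (inverse_mat A *\<^sub>v (D *\<^sub>v v))"
    using euclidean_norm_diff_le[of "inverse_mat A *\<^sub>v (B *\<^sub>v v)" n "inverse_mat A *\<^sub>v (D *\<^sub>v v)"] I(1) B D v by simp
  moreover have "euclidean_norm (inverse_mat A *\<^sub>v (B *\<^sub>v v)) \<le> s * euclidean_norm (B *\<^sub>v v)"
    unfolding s_def by (rule euclidean_norm_mult_le_spectral[OF I(1)]) (use B v in simp)
  ultimately show ?thesis using half by (simp add: s_def)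
qed

text \<open>The lower bound for the norm of B v forces a trivial kernel; taken at the preimage of a
  vector, it bounds the inverse.\<close>

lemma inverse_perturbed:
  assumes A: "A \<in> carrier_mat n n" and inv: "invertible_mat A" and B: "B \<in> carrier_mat n n"
    and n: "n > 0"
    and small: "frobenius_sq (B - A) * (spectral_norm (inverse_mat A))\<^sup>2 \<le> 1 / 4"
  shows "invertible_mat B" "spectral_norm (inverse_mat B) \<le> 2 * spectral_norm (inverse_mat A)"
proof -
  note le = euclidean_norm_perturbed_le[OF assms]
  show invB: "invertible_mat B"
  proof (rule invertible_matI[OF B])
    fix v assume v: "v \<in> carrier_vec n" "B *\<^sub>v v = 0\<^sub>v n"
    have "euclidean_norm (0\<^sub>v n) = 0" by (simp add: euclidean_norm_def)
    then show "v = 0\<^sub>v n"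
      using le[OF v(1)] v euclidean_norm_nonneg[of v] by (intro euclidean_norm_eq_0D[OF v(1)]) auto
  qed
  show "spectral_norm (inverse_mat B) \<le> 2 * spectral_norm (inverse_mat A)"
  proof (rule spectral_norm_leI[OF inverse_mat(1)[OF B invB]])
    fix v :: "real vec" assume v: "v \<in> carrier_vec n"
    show "euclidean_norm (inverse_mat B *\<^sub>v v) \<le> 2 * spectral_norm (inverse_mat A) * euclidean_norm v"
      using le[of "inverse_mat B *\<^sub>v v"] inverse_mat_mult_vec[OF B invB v] by simp
  qed (use spectral_norm_nonneg[OF inverse_mat(1)[OF A inv] n] in simp)
qed

text \<open>The resolvent identity B^-1 w = A^-1 w - A^-1 (B - A) B^-1 w, paired with
  \<open>h\<close>. Transposition moves A^-1 onto \<open>h\<close>, so the functional enters through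
  the one vector whose length the rate condition controls.\<close>

lemma scalar_prod_inverse_perturbed:
  assumes A: "A \<in> carrier_mat n n" and invA: "invertible_mat A"
    and B: "B \<in> carrier_mat n n" and invB: "invertible_mat B"
    and h: "h \<in> carrier_vec n" and w: "w \<in> carrier_vec n"
  shows "h \<bullet> (inverse_mat B *\<^sub>v w) = row_times_mat h (inverse_mat A) \<bullet> w
    - row_times_mat h (inverse_mat A) \<bullet> ((B - A) *\<^sub>v (inverse_mat B *\<^sub>v w))"
proof -
  define v where "v = inverse_mat B *\<^sub>v w"
  note I = inverse_mat[OF A invA]
  have v: "v \<in> carrier_vec n" "B *\<^sub>v v = w"
    using inverse_mat_mult_vec[OF B invB w] by (auto simp: v_def)
  have t: "row_times_mat h (inverse_mat A) \<bullet> u = h \<bullet> (inverse_mat A *\<^sub>v u)" if "u \<in> carrier_vec n" for u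
    unfolding row_times_mat_def by (rule transpose_vec_mult_scalar[OF I(1) that h])
  have D: "B - A \<in> carrier_mat n n" using A B by auto
  have "(B - A) *\<^sub>v v = w - A *\<^sub>v v"
    using minus_mult_distrib_mat_vec[OF B A v(1)] v(2) by simp
  then have "inverse_mat A *\<^sub>v ((B - A) *\<^sub>v v) = inverse_mat A *\<^sub>v w - v"
    using mult_minus_distrib_mat_vec[OF I(1) w, of "A *\<^sub>v v"] A v inverse_mat_mult_vec(3)[OF A invA v(1)] by simp
  then have "h \<bullet> (inverse_mat A *\<^sub>v ((B - A) *\<^sub>v v)) = h \<bullet> (inverse_mat A *\<^sub>v w) - h \<bullet> v"
    using scalar_prod_minus_distrib[OF h, of "inverse_mat A *\<^sub>v w" v] I(1) v w by simp
  then show ?thesis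
    using t[OF w] t[OF mult_mat_vec_carrier[OF D v(1)]] by (simp add: v_def)
qed

section \<open>Pathwise error of the thresholded estimator\<close>

lemma sq_sum3_le: "(a + b + c)\<^sup>2 \<le> 3 * (a\<^sup>2 + b\<^sup>2 + (c::real)\<^sup>2)"
  using sum_squares_bound[of a b] sum_squares_bound[of a c] sum_squares_bound[of b c]
  by (simp add: power2_eq_square algebra_simps)

text \<open>A deterministic inequality, to be used for each realisation: \<open>A\<close> is the
  true matrix, \<open>B\<close> the sample matrix, \<open>c\<close> the Galerkin coefficients,
  \<open>L\<close> the target. The bracket holds the linear part, the effect of the matrix error and
  the bias; the last summand pays for outcomes where the estimator is set to zero.\<close>

lemma thresholded_plugin_error_le:
  fixes h c w :: "real vec" and L N :: real
  assumes A: "A \<in> carrier_mat n n" and inv: "invertible_mat A" and B: "B \<in> carrier_mat n n"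
    and n: "n > 0"
    and h: "h \<in> carrier_vec n" and c: "c \<in> carrier_vec n" and w: "w \<in> carrier_vec n"
    and s_def: "s = spectral_norm (inverse_mat A)"
    and x_def: "x = frobenius_sq (B - A)"
    and a_def: "a = row_times_mat h (inverse_mat A)"
    and V_def: "V = w - B *\<^sub>v c"
    and y_def: "y = (euclidean_norm V)\<^sup>2"
    and N: "4 * s\<^sup>2 \<le> N"
  shows "((if invertible_mat B \<and> spectral_norm (inverse_mat B) \<le> sqrt N
           then h \<bullet> (inverse_mat B *\<^sub>v w) else 0) - L)\<^sup>2
    \<le> 3 * ((a \<bullet> V)\<^sup>2 + (euclidean_norm a)\<^sup>2 * (4 * s\<^sup>2 * (x * y) + 64 * N * s ^ 6 * (x ^ 4 * y)) + (h \<bullet> c - L)\<^sup>2)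
      + 4 * L\<^sup>2 * s\<^sup>2 * x"
proof -
  note I = inverse_mat[OF A inv]
  have s: "s \<ge> 0" unfolding s_def by (rule spectral_norm_nonneg[OF I(1) n])
  have x: "x \<ge> 0" by (simp add: x_def frobenius_sq_nonneg)
  have y: "y \<ge> 0" by (simp add: y_def)
  have N0: "N \<ge> 0" using N zero_le_power2[of s] by linarith
  have V: "V \<in> carrier_vec n" using w c B by (auto simp: V_def)
  have a: "a \<in> carrier_vec n" using h I(1) by (simp add: a_def row_times_mat_def)
  have D: "B - A \<in> carrier_mat n n" using A B by auto
  show ?thesis
  proof (cases "invertible_mat B \<and> spectral_norm (inverse_mat B) \<le> sqrt N")
    case True
    then have invB: "invertible_mat B" and sN: "spectral_norm (inverse_mat B) \<le> sqrt N" by auto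
    define v where "v = inverse_mat B *\<^sub>v V"
    have v: "v \<in> carrier_vec n" "B *\<^sub>v v = V"
      using inverse_mat_mult_vec[OF B invB V] by (auto simp: v_def)
    \<comment> \<open>Centring at \<open>c\<close>: as \<open>w\<close> is B c + V, the resolvent
      identity can be applied to \<open>V\<close> instead of \<open>w\<close>.\<close>
    have "v = inverse_mat B *\<^sub>v w - c"
      unfolding v_def V_def
      using mult_minus_distrib_mat_vec[OF inverse_mat(1)[OF B invB] w, of "B *\<^sub>v c"] B c
        inverse_mat_mult_vec(3)[OF B invB c] by simp
    then have "h \<bullet> v = h \<bullet> (inverse_mat B *\<^sub>v w) - h \<bullet> c"
      using scalar_prod_minus_distrib[OF h inverse_mat_mult_vec(1)[OF B invB w] c] by simp
    then have "h \<bullet> (inverse_mat B *\<^sub>v w) - L = a \<bullet> V + (- (a \<bullet> ((B - A) *\<^sub>v v))) + (h \<bullet> c - L)"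
      using scalar_prod_inverse_perturbed[OF A inv B invB h V] by (simp add: a_def v_def)
    then have err: "(h \<bullet> (inverse_mat B *\<^sub>v w) - L)\<^sup>2 \<le> 3 * ((a \<bullet> V)\<^sup>2 + (a \<bullet> ((B - A) *\<^sub>v v))\<^sup>2 + (h \<bullet> c - L)\<^sup>2)"
      using sq_sum3_le[of "a \<bullet> V" "- (a \<bullet> ((B - A) *\<^sub>v v))" "h \<bullet> c - L"]
      by (simp only: power2_minus)
    have key: "x * (euclidean_norm v)\<^sup>2 \<le> 4 * s\<^sup>2 * (x * y) + 64 * N * s ^ 6 * (x ^ 4 * y)"
    proof (cases "x * s\<^sup>2 \<le> 1 / 4")
      case True
      have "euclidean_norm v \<le> 2 * s * euclidean_norm V"
        using euclidean_norm_perturbed_le[OF A inv B n _ v(1)] True v(2) by (simp add: x_def s_def)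
      then have "(euclidean_norm v)\<^sup>2 \<le> (2 * s * euclidean_norm V)\<^sup>2"
        by (intro power_mono euclidean_norm_nonneg)
      then have "x * (euclidean_norm v)\<^sup>2 \<le> x * (4 * s\<^sup>2 * y)"
        using x by (intro mult_left_mono) (auto simp: y_def power_mult_distrib)
      moreover have "64 * N * s ^ 6 * (x ^ 4 * y) \<ge> 0"
        using N0 s x y by auto
      ultimately show ?thesis by (simp add: mult_ac)
    next
      case False
      have "euclidean_norm v \<le> spectral_norm (inverse_mat B) * euclidean_norm V"
        unfolding v_def by (rule euclidean_norm_mult_le_spectral[OF inverse_mat(1)[OF B invB] V])
      also have "\<dots> \<le> sqrt N * euclidean_norm V"
        by (intro mult_right_mono sN euclidean_norm_nonneg)
      finally have "(euclidean_norm v)\<^sup>2 \<le> (sqrt N * euclidean_norm V)\<^sup>2"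
        by (intro power_mono euclidean_norm_nonneg)
      then have 1: "x * (euclidean_norm v)\<^sup>2 \<le> x * (N * y)"
        using x N0 by (intro mult_left_mono) (auto simp: y_def power_mult_distrib)
      \<comment> \<open>The exponent 3 makes the dimension cancel. For \<open>x\<close> of order k^2
        / n, \<open>y\<close> of order k / n and the square of \<open>s\<close> at most of order n /
        k^3, the product N s^6 x^4 y with N = n has order 1 / n, the same as s^2 x y.\<close>
      have "1 \<le> (4 * (x * s\<^sup>2)) ^ 3" using False by (intro one_le_power) auto
      then have "(x * (N * y)) * 1 \<le> (x * (N * y)) * (4 * (x * s\<^sup>2)) ^ 3"
        using x N0 y by (intro mult_left_mono) auto
      also have "\<dots> = 64 * N * s ^ 6 * (x ^ 4 * y)"
        by (simp add: power_mult_distrib mult_ac eval_nat_numeral)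
      finally have "x * (N * y) \<le> 64 * N * s ^ 6 * (x ^ 4 * y)" by simp
      moreover have "0 \<le> 4 * s\<^sup>2 * (x * y)" using x y by simp
      ultimately show ?thesis using 1 by linarith
    qed
    have quad: "(a \<bullet> ((B - A) *\<^sub>v v))\<^sup>2 \<le> (euclidean_norm a)\<^sup>2 * (4 * s\<^sup>2 * (x * y) + 64 * N * s ^ 6 * (x ^ 4 * y))"
    proof -
      have "(a \<bullet> ((B - A) *\<^sub>v v))\<^sup>2 \<le> (euclidean_norm a)\<^sup>2 * (euclidean_norm ((B - A) *\<^sub>v v))\<^sup>2"
        by (rule scalar_prod_sq_le) (use a D A in auto)
      also have "\<dots> \<le> (euclidean_norm a)\<^sup>2 * (x * (euclidean_norm v)\<^sup>2)"
        unfolding x_def by (intro mult_left_mono euclidean_norm_mult_le_frobenius[OF D v(1)]) auto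
      also have "\<dots> \<le> (euclidean_norm a)\<^sup>2 * (4 * s\<^sup>2 * (x * y) + 64 * N * s ^ 6 * (x ^ 4 * y))"
        by (intro mult_left_mono key) simp
      finally show ?thesis .
    qed
    \<comment> \<open>Stated for bare reals, so that the long matrix expressions stay opaque to the
      arithmetic.\<close>
    have "E \<le> 3 * (p + q' + r) + t" if "E \<le> 3 * (p + q + r)" "q \<le> q'" "0 \<le> t" for E p q q' r t :: real
    proof -
      have "3 * (p + q + r) \<le> 3 * (p + q' + r)" using that(2) by simp
      then show ?thesis using that(1,3) by (meson add_increasing2 order_trans)
    qed
    from this[OF err quad] show ?thesis
      unfolding if_P[OF True] using x by simp
  next
    case False
    \<comment> \<open>For a small matrix error \<open>B\<close> would be invertible with an inverse
      of norm at most 2 s, which by \<open>N\<close> does not exceed the threshold. Hence this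
      branch is reached only for large errors.\<close>
    have "x * s\<^sup>2 > 1 / 4"
    proof (rule ccontr)
      assume "\<not> x * s\<^sup>2 > 1 / 4"
      then have small: "frobenius_sq (B - A) * (spectral_norm (inverse_mat A))\<^sup>2 \<le> 1 / 4"
        by (simp add: x_def s_def)
      have "2 * s \<le> sqrt N" by (rule real_le_rsqrt) (use N in \<open>simp add: power_mult_distrib\<close>)
      then show False
        using inverse_perturbed[OF A inv B n small] False by (auto simp: s_def)
    qed
    then have "L\<^sup>2 * 1 \<le> L\<^sup>2 * (4 * (x * s\<^sup>2))"
      by (intro mult_left_mono) auto
    then have L: "(0 - L)\<^sup>2 \<le> 4 * L\<^sup>2 * s\<^sup>2 * x" by (simp add: mult_ac)
    have "E \<le> 3 * p + t" if "E \<le> t" "0 \<le> p" for E p t :: real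
      using that by linarith
    note this[OF L]
    moreover have "0 \<le> (a \<bullet> V)\<^sup>2 + (euclidean_norm a)\<^sup>2 * (4 * s\<^sup>2 * (x * y) + 64 * N * s ^ 6 * (x ^ 4 * y)) + (h \<bullet> c - L)\<^sup>2"
      using N0 s x y by (intro mult_nonneg_nonneg add_nonneg_nonneg) auto
    ultimately show ?thesis unfolding if_not_P[OF False] by blast
  qed
qed

section \<open>Moments of sums of independent random variables\<close>

text \<open>Jensen's inequality for a convex even power.\<close>

lemma mean_power_even_le:
  fixes x :: "'i \<Rightarrow> real"
  assumes "finite A" "A \<noteq> {}" "even p"
  shows "((\<Sum>i\<in>A. x i) / real (card A)) ^ p \<le> (\<Sum>i\<in>A. x i ^ p) / real (card A)"
proof -
  have c: "real (card A) > 0" using assms by (simp add: card_gt_0_iff)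
  have "(\<Sum>i\<in>A. (1 / real (card A)) *\<^sub>R x i) ^ p \<le> (\<Sum>i\<in>A. (1 / real (card A)) * x i ^ p)"
    by (rule convex_on_sum[OF assms(1,2) convex_power_even[OF assms(3)]]) (use c in auto)
  then show ?thesis
    by (simp add: sum_divide_distrib)
qed

section \<open>Exponential moments by Bernstein's argument\<close>

lemma exp_remainder_le:
  fixes y :: real
  shows "exp y - 1 - y \<le> (\<Sum>k. \<bar>y\<bar> ^ (k + 2) / fact (k + 2))"
    and "summable (\<lambda>k. \<bar>y\<bar> ^ (k + 2) / fact (k + 2))"
proof -
  have s: "summable (\<lambda>k. z ^ (k + 2) / fact (k + 2))" for z :: real
    using summable_ignore_initial_segment[OF summable_exp[of z], of 2]
    by (simp add: field_simps)
  then show "summable (\<lambda>k. \<bar>y\<bar> ^ (k + 2) / fact (k + 2))" .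
  have "exp y - 1 - y = (\<Sum>k. y ^ (k + 2) / fact (k + 2))"
    using exp_first_two_terms[of y] by (simp add: field_simps)
  also have "\<dots> \<le> (\<Sum>k. \<bar>y\<bar> ^ (k + 2) / fact (k + 2))"
  proof (rule suminf_le[OF _ s s])
    fix k
    have "y ^ (k + 2) \<le> \<bar>y\<bar> ^ (k + 2)"
      by (metis abs_ge_self power_abs)
    then show "y ^ (k + 2) / fact (k + 2) \<le> \<bar>y\<bar> ^ (k + 2) / fact (k + 2)"
      by (simp add: divide_right_mono)
  qed
  finally show "exp y - 1 - y \<le> (\<Sum>k. \<bar>y\<bar> ^ (k + 2) / fact (k + 2))" .
qed

context prob_space
begin

text \<open>The factorial in the moment bound cancels the one in the exponential series, leaving a
  geometric series in t = |s| B. As t is at most 1/2, its sum from the second power on is at most 2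
  t^2. The linear term vanishes by centring, and 1 + x \<le> exp x finishes.\<close>

lemma nn_expectation_exp_le:
  fixes X :: "'a \<Rightarrow> real"
  assumes X [measurable]: "X \<in> borel_measurable M"
    and B: "B > 0"
    and moments: "\<And>k. k \<ge> 2 \<Longrightarrow> (\<integral>\<^sup>+\<omega>. ennreal (\<bar>X \<omega>\<bar> ^ k) \<partial>M) \<le> ennreal (B ^ k * fact k)"
    and centred: "expectation X = 0"
    and s: "\<bar>s\<bar> * B \<le> 1 / 2"
  shows "(\<integral>\<^sup>+\<omega>. ennreal (exp (s * X \<omega>)) \<partial>M) \<le> ennreal (exp (2 * (s * B)\<^sup>2))"
proof -
  define t where "t = \<bar>s\<bar> * B"
  have t: "0 \<le> t" "t \<le> 1/2" using s B by (auto simp: t_def)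
  \<comment> \<open>Integrability of \<open>X\<close> must be secured before \<open>centred\<close>
    can be used, because the integral of a non-integrable function is 0 by default.\<close>
  have "integrable M (\<lambda>\<omega>. (X \<omega>)\<^sup>2)"
    by (rule integrableI_bounded)
      (use le_less_trans[OF moments[of 2] ennreal_less_top] in \<open>simp_all add: power2_eq_square\<close>)
  then have iX: "integrable M X" by (rule square_integrable_imp_integrable[OF X])
  define R where "R \<omega> = exp (s * X \<omega>) - 1 - s * X \<omega>" for \<omega>
  have R0: "R \<omega> \<ge> 0" for \<omega> unfolding R_def using exp_ge_add_one_self[of "s * X \<omega>"] by linarith
  have [measurable]: "R \<in> borel_measurable M" by (simp add: R_def [abs_def])
  \<comment> \<open>The remainder \<open>R\<close> is nonnegative, so its expectation is computed in
    the extended reals, where a series is integrated term by term.\<close>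
  have "(\<integral>\<^sup>+\<omega>. ennreal (R \<omega>) \<partial>M) \<le> (\<integral>\<^sup>+\<omega>. (\<Sum>k. ennreal (\<bar>s * X \<omega>\<bar> ^ (k + 2) / fact (k + 2))) \<partial>M)"
  proof (rule nn_integral_mono)
    fix \<omega>
    show "ennreal (R \<omega>) \<le> (\<Sum>k. ennreal (\<bar>s * X \<omega>\<bar> ^ (k + 2) / fact (k + 2)))"
      by (subst suminf_ennreal2) (use exp_remainder_le[of "s * X \<omega>"] in \<open>auto simp: R_def intro!: ennreal_leI\<close>)
  qed
  also have "\<dots> = (\<Sum>k. \<integral>\<^sup>+\<omega>. ennreal (\<bar>s * X \<omega>\<bar> ^ (k + 2) / fact (k + 2)) \<partial>M)"
    by (rule nn_integral_suminf) simp
  also have "\<dots> \<le> (\<Sum>k. ennreal (t ^ (k + 2)))"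
  proof (rule suminf_le)
    fix k
    have "(\<integral>\<^sup>+\<omega>. ennreal (\<bar>s * X \<omega>\<bar> ^ (k + 2) / fact (k + 2)) \<partial>M)
      = (\<integral>\<^sup>+\<omega>. ennreal (\<bar>s\<bar> ^ (k + 2) / fact (k + 2)) * ennreal (\<bar>X \<omega>\<bar> ^ (k + 2)) \<partial>M)"
      by (rule nn_integral_cong)
        (simp only: ennreal_mult[symmetric] zero_le_power abs_ge_zero divide_nonneg_nonneg fact_ge_zero,
          simp add: abs_mult power_mult_distrib mult_ac)
    also have "\<dots> = ennreal (\<bar>s\<bar> ^ (k + 2) / fact (k + 2)) * (\<integral>\<^sup>+\<omega>. ennreal (\<bar>X \<omega>\<bar> ^ (k + 2)) \<partial>M)"
      by (rule nn_integral_cmult) simp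
    also have "\<dots> \<le> ennreal (\<bar>s\<bar> ^ (k + 2) / fact (k + 2)) * ennreal (B ^ (k + 2) * fact (k + 2))"
      by (intro mult_left_mono moments) auto
    also have "\<dots> = ennreal (t ^ (k + 2))"
    proof -
      have "ennreal (\<bar>s\<bar> ^ (k + 2) / fact (k + 2)) * ennreal (B ^ (k + 2) * fact (k + 2))
        = ennreal (\<bar>s\<bar> ^ (k + 2) / fact (k + 2) * (B ^ (k + 2) * fact (k + 2)))"
        by (rule ennreal_mult[symmetric]) (use B in \<open>auto intro!: mult_nonneg_nonneg\<close>)
      also have "\<bar>s\<bar> ^ (k + 2) / fact (k + 2) * (B ^ (k + 2) * fact (k + 2)) = t ^ (k + 2)"
        by (simp add: t_def power_mult_distrib del: power_Suc power_add add_2_eq_Suc' fact_Suc)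
      finally show ?thesis .
    qed
    finally show "(\<integral>\<^sup>+\<omega>. ennreal (\<bar>s * X \<omega>\<bar> ^ (k + 2) / fact (k + 2)) \<partial>M) \<le> ennreal (t ^ (k + 2))" .
  qed auto
  also have "\<dots> = ennreal (\<Sum>k. t ^ (k + 2))"
    by (rule suminf_ennreal2) (use t in \<open>auto simp: power_add summable_geometric intro!: summable_mult2\<close>)
  also have "(\<Sum>k. t ^ (k + 2)) = t\<^sup>2 / (1 - t)"
    using t sums_unique[OF sums_mult[OF geometric_sums[of t], of "t\<^sup>2"]]
    by (simp add: power2_eq_square mult_ac)
  also have "\<dots> \<le> 2 * t\<^sup>2"
    using t mult_right_mono[of 1 "2 * (1 - t)" "t\<^sup>2"] by (simp add: divide_le_eq algebra_simps)
  finally have R: "(\<integral>\<^sup>+\<omega>. ennreal (R \<omega>) \<partial>M) \<le> ennreal (2 * t\<^sup>2)" by (simp add: ennreal_leI)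
  then have iR: "integrable M R"
    by (intro integrableI_bounded) (use R0 le_less_trans[OF R ennreal_less_top] in auto)
  have ER: "expectation R \<le> 2 * t\<^sup>2"
    using R by (simp add: nn_integral_eq_integral[OF iR] R0)
  have e: "exp (s * X \<omega>) = R \<omega> + (1 + s * X \<omega>)" for \<omega> by (simp add: R_def)
  have "integrable M (\<lambda>\<omega>. exp (s * X \<omega>))" using iR iX by (simp add: e)
  then have "(\<integral>\<^sup>+\<omega>. ennreal (exp (s * X \<omega>)) \<partial>M) = ennreal (expectation (\<lambda>\<omega>. exp (s * X \<omega>)))"
    by (rule nn_integral_eq_integral) simp
  also have "expectation (\<lambda>\<omega>. exp (s * X \<omega>)) = expectation R + 1"
    using iR iX centred by (simp add: e prob_space)
  also have "\<dots> \<le> 1 + 2 * t\<^sup>2" using ER by simp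
  also have "\<dots> \<le> exp (2 * t\<^sup>2)" by (rule exp_ge_add_one_self)
  finally show ?thesis by (simp add: ennreal_leI t_def power_mult_distrib)
qed

text \<open>By independence the expectation of the product of exponentials factorizes.\<close>

lemma nn_expectation_exp_sum_le:
  fixes X :: "'i \<Rightarrow> 'a \<Rightarrow> real"
  assumes I: "finite I" and indep: "indep_vars (\<lambda>_. borel) X I"
    and B: "B > 0"
    and moments: "\<And>i k. i \<in> I \<Longrightarrow> k \<ge> 2 \<Longrightarrow>
      (\<integral>\<^sup>+\<omega>. ennreal (\<bar>X i \<omega>\<bar> ^ k) \<partial>M) \<le> ennreal (B ^ k * fact k)"
    and centred: "\<And>i. i \<in> I \<Longrightarrow> expectation (X i) = 0"
    and s: "\<bar>s\<bar> * B \<le> 1 / 2"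
  shows "(\<integral>\<^sup>+\<omega>. ennreal (exp (s * (\<Sum>i\<in>I. X i \<omega>))) \<partial>M) \<le> ennreal (exp (2 * real (card I) * (s * B)\<^sup>2))"
proof -
  have X: "X i \<in> borel_measurable M" if "i \<in> I" for i
    using indep that by (auto simp: indep_vars_def)
  have "(\<integral>\<^sup>+\<omega>. ennreal (exp (s * (\<Sum>i\<in>I. X i \<omega>))) \<partial>M)
    = (\<integral>\<^sup>+\<omega>. (\<Prod>i\<in>I. ennreal (exp (s * X i \<omega>))) \<partial>M)"
    by (simp add: sum_distrib_left exp_sum I prod_ennreal)
  also have "\<dots> = (\<Prod>i\<in>I. \<integral>\<^sup>+\<omega>. ennreal (exp (s * X i \<omega>)) \<partial>M)"
    by (rule indep_vars_nn_integral[OF I]) (auto intro!: indep_vars_compose2[OF indep])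
  also have "\<dots> \<le> (\<Prod>i\<in>I. ennreal (exp (2 * (s * B)\<^sup>2)))"
    by (intro prod_mono_ennreal nn_expectation_exp_le X B moments centred s)
  also have "\<dots> = ennreal (exp (2 * real (card I) * (s * B)\<^sup>2))"
    by (simp add: ennreal_power exp_of_nat_mult[symmetric] mult_ac)
  finally show ?thesis .
qed

text \<open>Polynomial moments of every order follow from exponential ones through |u|^p / p! \<le>
  exp |u| \<le> exp u + exp (-u). The bound is free of the number of summands.\<close>

lemma nn_expectation_normalized_sum_power_le:
  fixes X :: "'i \<Rightarrow> 'a \<Rightarrow> real"
  assumes I: "finite I" "I \<noteq> {}" and indep: "indep_vars (\<lambda>_. borel) X I"
    and B: "B > 0"
    and moments: "\<And>i k. i \<in> I \<Longrightarrow> k \<ge> 2 \<Longrightarrow>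
      (\<integral>\<^sup>+\<omega>. ennreal (\<bar>X i \<omega>\<bar> ^ k) \<partial>M) \<le> ennreal (B ^ k * fact k)"
    and centred: "\<And>i. i \<in> I \<Longrightarrow> expectation (X i) = 0"
  shows "(\<integral>\<^sup>+\<omega>. ennreal (\<bar>(\<Sum>i\<in>I. X i \<omega>) / sqrt (real (card I))\<bar> ^ p) \<partial>M)
    \<le> ennreal ((2 * B) ^ p * fact p * (2 * exp (1 / 2)))"
proof -
  define n where "n = real (card I)"
  have n: "n \<ge> 1" using I by (simp add: n_def card_gt_0_iff Suc_le_eq)
  \<comment> \<open>The largest scale with |s| B \<le> 1/2 for n = 1, shrunk by sqrt n so that the
    exponent 2 n (s B)^2 equals 1/2 for every n.\<close>
  define s where "s = 1 / (2 * B * sqrt n)"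
  have s0: "s > 0" using n B by (simp add: s_def)
  have sB: "\<bar>s\<bar> * B = 1 / (2 * sqrt n)" using s0 B n by (simp add: s_def)
  have s1: "\<bar>s\<bar> * B \<le> 1/2" unfolding sB using n by (simp add: divide_le_eq)
  have s2: "2 * n * (s * B)\<^sup>2 = 1/2" using sB s0 n by (simp add: power_divide power_mult_distrib)
  define S where "S \<omega> = (\<Sum>i\<in>I. X i \<omega>)" for \<omega>
  have X: "X i \<in> borel_measurable M" if "i \<in> I" for i
    using indep that by (auto simp: indep_vars_def)
  have [measurable]: "S \<in> borel_measurable M" unfolding S_def [abs_def] using X by auto
  have pos: "(\<integral>\<^sup>+\<omega>. ennreal (exp (s * S \<omega>)) \<partial>M) \<le> ennreal (exp (1/2))"
    using nn_expectation_exp_sum_le[OF I(1) indep B moments centred s1]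
    unfolding n_def[symmetric] S_def[symmetric] s2 by simp
  have neg: "(\<integral>\<^sup>+\<omega>. ennreal (exp (- s * S \<omega>)) \<partial>M) \<le> ennreal (exp (1/2))"
    using nn_expectation_exp_sum_le[OF I(1) indep B moments centred, of "-s"] s1
    unfolding n_def[symmetric] S_def[symmetric] by (simp add: s2)
  define K where "K = (2 * B) ^ p * fact p"
  have K: "K > 0" using B by (simp add: K_def)
  have pw: "\<bar>S \<omega> / sqrt n\<bar> ^ p \<le> K * (exp (s * S \<omega>) + exp (- s * S \<omega>))" for \<omega>
  proof -
    have eq: "\<bar>S \<omega> / sqrt n\<bar> = 2 * B * \<bar>s * S \<omega>\<bar>"
      using B n s0 by (simp add: s_def abs_mult)
    have "\<bar>s * S \<omega>\<bar> ^ p / fact p \<le> exp \<bar>s * S \<omega>\<bar>"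
    proof -
      have "\<bar>s * S \<omega>\<bar> ^ p / fact p = (\<Sum>k\<in>{p}. \<bar>s * S \<omega>\<bar> ^ k /\<^sub>R fact k)"
        by (simp add: field_simps)
      also have "\<dots> \<le> (\<Sum>k. \<bar>s * S \<omega>\<bar> ^ k /\<^sub>R fact k)"
        by (rule sum_le_suminf[OF summable_exp_generic]) auto
      finally show ?thesis by (simp add: exp_def)
    qed
    also have "\<dots> \<le> exp (s * S \<omega>) + exp (- s * S \<omega>)"
      by (auto simp: abs_if)
    finally show ?thesis
      unfolding eq power_mult_distrib K_def
      using mult_left_mono[of "\<bar>s * S \<omega>\<bar> ^ p / fact p" "exp (s * S \<omega>) + exp (- s * S \<omega>)" "(2*B)^p * fact p"] B
      by (simp add: power_mult_distrib)
  qed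
  have "(\<integral>\<^sup>+\<omega>. ennreal (\<bar>S \<omega> / sqrt n\<bar> ^ p) \<partial>M)
    \<le> (\<integral>\<^sup>+\<omega>. ennreal K * (ennreal (exp (s * S \<omega>)) + ennreal (exp (- s * S \<omega>))) \<partial>M)"
    by (rule nn_integral_mono) 
      (use pw K in \<open>simp add: ennreal_plus[symmetric] ennreal_mult[symmetric] ennreal_leI del: ennreal_plus\<close>)
  also have "\<dots> = ennreal K * ((\<integral>\<^sup>+\<omega>. ennreal (exp (s * S \<omega>)) \<partial>M) + (\<integral>\<^sup>+\<omega>. ennreal (exp (- s * S \<omega>)) \<partial>M))"
    by (simp add: nn_integral_cmult nn_integral_add)
  also have "\<dots> \<le> ennreal K * (ennreal (exp (1/2)) + ennreal (exp (1/2)))"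
    by (intro mult_left_mono add_mono pos neg) auto
  also have "\<dots> = ennreal (K * (2 * exp (1/2)))"
    using K by (simp add: ennreal_plus[symmetric] ennreal_mult[symmetric] del: ennreal_plus)
  finally show ?thesis by (simp add: S_def n_def K_def)
qed

section \<open>Second and fourth moments of centred sums\<close>

lemma expectation_sum_power2_le:
  fixes X :: "'i \<Rightarrow> 'a \<Rightarrow> real"
  assumes I: "finite I" and indep: "indep_vars (\<lambda>_. borel) X I"
    and int: "\<And>i. i \<in> I \<Longrightarrow> integrable M (\<lambda>\<omega>. (X i \<omega>)\<^sup>2)"
    and centred: "\<And>i. i \<in> I \<Longrightarrow> expectation (X i) = 0"
    and bound: "\<And>i. i \<in> I \<Longrightarrow> expectation (\<lambda>\<omega>. (X i \<omega>)\<^sup>2) \<le> v"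
  shows "integrable M (\<lambda>\<omega>. (\<Sum>i\<in>I. X i \<omega>)\<^sup>2)"
    and "expectation (\<lambda>\<omega>. (\<Sum>i\<in>I. X i \<omega>)\<^sup>2) \<le> real (card I) * v"
proof -
  have "integrable M (\<lambda>\<omega>. (\<Sum>i\<in>I. X i \<omega>)\<^sup>2) \<and>
    expectation (\<lambda>\<omega>. (\<Sum>i\<in>I. X i \<omega>)\<^sup>2) \<le> real (card I) * v"
    using assms
  proof (induction I rule: finite_induct)
    case (insert i I)
    define S where "S \<omega> = (\<Sum>i\<in>I. X i \<omega>)" for \<omega>
    have ind: "indep_var borel (X i) borel S"
      unfolding S_def [abs_def] by (rule indep_vars_sum) (use insert in auto)
    have X: "X j \<in> borel_measurable M" if "j \<in> insert i I" for j
      using insert.prems(1) that by (auto simp: indep_vars_def)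
    have iX: "integrable M (X j)" if "j \<in> insert i I" for j
      using square_integrable_imp_integrable[OF X[OF that] insert.prems(2)[OF that]] .
    have S2: "integrable M (\<lambda>\<omega>. (S \<omega>)\<^sup>2)" "expectation (\<lambda>\<omega>. (S \<omega>)\<^sup>2) \<le> real (card I) * v"
      using insert.IH[OF indep_vars_subset[OF insert.prems(1)]] insert.prems by (auto simp: S_def)
    have S: "integrable M S" "expectation S = 0"
      using iX insert.prems(3) by (auto simp: S_def [abs_def])
    \<comment> \<open>The new variable is independent of the partial sum \<open>S\<close> and both
      are centred, so the cross term drops out and second moments add up.\<close>
    have XS: "integrable M (\<lambda>\<omega>. X i \<omega> * S \<omega>)" "expectation (\<lambda>\<omega>. X i \<omega> * S \<omega>) = 0"
      using indep_var_integrable[OF ind] indep_var_lebesgue_integral[OF ind] iX S by auto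
    have eq: "(\<Sum>i\<in>insert i I. X i \<omega>)\<^sup>2 = (X i \<omega>)\<^sup>2 + 2 * (X i \<omega> * S \<omega>) + (S \<omega>)\<^sup>2" for \<omega>
      using insert.hyps by (simp add: S_def power2_sum algebra_simps)
    show ?case
      unfolding eq using insert.prems(2,4)[of i] S2 XS insert.hyps
      by (simp add: distrib_right)
  qed simp
  then show "integrable M (\<lambda>\<omega>. (\<Sum>i\<in>I. X i \<omega>)\<^sup>2)"
    and "expectation (\<lambda>\<omega>. (\<Sum>i\<in>I. X i \<omega>)\<^sup>2) \<le> real (card I) * v" by auto
qed

lemma integrable_power_mono:
  fixes X :: "'a \<Rightarrow> real"
  assumes X [measurable]: "X \<in> borel_measurable M" and int: "integrable M (\<lambda>\<omega>. X \<omega> ^ p)"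
    and "even p" "k \<le> p"
  shows "integrable M (\<lambda>\<omega>. X \<omega> ^ k)"
proof (rule Bochner_Integration.integrable_bound[of M "\<lambda>\<omega>. 1 + X \<omega> ^ p"])
  show "AE \<omega> in M. norm (X \<omega> ^ k) \<le> norm (1 + X \<omega> ^ p)"
  proof (rule AE_I2)
    fix \<omega>
    have "\<bar>X \<omega>\<bar> ^ k \<le> 1 + \<bar>X \<omega>\<bar> ^ p"
    proof (cases "\<bar>X \<omega>\<bar> \<le> 1")
      case True
      then show ?thesis using power_le_one[of "\<bar>X \<omega>\<bar>" k] zero_le_power[of "\<bar>X \<omega>\<bar>" p] by linarith
    next
      case False
      then show ?thesis using power_increasing[OF \<open>k \<le> p\<close>, of "\<bar>X \<omega>\<bar>"] by linarith
    qed
    then show "norm (X \<omega> ^ k) \<le> norm (1 + X \<omega> ^ p)"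
      using \<open>even p\<close> by (simp add: power_abs power_even_abs)
  qed
qed (use int in auto)

text \<open>Induction over the index set. In the binomial expansion of the fourth power of X + S,
  the two terms containing a first power vanish by independence and centring; the mixed term of
  second powers is what makes the growth quadratic.\<close>

lemma expectation_sum_power4_le:
  fixes X :: "'i \<Rightarrow> 'a \<Rightarrow> real"
  assumes I: "finite I" and indep: "indep_vars (\<lambda>_. borel) X I"
    and int: "\<And>i. i \<in> I \<Longrightarrow> integrable M (\<lambda>\<omega>. X i \<omega> ^ 4)"
    and centred: "\<And>i. i \<in> I \<Longrightarrow> expectation (X i) = 0"
    and bound: "\<And>i. i \<in> I \<Longrightarrow> expectation (\<lambda>\<omega>. X i \<omega> ^ 4) \<le> C"
    and C: "C \<ge> 0"
  shows "integrable M (\<lambda>\<omega>. (\<Sum>i\<in>I. X i \<omega>) ^ 4)"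
    and "expectation (\<lambda>\<omega>. (\<Sum>i\<in>I. X i \<omega>) ^ 4) \<le> 3 * (real (card I))\<^sup>2 * C"
proof -
  have "integrable M (\<lambda>\<omega>. (\<Sum>i\<in>I. X i \<omega>) ^ 4) \<and>
    expectation (\<lambda>\<omega>. (\<Sum>i\<in>I. X i \<omega>) ^ 4) \<le> 3 * (real (card I))\<^sup>2 * C"
    using I indep int centred bound
  proof (induction I rule: finite_induct)
    case (insert i I)
    define S where "S \<omega> = (\<Sum>i\<in>I. X i \<omega>)" for \<omega>
    have ind: "indep_var borel (X i) borel S"
      unfolding S_def [abs_def] by (rule indep_vars_sum) (use insert in auto)
    have X [measurable]: "X j \<in> borel_measurable M" if "j \<in> insert i I" for j
      using insert.prems(1) that by (auto simp: indep_vars_def)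
    have [measurable]: "S \<in> borel_measurable M" using X by (auto simp: S_def [abs_def])
    have iX: "integrable M (\<lambda>\<omega>. X j \<omega> ^ k)" if "j \<in> insert i I" "k \<le> 4" for j k
      by (rule integrable_power_mono[OF X insert.prems(2)]) (use that in auto)
    \<comment> \<open>The variance of the square is nonnegative, so the second moment is at most the
      root of the fourth.\<close>
    have ES2: "expectation (\<lambda>\<omega>. (X j \<omega>)\<^sup>2) \<le> sqrt C" if "j \<in> insert i I" for j
    proof (rule real_le_rsqrt)
      have "0 \<le> variance (\<lambda>\<omega>. (X j \<omega>)\<^sup>2)" by (rule variance_positive)
      also have "\<dots> = expectation (\<lambda>\<omega>. ((X j \<omega>)\<^sup>2)\<^sup>2) - (expectation (\<lambda>\<omega>. (X j \<omega>)\<^sup>2))\<^sup>2"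
        by (rule variance_eq) (use iX[OF that] in \<open>auto simp flip: power_mult\<close>)
      finally show "(expectation (\<lambda>\<omega>. (X j \<omega>)\<^sup>2))\<^sup>2 \<le> C"
        using insert.prems(4)[OF that] by (simp flip: power_mult)
    qed
    have S4: "integrable M (\<lambda>\<omega>. S \<omega> ^ 4)" "expectation (\<lambda>\<omega>. S \<omega> ^ 4) \<le> 3 * (real (card I))\<^sup>2 * C"
      using insert.IH[OF indep_vars_subset[OF insert.prems(1)]] insert.prems by (auto simp: S_def)
    have iS: "integrable M (\<lambda>\<omega>. S \<omega> ^ k)" if "k \<le> 4" for k
      by (rule integrable_power_mono[OF _ S4(1)]) (use that in auto)
    have S2: "expectation (\<lambda>\<omega>. (S \<omega>)\<^sup>2) \<le> real (card I) * sqrt C"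
      unfolding S_def
      by (rule expectation_sum_power2_le)
        (use insert.hyps insert.prems(3) iX[of _ 2] ES2 indep_vars_subset[OF insert.prems(1)] in auto)
    have ES: "expectation S = 0"
      using iX[of _ 1] insert.prems(3) by (auto simp: S_def [abs_def])
    have prod: "integrable M (\<lambda>\<omega>. X i \<omega> ^ k * S \<omega> ^ l)"
      "expectation (\<lambda>\<omega>. X i \<omega> ^ k * S \<omega> ^ l) = expectation (\<lambda>\<omega>. X i \<omega> ^ k) * expectation (\<lambda>\<omega>. S \<omega> ^ l)"
      if "k \<le> 4" "l \<le> 4" for k l
    proof -
      have kl: "indep_var borel (\<lambda>\<omega>. X i \<omega> ^ k) borel (\<lambda>\<omega>. S \<omega> ^ l)"
        using indep_var_compose[OF ind, of "\<lambda>x. x ^ k" borel "\<lambda>x. x ^ l" borel] by (simp add: comp_def)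
      show "integrable M (\<lambda>\<omega>. X i \<omega> ^ k * S \<omega> ^ l)"
        by (rule indep_var_integrable[OF kl]) (use iX iS that in auto)
      show "expectation (\<lambda>\<omega>. X i \<omega> ^ k * S \<omega> ^ l) = expectation (\<lambda>\<omega>. X i \<omega> ^ k) * expectation (\<lambda>\<omega>. S \<omega> ^ l)"
        by (rule indep_var_lebesgue_integral[OF kl]) (use iX iS that in auto)
    qed
    \<comment> \<open>Trivial powers 0 and 1 are kept so that each term has the shape covered by
      \<open>prod\<close>.\<close>
    have eq: "(\<Sum>i\<in>insert i I. X i \<omega>) ^ 4 = X i \<omega> ^ 4 * S \<omega> ^ 0 + 4 * (X i \<omega> ^ 3 * S \<omega> ^ 1)
        + 6 * (X i \<omega> ^ 2 * S \<omega> ^ 2) + 4 * (X i \<omega> ^ 1 * S \<omega> ^ 3) + X i \<omega> ^ 0 * S \<omega> ^ 4" for \<omega>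
      using insert.hyps by (simp add: S_def power4_eq_xxxx power2_eq_square power3_eq_cube algebra_simps)
    have Ei: "expectation (X i) = 0" using insert.prems(3) by simp
    have int: "integrable M (\<lambda>\<omega>. (\<Sum>i\<in>insert i I. X i \<omega>) ^ 4)"
      unfolding eq by (intro Bochner_Integration.integrable_add integrable_mult_right prod) auto
    have "expectation (\<lambda>\<omega>. (\<Sum>i\<in>insert i I. X i \<omega>) ^ 4)
      = expectation (\<lambda>\<omega>. X i \<omega> ^ 4) + 6 * (expectation (\<lambda>\<omega>. (X i \<omega>)\<^sup>2) * expectation (\<lambda>\<omega>. (S \<omega>)\<^sup>2))
        + expectation (\<lambda>\<omega>. S \<omega> ^ 4)"
      unfolding eq 
      apply (subst Bochner_Integration.integral_add, (intro Bochner_Integration.integrable_add integrable_mult_right prod; simp), 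
          (intro Bochner_Integration.integrable_add integrable_mult_right prod; simp))+
      by (simp only: integral_mult_right_zero prod order_refl, simp add: prod Ei ES prob_space)
    also have "\<dots> \<le> C + 6 * (sqrt C * (real (card I) * sqrt C)) + 3 * (real (card I))\<^sup>2 * C"
      using insert.prems(4)[of i] S4(2) ES2[of i] S2 C
      by (intro add_mono mult_left_mono mult_mono) auto
    also have "\<dots> = C + 6 * real (card I) * C + 3 * (real (card I))\<^sup>2 * C"
      using C real_sqrt_mult_self[of C] by (simp add: algebra_simps)
    \<comment> \<open>With k the old cardinality, C + 6 k C + 3 k^2 C is at most 3 (k + 1)^2 C; the
      leading constant 3 is chosen to absorb the mixed term 6 k C.\<close>
    also have "\<dots> \<le> 3 * (real (card (insert i I)))\<^sup>2 * C"
      using insert.hyps C by (simp add: power2_eq_square algebra_simps)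
    finally show ?case using int by simp
  qed simp
  then show "integrable M (\<lambda>\<omega>. (\<Sum>i\<in>I. X i \<omega>) ^ 4)"
    and "expectation (\<lambda>\<omega>. (\<Sum>i\<in>I. X i \<omega>) ^ 4) \<le> 3 * (real (card I))\<^sup>2 * C" by auto
qed

end

section \<open>Conditional expectations and expansions in an orthonormal basis\<close>

lemma vimage_algebra_factorization_nonneg:
  fixes X :: "'a \<Rightarrow> real"
  assumes X: "X \<in> borel_measurable (vimage_algebra \<Omega> W MW)" "\<And>\<omega>. 0 \<le> X \<omega>" and W: "W \<in> \<Omega> \<rightarrow> space MW"
  shows "\<exists>\<psi>\<in>borel_measurable MW. \<forall>\<omega>\<in>\<Omega>. X \<omega> = \<psi> (W \<omega>)"
  using X
proof (induction rule: borel_measurable_induct_real)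
  case (set A)
  then obtain B where B: "B \<in> sets MW" "A = W -` B \<inter> \<Omega>"
    by (auto simp: sets_vimage_algebra2[OF W])
  then show ?case
    by (intro bexI[of _ "indicator B"]) (auto simp: indicator_def)
next
  case (mult u c)
  then obtain \<psi> where "\<psi> \<in> borel_measurable MW" "\<forall>\<omega>\<in>\<Omega>. u \<omega> = \<psi> (W \<omega>)" by blast
  then show ?case by (intro bexI[of _ "\<lambda>w. c * \<psi> w"]) auto
next
  case (add u v)
  then obtain \<psi> \<chi> where "\<psi> \<in> borel_measurable MW" "\<forall>\<omega>\<in>\<Omega>. u \<omega> = \<psi> (W \<omega>)"
    "\<chi> \<in> borel_measurable MW" "\<forall>\<omega>\<in>\<Omega>. v \<omega> = \<chi> (W \<omega>)" by blast
  then show ?case by (intro bexI[of _ "\<lambda>w. \<chi> w + \<psi> w"]) auto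
next
  case (seq U)
  then have "\<forall>i. \<exists>\<psi>. \<psi> \<in> borel_measurable MW \<and> (\<forall>\<omega>\<in>\<Omega>. U i \<omega> = \<psi> (W \<omega>))" by blast
  then obtain \<psi> where \<psi>: "\<And>i. \<psi> i \<in> borel_measurable MW" "\<And>i. \<forall>\<omega>\<in>\<Omega>. U i \<omega> = \<psi> i (W \<omega>)"
    by metis
  show ?case
  \<comment> \<open>Off the range of \<open>W\<close> the functions \<open>\<psi> i\<close> need not
    converge. The pointwise \<open>lim\<close> is measurable nevertheless, and only its values at
    points \<open>W \<omega>\<close> matter.\<close>
  proof (intro bexI[of _ "\<lambda>w. lim (\<lambda>i. \<psi> i w)"] ballI)
    fix \<omega> assume \<omega>: "\<omega> \<in> \<Omega>"
    have "(\<lambda>i. U i \<omega>) \<longlonglongrightarrow> X \<omega>" by (rule seq.hyps) (use \<omega> in simp)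
    then have "(\<lambda>i. \<psi> i (W \<omega>)) \<longlonglongrightarrow> X \<omega>"
      using \<psi>(2) \<omega> by simp
    then show "X \<omega> = lim (\<lambda>i. \<psi> i (W \<omega>))" by (simp add: limI)
  qed (use \<psi>(1) in measurable)
qed

text \<open>The Doob-Dynkin lemma. The induction over simple functions handles nonnegative
  functions, hence the split into positive and negative parts.\<close>

lemma vimage_algebra_factorization:
  fixes X :: "'a \<Rightarrow> real"
  assumes X: "X \<in> borel_measurable (vimage_algebra \<Omega> W MW)" and W: "W \<in> \<Omega> \<rightarrow> space MW"
  shows "\<exists>\<psi>\<in>borel_measurable MW. \<forall>\<omega>\<in>\<Omega>. X \<omega> = \<psi> (W \<omega>)"
proof -
  have "(\<lambda>\<omega>. max 0 (X \<omega>)) \<in> borel_measurable (vimage_algebra \<Omega> W MW)"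
    by (rule borel_measurable_max[OF X borel_measurable_const])
  from vimage_algebra_factorization_nonneg[OF this max.cobounded1 W]
  obtain \<psi> where \<psi>: "\<psi> \<in> borel_measurable MW" "\<forall>\<omega>\<in>\<Omega>. max 0 (X \<omega>) = \<psi> (W \<omega>)"
    by blast
  have "(\<lambda>\<omega>. max 0 (- X \<omega>)) \<in> borel_measurable (vimage_algebra \<Omega> W MW)"
    by (rule borel_measurable_max[OF borel_measurable_uminus[OF X] borel_measurable_const])
  from vimage_algebra_factorization_nonneg[OF this max.cobounded1 W]
  obtain \<chi> where \<chi>: "\<chi> \<in> borel_measurable MW" "\<forall>\<omega>\<in>\<Omega>. max 0 (- X \<omega>) = \<chi> (W \<omega>)"
    by blast
  show ?thesis
  proof (intro bexI[of _ "\<lambda>w. \<psi> w - \<chi> w"] ballI)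
    fix \<omega> assume "\<omega> \<in> \<Omega>"
    then have "max 0 (X \<omega>) = \<psi> (W \<omega>)" "max 0 (- X \<omega>) = \<chi> (W \<omega>)"
      using \<psi>(2) \<chi>(2) by auto
    moreover have "X \<omega> = max 0 (X \<omega>) - max 0 (- X \<omega>)" by (simp add: max_def)
    ultimately show "X \<omega> = \<psi> (W \<omega>) - \<chi> (W \<omega>)" by metis
  qed (rule borel_measurable_diff[OF \<psi>(1) \<chi>(1)])
qed

section \<open>Conditional expectations given the instrument\<close>

context prob_space
begin

lemma sigma_finite_subalgebra_sigma_of:
  assumes W: "W \<in> M \<rightarrow>\<^sub>M MW"
  shows "sigma_finite_subalgebra M (sigma_of M W MW)"
proof (rule finite_measure_subalgebra_is_sigma_finite)
  show "finite_measure_subalgebra M (sigma_of M W MW)"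
  proof (intro finite_measure_subalgebra.intro finite_measure_subalgebra_axioms.intro)
    show "finite_measure M" by (rule finite_measure_axioms)
    show "subalgebra M (sigma_of M W MW)"
      unfolding subalgebra_def sigma_of_def using sets_image_in_sets[OF refl W] by simp
  qed
qed

lemma measurable_sigma_of:
  assumes W: "W \<in> M \<rightarrow>\<^sub>M MW"
  shows "W \<in> sigma_of M W MW \<rightarrow>\<^sub>M MW"
  unfolding sigma_of_def by (rule measurable_vimage_algebra1) (use measurable_space[OF W] in auto)

text \<open>\<open>cond_exp_fun\<close> is a Hilbert choice; the factorization through
  \<open>W\<close> provides the witness that gives it its two properties.\<close>

lemma cond_exp_fun:
  assumes W: "W \<in> M \<rightarrow>\<^sub>M MW"
  shows "cond_exp_fun M W MW X \<in> borel_measurable MW"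
    and "AE \<omega> in M. cond_exp_fun M W MW X (W \<omega>) = real_cond_exp M (sigma_of M W MW) X \<omega>"
proof -
  have "\<exists>\<psi>\<in>borel_measurable MW. \<forall>\<omega>\<in>space M. real_cond_exp M (sigma_of M W MW) X \<omega> = \<psi> (W \<omega>)"
  proof (rule vimage_algebra_factorization)
    show "real_cond_exp M (sigma_of M W MW) X \<in> borel_measurable (vimage_algebra (space M) W MW)"
      using borel_measurable_cond_exp[of M "sigma_of M W MW" X] unfolding sigma_of_def .
    show "W \<in> space M \<rightarrow> space MW"
      using measurable_space[OF W] by blast
  qed
  then have "\<exists>\<psi>. \<psi> \<in> borel_measurable MW \<and>
      (AE \<omega> in M. \<psi> (W \<omega>) = real_cond_exp M (sigma_of M W MW) X \<omega>)"
    by (metis (mono_tags, lifting) AE_I2)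
  from someI_ex[OF this]
  show "cond_exp_fun M W MW X \<in> borel_measurable MW"
    and "AE \<omega> in M. cond_exp_fun M W MW X (W \<omega>) = real_cond_exp M (sigma_of M W MW) X \<omega>"
    unfolding cond_exp_fun_def by auto
qed

text \<open>Coefficients of a regression function are ordinary expectations. This is why sample
  averages estimate both the operator matrix and the coefficients of \<open>g\<close>.\<close>

lemma L2_inner_cond_exp_fun:
  assumes W [measurable]: "W \<in> M \<rightarrow>\<^sub>M MW" and X [measurable]: "X \<in> borel_measurable M"
    and f [measurable]: "f \<in> borel_measurable MW"
    and int: "integrable M (\<lambda>\<omega>. X \<omega> * f (W \<omega>))"
  shows "L2_inner (distr M MW W) (cond_exp_fun M W MW X) f = expectation (\<lambda>\<omega>. X \<omega> * f (W \<omega>))"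
proof -
  note sub = sigma_finite_subalgebra_sigma_of[OF W]
  note c = cond_exp_fun(1)[OF W, of X]
  have fF: "(\<lambda>\<omega>. f (W \<omega>)) \<in> borel_measurable (sigma_of M W MW)"
    by (rule measurable_compose[OF measurable_sigma_of[OF W] f])
  have "L2_inner (distr M MW W) (cond_exp_fun M W MW X) f
    = expectation (\<lambda>\<omega>. cond_exp_fun M W MW X (W \<omega>) * f (W \<omega>))"
    unfolding L2_inner_def by (rule integral_distr[OF W borel_measurable_times[OF c f]])
  also have "\<dots> = expectation (\<lambda>\<omega>. f (W \<omega>) * real_cond_exp M (sigma_of M W MW) X \<omega>)"
  proof (rule integral_cong_AE)
    show "(\<lambda>\<omega>. cond_exp_fun M W MW X (W \<omega>) * f (W \<omega>)) \<in> borel_measurable M"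
      by (rule borel_measurable_times[OF measurable_compose[OF W c] measurable_compose[OF W f]])
    show "(\<lambda>\<omega>. f (W \<omega>) * real_cond_exp M (sigma_of M W MW) X \<omega>) \<in> borel_measurable M"
      by (rule borel_measurable_times[OF measurable_compose[OF W f] borel_measurable_cond_exp2])
    show "AE \<omega> in M. cond_exp_fun M W MW X (W \<omega>) * f (W \<omega>) = f (W \<omega>) * real_cond_exp M (sigma_of M W MW) X \<omega>"
      using cond_exp_fun(2)[OF W, of X] by eventually_elim simp
  qed
  also have "\<dots> = expectation (\<lambda>\<omega>. f (W \<omega>) * X \<omega>)"
    by (rule sigma_finite_subalgebra.real_cond_exp_intg(2)[OF sub _ fF X]) (use int in \<open>simp add: mult.commute\<close>)
  finally show ?thesis by (simp add: mult.commute)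
qed

text \<open>A function of \<open>W\<close> can be moved out of the conditional expectation. In the
  extended nonnegative reals this raises no question of integrability.\<close>

lemma nn_expectation_mult_le:
  assumes W [measurable]: "W \<in> M \<rightarrow>\<^sub>M MW" and X [measurable]: "X \<in> borel_measurable M"
    and F [measurable]: "F \<in> borel_measurable MW"
    and bound: "AE \<omega> in M. nn_cond_exp M (sigma_of M W MW) X \<omega> \<le> c"
  shows "(\<integral>\<^sup>+\<omega>. F (W \<omega>) * X \<omega> \<partial>M) \<le> c * (\<integral>\<^sup>+\<omega>. F (W \<omega>) \<partial>M)"
proof -
  note sub = sigma_finite_subalgebra_sigma_of[OF W]
  have FF: "(\<lambda>\<omega>. F (W \<omega>)) \<in> borel_measurable (sigma_of M W MW)"
    by (rule measurable_compose[OF measurable_sigma_of[OF W] F])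
  have "(\<integral>\<^sup>+\<omega>. F (W \<omega>) * X \<omega> \<partial>M) = (\<integral>\<^sup>+\<omega>. F (W \<omega>) * nn_cond_exp M (sigma_of M W MW) X \<omega> \<partial>M)"
    by (rule sigma_finite_subalgebra.nn_cond_exp_intg[OF sub FF X, symmetric])
  also have "\<dots> \<le> (\<integral>\<^sup>+\<omega>. c * F (W \<omega>) \<partial>M)"
  proof (rule nn_integral_mono_AE)
    show "AE \<omega> in M. F (W \<omega>) * nn_cond_exp M (sigma_of M W MW) X \<omega> \<le> c * F (W \<omega>)"
      using bound by eventually_elim (simp add: mult.commute[of c] mult_left_mono)
  qed
  also have "\<dots> = c * (\<integral>\<^sup>+\<omega>. F (W \<omega>) \<partial>M)"
    by (rule nn_integral_cmult[OF measurable_compose[OF W F]])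
  finally show ?thesis .
qed

end

section \<open>Square integrable functions and basis expansions\<close>

lemma L2_space_integrable_mult:
  assumes "\<phi> \<in> L2_space P" "\<psi> \<in> L2_space P"
  shows "integrable P (\<lambda>x. \<phi> x * \<psi> x)"
proof (rule Bochner_Integration.integrable_bound[of P "\<lambda>x. (\<phi> x)\<^sup>2 + (\<psi> x)\<^sup>2"])
  show "AE x in P. norm (\<phi> x * \<psi> x) \<le> norm ((\<phi> x)\<^sup>2 + (\<psi> x)\<^sup>2)"
  proof (rule AE_I2)
    fix x
    have "2 * \<bar>\<phi> x\<bar> * \<bar>\<psi> x\<bar> \<le> (\<phi> x)\<^sup>2 + (\<psi> x)\<^sup>2"
      using sum_squares_bound[of "\<bar>\<phi> x\<bar>" "\<bar>\<psi> x\<bar>"] by simp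
    moreover have "0 \<le> \<bar>\<phi> x\<bar> * \<bar>\<psi> x\<bar>" by simp
    ultimately have "\<bar>\<phi> x\<bar> * \<bar>\<psi> x\<bar> \<le> (\<phi> x)\<^sup>2 + (\<psi> x)\<^sup>2" by linarith
    then show "norm (\<phi> x * \<psi> x) \<le> norm ((\<phi> x)\<^sup>2 + (\<psi> x)\<^sup>2)" by (simp add: abs_mult)
  qed
qed (use assms in \<open>auto simp: L2_space_def\<close>)

lemma L2_space_add:
  assumes "\<phi> \<in> L2_space P" "\<psi> \<in> L2_space P"
  shows "(\<lambda>x. \<phi> x + \<psi> x) \<in> L2_space P"
  using assms L2_space_integrable_mult[OF assms]
  by (auto simp: L2_space_def power2_sum mult.assoc)

lemma L2_space_mult:
  assumes "\<phi> \<in> L2_space P"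
  shows "(\<lambda>x. c * \<phi> x) \<in> L2_space P"
  using assms by (auto simp: L2_space_def power_mult_distrib)

lemma L2_space_diff:
  assumes "\<phi> \<in> L2_space P" "\<psi> \<in> L2_space P"
  shows "(\<lambda>x. \<phi> x - \<psi> x) \<in> L2_space P"
  using L2_space_add[OF assms(1) L2_space_mult[OF assms(2), of "-1"]] by simp

lemma L2_space_sum:
  assumes "\<And>i. i \<in> I \<Longrightarrow> \<phi> i \<in> L2_space P"
  shows "(\<lambda>x. \<Sum>i\<in>I. \<phi> i x) \<in> L2_space P"
proof (cases "finite I")
  case True
  then show ?thesis using assms
  proof (induction I)
    case empty
    then show ?case by (simp add: L2_space_def)
  next
    case (insert i I)
    then show ?case using L2_space_add[of "\<phi> i" P "\<lambda>x. \<Sum>i\<in>I. \<phi> i x"] by simp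
  qed
qed (simp add: L2_space_def)

lemma basis_coeff_diff_expansion:
  assumes e: "orthonormal_basis P e" and \<phi>: "\<phi> \<in> L2_space P"
  shows "basis_coeff P e (\<lambda>x. \<phi> x - (\<Sum>j<k. c j * e j x)) i = basis_coeff P e \<phi> i - (if i < k then c i else 0)"
proof -
  have eL: "e j \<in> L2_space P" for j using e by (simp add: orthonormal_basis_def)
  have "basis_coeff P e (\<lambda>x. \<phi> x - (\<Sum>j<k. c j * e j x)) i
    = (\<integral>x. \<phi> x * e i x - (\<Sum>j<k. c j * (e j x * e i x)) \<partial>P)"
    by (simp add: basis_coeff_def L2_inner_def left_diff_distrib sum_distrib_right mult.assoc)
  also have "\<dots> = basis_coeff P e \<phi> i - (\<Sum>j<k. c j * L2_inner P (e j) (e i))"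
    using L2_space_integrable_mult[OF \<phi> eL] L2_space_integrable_mult[OF eL eL]
    by (subst Bochner_Integration.integral_diff) (auto simp: basis_coeff_def L2_inner_def)
  also have "(\<Sum>j<k. c j * L2_inner P (e j) (e i)) = (\<Sum>j<k. if j = i then c j else 0)"
    using e by (intro sum.cong) (auto simp: orthonormal_basis_def)
  finally show ?thesis by (simp add: sum.delta)
qed

text \<open>Norm convergence of the expansion says that the squared remainders tend to 0 in L1, so
  they tend to 0 almost everywhere along a subsequence. That suffices for pointwise
  majorants.\<close>

lemma L2_expansion_AE_subseq:
  assumes e: "orthonormal_basis P e" and \<delta>: "\<delta> \<in> L2_space P"
  obtains r :: "nat \<Rightarrow> nat" where
    "AE x in P. (\<lambda>n. \<Sum>j<r n. basis_coeff P e \<delta> j * e j x) \<longlonglongrightarrow> \<delta> x"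
proof -
  define R where "R k x = \<delta> x - (\<Sum>j<k. basis_coeff P e \<delta> j * e j x)" for k x
  have eL: "e j \<in> L2_space P" for j using e by (simp add: orthonormal_basis_def)
  have RL: "R k \<in> L2_space P" for k
    unfolding R_def [abs_def] by (intro L2_space_diff \<delta> L2_space_sum L2_space_mult eL)
  have "(\<lambda>k. L2_norm P (R k)) \<longlonglongrightarrow> 0"
    using e \<delta> by (auto simp: orthonormal_basis_def R_def [abs_def] basis_coeff_def)
  then have "(\<lambda>k. (L2_norm P (R k))\<^sup>2) \<longlonglongrightarrow> 0\<^sup>2" by (rule tendsto_power)
  moreover have "(L2_norm P (R k))\<^sup>2 = (\<integral>x. norm ((R k x)\<^sup>2) \<partial>P)" for k
    by (simp add: L2_norm_def L2_inner_def power2_eq_square[symmetric])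
  ultimately have "(\<lambda>k. \<integral>x. norm ((R k x)\<^sup>2) \<partial>P) \<longlonglongrightarrow> 0" by simp
  then obtain r where r: "AE x in P. (\<lambda>n. (R (r n) x)\<^sup>2) \<longlonglongrightarrow> 0"
    using tendsto_L1_AE_subseq[of P "\<lambda>k x. (R k x)\<^sup>2"] RL by (auto simp: L2_space_def)
  have "AE x in P. (\<lambda>n. \<Sum>j<r n. basis_coeff P e \<delta> j * e j x) \<longlonglongrightarrow> \<delta> x"
    using r
  proof eventually_elim
    case (elim x)
    then have "(\<lambda>n. sqrt ((R (r n) x)\<^sup>2)) \<longlonglongrightarrow> sqrt 0" by (rule tendsto_real_sqrt)
    then have "(\<lambda>n. R (r n) x) \<longlonglongrightarrow> 0" by (simp add: tendsto_rabs_zero_iff)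
    then have "(\<lambda>n. \<delta> x - R (r n) x) \<longlonglongrightarrow> \<delta> x - 0" by (intro tendsto_diff tendsto_const)
    then show ?case by (simp add: R_def)
  qed
  then show ?thesis by (rule that)
qed

text \<open>Cauchy-Schwarz with sqrt(w) d against u / sqrt(w). For the fourth power the result is
  squared and Cauchy-Schwarz is used once more with 1 / sqrt(w) split off, at the price of the sum
  of the inverse weights.\<close>

lemma weighted_partial_sum_bounds:
  fixes d w u :: "nat \<Rightarrow> real"
  assumes w: "\<And>j. w j > 0" and d: "summable (\<lambda>j. w j * (d j)\<^sup>2)" and wi: "summable (\<lambda>j. 1 / w j)"
  shows "(\<Sum>j<k. d j * u j)\<^sup>2 \<le> (weighted_norm w d)\<^sup>2 * (\<Sum>j<k. (u j)\<^sup>2 / w j)"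
    and "(\<Sum>j<k. d j * u j) ^ 4 \<le> weighted_norm w d ^ 4 * (\<Sum>j. 1 / w j) * (\<Sum>j<k. u j ^ 4 / w j)"
proof -
  have wn: "(weighted_norm w d)\<^sup>2 = (\<Sum>j. w j * (d j)\<^sup>2)"
    unfolding weighted_norm_def using w by (intro real_sqrt_pow2 suminf_nonneg d mult_nonneg_nonneg) (auto intro: less_imp_le)
  have "(\<Sum>j<k. d j * u j)\<^sup>2 = (\<Sum>j<k. (sqrt (w j) * d j) * (u j / sqrt (w j)))\<^sup>2"
    using w by (intro arg_cong[of _ _ "\<lambda>x. x\<^sup>2"] sum.cong) (auto simp: less_imp_neq[OF w, symmetric])
  also have "\<dots> \<le> (\<Sum>j<k. (sqrt (w j) * d j)\<^sup>2) * (\<Sum>j<k. (u j / sqrt (w j))\<^sup>2)"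
    by (rule Cauchy_Schwarz_ineq_sum)
  also have "\<dots> = (\<Sum>j<k. w j * (d j)\<^sup>2) * (\<Sum>j<k. (u j)\<^sup>2 / w j)"
    using w by (simp add: power_mult_distrib power_divide less_imp_le)
  also have "\<dots> \<le> (weighted_norm w d)\<^sup>2 * (\<Sum>j<k. (u j)\<^sup>2 / w j)"
    unfolding wn using w by (intro mult_right_mono sum_le_suminf d sum_nonneg) (auto simp: less_imp_le)
  finally show 1: "(\<Sum>j<k. d j * u j)\<^sup>2 \<le> (weighted_norm w d)\<^sup>2 * (\<Sum>j<k. (u j)\<^sup>2 / w j)" .
  have "(\<Sum>j<k. (u j)\<^sup>2 / w j)\<^sup>2 = (\<Sum>j<k. (1 / sqrt (w j)) * ((u j)\<^sup>2 / sqrt (w j)))\<^sup>2"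
    using w by (intro arg_cong[of _ _ "\<lambda>x. x\<^sup>2"] sum.cong) (auto simp: less_imp_le)
  also have "\<dots> \<le> (\<Sum>j<k. (1 / sqrt (w j))\<^sup>2) * (\<Sum>j<k. ((u j)\<^sup>2 / sqrt (w j))\<^sup>2)"
    by (rule Cauchy_Schwarz_ineq_sum)
  also have "\<dots> = (\<Sum>j<k. 1 / w j) * (\<Sum>j<k. u j ^ 4 / w j)"
    using w by (simp add: power_divide less_imp_le flip: power_mult)
  also have "\<dots> \<le> (\<Sum>j. 1 / w j) * (\<Sum>j<k. u j ^ 4 / w j)"
    using w by (intro mult_right_mono sum_le_suminf wi sum_nonneg) (auto simp: less_imp_le)
  finally have 2: "(\<Sum>j<k. (u j)\<^sup>2 / w j)\<^sup>2 \<le> (\<Sum>j. 1 / w j) * (\<Sum>j<k. u j ^ 4 / w j)" .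
  have "(\<Sum>j<k. d j * u j) ^ 4 = ((\<Sum>j<k. d j * u j)\<^sup>2)\<^sup>2" by (simp flip: power_mult)
  also have "\<dots> \<le> ((weighted_norm w d)\<^sup>2 * (\<Sum>j<k. (u j)\<^sup>2 / w j))\<^sup>2"
    by (intro power_mono 1) simp
  also have "\<dots> = weighted_norm w d ^ 4 * (\<Sum>j<k. (u j)\<^sup>2 / w j)\<^sup>2"
    by (simp add: power_mult_distrib flip: power_mult)
  also have "\<dots> \<le> weighted_norm w d ^ 4 * ((\<Sum>j. 1 / w j) * (\<Sum>j<k. u j ^ 4 / w j))"
    by (intro mult_left_mono 2) simp
  finally show "(\<Sum>j<k. d j * u j) ^ 4 \<le> weighted_norm w d ^ 4 * (\<Sum>j. 1 / w j) * (\<Sum>j<k. u j ^ 4 / w j)"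
    by (simp add: mult.assoc)
qed

text \<open>The right-hand side lives in the extended reals, where the series of \<open>b\<close>
  always has a value, possibly infinite.\<close>

lemma ennreal_limit_le_suminf:
  fixes s :: "nat \<Rightarrow> real" and b :: "nat \<Rightarrow> real"
  assumes lim: "s \<longlonglongrightarrow> l" and le: "\<And>n. s n \<le> c * (\<Sum>j<r n. b j)" and c: "c \<ge> 0" and b: "\<And>j. b j \<ge> 0"
  shows "ennreal l \<le> ennreal c * (\<Sum>j. ennreal (b j))"
proof (rule LIMSEQ_le_const2)
  show "(\<lambda>n. ennreal (s n)) \<longlonglongrightarrow> ennreal l" using lim by (rule tendsto_ennrealI)
  have "ennreal (s n) \<le> ennreal c * (\<Sum>j. ennreal (b j))" for n
  proof -
    have "ennreal (s n) \<le> ennreal (c * (\<Sum>j<r n. b j))" by (rule ennreal_leI[OF le])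
    also have "\<dots> = ennreal c * (\<Sum>j<r n. ennreal (b j))"
      using c b by (simp add: ennreal_mult sum_nonneg)
    also have "\<dots> \<le> ennreal c * (\<Sum>j. ennreal (b j))"
      by (intro mult_left_mono sum_le_suminf) auto
    finally show ?thesis .
  qed
  then show "\<exists>N. \<forall>n\<ge>N. ennreal (s n) \<le> ennreal c * (\<Sum>j. ennreal (b j))" by blast
qed

text \<open>The partial sum bounds pass to the limit along the subsequence. Apart from its weighted
  norm, \<open>\<delta>\<close> does not occur in the majorants, which makes them uniform over
  approximation errors of bounded norm.\<close>

lemma weighted_expansion_AE_le:
  assumes e: "orthonormal_basis P e" and \<delta>: "\<delta> \<in> L2_space P"
    and w: "\<And>j. w j > 0" and wi: "summable (\<lambda>j. 1 / w j)"
    and d: "basis_coeff P e \<delta> \<in> weighted_space w"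
  shows "AE x in P. ennreal ((\<delta> x)\<^sup>2)
      \<le> ennreal ((weighted_norm w (basis_coeff P e \<delta>))\<^sup>2) * (\<Sum>j. ennreal ((e j x)\<^sup>2 / w j))"
    and "AE x in P. ennreal (\<delta> x ^ 4)
      \<le> ennreal (weighted_norm w (basis_coeff P e \<delta>) ^ 4 * (\<Sum>j. 1 / w j)) * (\<Sum>j. ennreal (e j x ^ 4 / w j))"
proof -
  have sd: "summable (\<lambda>j. w j * (basis_coeff P e \<delta> j)\<^sup>2)" using d by (simp add: weighted_space_def)
  obtain r where r: "AE x in P. (\<lambda>n. \<Sum>j<r n. basis_coeff P e \<delta> j * e j x) \<longlonglongrightarrow> \<delta> x"
    using L2_expansion_AE_subseq[OF e \<delta>] .
  show "AE x in P. ennreal ((\<delta> x)\<^sup>2)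
      \<le> ennreal ((weighted_norm w (basis_coeff P e \<delta>))\<^sup>2) * (\<Sum>j. ennreal ((e j x)\<^sup>2 / w j))"
    using r
  proof eventually_elim
    case (elim x)
    show ?case
      by (rule ennreal_limit_le_suminf[OF tendsto_power[OF elim, of 2] weighted_partial_sum_bounds(1)[OF w sd wi]])
        (use w in \<open>auto simp: less_imp_le\<close>)
  qed
  show "AE x in P. ennreal (\<delta> x ^ 4)
      \<le> ennreal (weighted_norm w (basis_coeff P e \<delta>) ^ 4 * (\<Sum>j. 1 / w j)) * (\<Sum>j. ennreal (e j x ^ 4 / w j))"
    using r
  proof eventually_elim
    case (elim x)
    show ?case
      by (rule ennreal_limit_le_suminf[OF tendsto_power[OF elim, of 4] weighted_partial_sum_bounds(2)[OF w sd wi]])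
        (use w wi in \<open>auto simp: less_imp_le intro!: mult_nonneg_nonneg suminf_nonneg\<close>)
  qed
qed

section \<open>Bounds for nonnegative integrals and scalar inequalities\<close>

lemma integrable_of_nn_bound:
  fixes g :: "'b \<Rightarrow> real"
  assumes g: "g \<in> borel_measurable P" "\<And>x. g x \<ge> 0" and le: "(\<integral>\<^sup>+x. ennreal (g x) \<partial>P) \<le> ennreal C" and C: "C \<ge> 0"
  shows "integrable P g" "(\<integral>x. g x \<partial>P) \<le> C"
proof -
  show int: "integrable P g"
    by (intro integrableI_bounded) (use g le_less_trans[OF le ennreal_less_top] in auto)
  show "(\<integral>x. g x \<partial>P) \<le> C"
    using le C by (simp add: nn_integral_eq_integral[OF int] g(2))
qed

lemma nn_bound_of_integrable:
  fixes g :: "'b \<Rightarrow> real"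
  assumes "integrable P g" "\<And>x. g x \<ge> 0" "(\<integral>x. g x \<partial>P) \<le> C"
  shows "(\<integral>\<^sup>+x. ennreal (g x) \<partial>P) \<le> ennreal C"
  using assms by (simp add: nn_integral_eq_integral ennreal_leI)

text \<open>Integration term by term: a bound common to all \<open>u j\<close> is summed against the
  inverse weights.\<close>

lemma nn_integral_weighted_suminf_le:
  fixes u :: "nat \<Rightarrow> 'b \<Rightarrow> real" and w :: "nat \<Rightarrow> real"
  assumes F [measurable]: "F \<in> borel_measurable P" and u [measurable]: "\<And>j. u j \<in> borel_measurable P"
    and u0: "\<And>j x. u j x \<ge> 0" and w: "\<And>j. w j > 0" and wi: "summable (\<lambda>j. 1 / w j)"
    and B: "\<And>j. (\<integral>\<^sup>+x. F x * ennreal (u j x) \<partial>P) \<le> B"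
  shows "(\<integral>\<^sup>+x. F x * (\<Sum>j. ennreal (u j x / w j)) \<partial>P) \<le> ennreal (\<Sum>j. 1 / w j) * B"
proof -
  have "(\<integral>\<^sup>+x. F x * (\<Sum>j. ennreal (u j x / w j)) \<partial>P) = (\<integral>\<^sup>+x. (\<Sum>j. ennreal (1 / w j) * (F x * ennreal (u j x))) \<partial>P)"
  proof (rule nn_integral_cong)
    fix x
    have "ennreal (u j x / w j) = ennreal (1 / w j) * ennreal (u j x)" for j
      using w[of j] u0[of j x] by (simp add: ennreal_mult[symmetric] less_imp_le)
    then show "F x * (\<Sum>j. ennreal (u j x / w j)) = (\<Sum>j. ennreal (1 / w j) * (F x * ennreal (u j x)))"
      by (simp add: mult_ac flip: ennreal_suminf_cmult)
  qed
  also have "\<dots> = (\<Sum>j. \<integral>\<^sup>+x. ennreal (1 / w j) * (F x * ennreal (u j x)) \<partial>P)"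
    by (rule nn_integral_suminf) measurable
  also have "\<dots> = (\<Sum>j. ennreal (1 / w j) * (\<integral>\<^sup>+x. F x * ennreal (u j x) \<partial>P))"
    by (intro suminf_cong nn_integral_cmult) measurable
  also have "\<dots> \<le> (\<Sum>j. ennreal (1 / w j) * B)"
    by (intro suminf_le mult_left_mono B) auto
  also have "\<dots> = (\<Sum>j. ennreal (1 / w j)) * B"
    by (rule ennreal_suminf_multc)
  also have "(\<Sum>j. ennreal (1 / w j)) = ennreal (\<Sum>j. 1 / w j)"
    by (rule suminf_ennreal2) (use w wi in \<open>auto simp: less_imp_le\<close>)
  finally show ?thesis .
qed

lemma L2_space_distr:
  assumes Z [measurable]: "Z \<in> M \<rightarrow>\<^sub>M N" and \<phi>: "\<phi> \<in> L2_space (distr M N Z)"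
  shows "(\<lambda>\<omega>. \<phi> (Z \<omega>)) \<in> L2_space M"
proof -
  have m: "\<phi> \<in> borel_measurable N" and i: "integrable (distr M N Z) (\<lambda>x. (\<phi> x)\<^sup>2)"
    using \<phi> by (auto simp: L2_space_def)
  have "(\<lambda>x. (\<phi> x)\<^sup>2) \<in> borel_measurable N" using m by (rule borel_measurable_power)
  then have "integrable M (\<lambda>\<omega>. (\<phi> (Z \<omega>))\<^sup>2)" using i integrable_distr_eq[OF Z] by blast
  then show ?thesis using measurable_compose[OF Z m] by (simp add: L2_space_def)
qed

lemma L2_inner_distr:
  assumes Z: "Z \<in> M \<rightarrow>\<^sub>M N" and \<phi>: "\<phi> \<in> borel_measurable N" and \<psi>: "\<psi> \<in> borel_measurable N"
  shows "L2_inner (distr M N Z) \<phi> \<psi> = (\<integral>\<omega>. \<phi> (Z \<omega>) * \<psi> (Z \<omega>) \<partial>M)"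
  unfolding L2_inner_def by (rule integral_distr[OF Z borel_measurable_times[OF \<phi> \<psi>]])

lemma power4_add_le: "(a + b) ^ 4 \<le> 8 * (a ^ 4 + (b::real) ^ 4)"
proof -
  have 1: "(x + y)\<^sup>2 \<le> 2 * (x\<^sup>2 + y\<^sup>2)" for x y :: real
    using sum_squares_bound[of x y] by (simp add: power2_sum)
  have "(a + b) ^ 4 = ((a + b)\<^sup>2)\<^sup>2" by (simp flip: power_mult)
  also have "\<dots> \<le> (2 * (a\<^sup>2 + b\<^sup>2))\<^sup>2" by (intro power_mono 1) simp
  also have "\<dots> = 4 * (a\<^sup>2 + b\<^sup>2)\<^sup>2" unfolding power_mult_distrib by simp
  also have "\<dots> \<le> 4 * (2 * ((a\<^sup>2)\<^sup>2 + (b\<^sup>2)\<^sup>2))" by (intro mult_left_mono 1) simp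
  finally show ?thesis by (simp flip: power_mult)
qed

text \<open>Convexity alone is used, so the averaged functions may depend on each other, as the
  entries of the sample matrix do.\<close>

lemma nn_integral_mean_power_le:
  fixes u :: "'i \<Rightarrow> 'b \<Rightarrow> real"
  assumes A: "finite A" "A \<noteq> {}" and p: "even p" and u: "\<And>i. i \<in> A \<Longrightarrow> u i \<in> borel_measurable P"
    and C: "\<And>i. i \<in> A \<Longrightarrow> (\<integral>\<^sup>+x. ennreal (u i x ^ p) \<partial>P) \<le> ennreal C" "C \<ge> 0"
  shows "(\<integral>\<^sup>+x. ennreal (((\<Sum>i\<in>A. u i x) / real (card A)) ^ p) \<partial>P) \<le> ennreal C"
proof -
  have u0: "u i x ^ p \<ge> 0" for i x using p by (rule zero_le_even_power)
  have i: "integrable P (\<lambda>x. u i x ^ p)" "(\<integral>x. u i x ^ p \<partial>P) \<le> C" if "i \<in> A" for i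
    using integrable_of_nn_bound[OF borel_measurable_power[OF u[OF that]] u0 C(1)[OF that] C(2)] by auto
  have c: "real (card A) > 0" using A by (simp add: card_gt_0_iff)
  have "(\<integral>\<^sup>+x. ennreal (((\<Sum>i\<in>A. u i x) / real (card A)) ^ p) \<partial>P)
    \<le> (\<integral>\<^sup>+x. ennreal ((\<Sum>i\<in>A. u i x ^ p) / real (card A)) \<partial>P)"
    by (intro nn_integral_mono ennreal_leI mean_power_even_le A p)
  also have "\<dots> \<le> ennreal C"
  proof (rule nn_bound_of_integrable)
    show "integrable P (\<lambda>x. (\<Sum>i\<in>A. u i x ^ p) / real (card A))" using i(1) by auto
    show "(\<Sum>i\<in>A. u i x ^ p) / real (card A) \<ge> 0" for x using u0 by (simp add: sum_nonneg)
    have "(\<integral>x. (\<Sum>i\<in>A. u i x ^ p) / real (card A) \<partial>P) = (\<Sum>i\<in>A. \<integral>x. u i x ^ p \<partial>P) / real (card A)"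
      using i(1) by (simp add: Bochner_Integration.integral_sum)
    also have "\<dots> \<le> (\<Sum>i\<in>A. C) / real (card A)"
      by (intro divide_right_mono sum_mono i(2)) auto
    also have "\<dots> = C" using c by simp
    finally show "(\<integral>x. (\<Sum>i\<in>A. u i x ^ p) / real (card A) \<partial>P) \<le> C" .
  qed
  finally show ?thesis .
qed

text \<open>Bookkeeping for the risk bound: linearity is applied to real integrals, and the result
  is carried back to the extended reals.\<close>

lemma (in prob_space) nn_expectation_affine3_le:
  fixes p u v :: "'a \<Rightarrow> real"
  assumes "p \<in> borel_measurable M" "u \<in> borel_measurable M" "v \<in> borel_measurable M"
    and "\<And>\<omega>. p \<omega> \<ge> 0" "\<And>\<omega>. u \<omega> \<ge> 0" "\<And>\<omega>. v \<omega> \<ge> 0"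
    and "(\<integral>\<^sup>+\<omega>. ennreal (p \<omega>) \<partial>M) \<le> ennreal P" "(\<integral>\<^sup>+\<omega>. ennreal (u \<omega>) \<partial>M) \<le> ennreal Q" "(\<integral>\<^sup>+\<omega>. ennreal (v \<omega>) \<partial>M) \<le> ennreal R"
    and "P \<ge> 0" "Q \<ge> 0" "R \<ge> 0" "a \<ge> 0" "b \<ge> 0" "c \<ge> 0" "d \<ge> 0"
  shows "(\<integral>\<^sup>+\<omega>. ennreal (a * p \<omega> + b * u \<omega> + c * v \<omega> + d) \<partial>M) \<le> ennreal (a * P + b * Q + c * R + d)"
proof -
  note p = integrable_of_nn_bound[OF assms(1,4,7,10)]
  note u = integrable_of_nn_bound[OF assms(2,5,8,11)]
  note v = integrable_of_nn_bound[OF assms(3,6,9,12)]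
  show ?thesis
  proof (rule nn_bound_of_integrable)
    show "integrable M (\<lambda>\<omega>. a * p \<omega> + b * u \<omega> + c * v \<omega> + d)" using p(1) u(1) v(1) by simp
    show "a * p \<omega> + b * u \<omega> + c * v \<omega> + d \<ge> 0" for \<omega> using assms by simp
    have "expectation (\<lambda>\<omega>. a * p \<omega> + b * u \<omega> + c * v \<omega> + d) = a * expectation p + b * expectation u + c * expectation v + d"
      using p(1) u(1) v(1) by (simp add: prob_space)
    also have "\<dots> \<le> a * P + b * Q + c * R + d"
      using p(2) u(2) v(2) assms by (intro add_mono mult_left_mono) auto
    finally show "expectation (\<lambda>\<omega>. a * p \<omega> + b * u \<omega> + c * v \<omega> + d) \<le> a * P + b * Q + c * R + d" .
  qed
qed

text \<open>The duality between the spaces with weights \<open>w\<close> and 1 / w. It makes the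
  linear functional a convergent series and controls it by the weighted norm.\<close>

lemma weighted_Cauchy_Schwarz:
  fixes h d w :: "nat \<Rightarrow> real"
  assumes w: "\<And>j. w j > 0" and wi: "summable (\<lambda>j. 1 / w j)"
    and h: "h \<in> weighted_space (\<lambda>j. 1 / w j)" and d: "d \<in> weighted_space w"
  shows "summable (\<lambda>j. h j * d j)"
    and "(\<Sum>j. h j * d j)\<^sup>2 \<le> (weighted_norm (\<lambda>j. 1 / w j) h)\<^sup>2 * (weighted_norm w d)\<^sup>2"
proof -
  have sh: "summable (\<lambda>j. (h j)\<^sup>2 / w j)" and sd: "summable (\<lambda>j. w j * (d j)\<^sup>2)"
    using h d by (auto simp: weighted_space_def)
  show s: "summable (\<lambda>j. h j * d j)"
  proof (rule summable_comparison_test'[of "\<lambda>j. (h j)\<^sup>2 / w j + w j * (d j)\<^sup>2" 0])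
    show "summable (\<lambda>j. (h j)\<^sup>2 / w j + w j * (d j)\<^sup>2)" by (rule summable_add[OF sh sd])
    fix j
    have wj: "w j > 0" "sqrt (w j) > 0" using w[of j] by auto
    have "2 * (\<bar>h j\<bar> / sqrt (w j)) * (sqrt (w j) * \<bar>d j\<bar>) \<le> (\<bar>h j\<bar> / sqrt (w j))\<^sup>2 + (sqrt (w j) * \<bar>d j\<bar>)\<^sup>2"
      by (rule sum_squares_bound)
    then have "2 * (\<bar>h j\<bar> * \<bar>d j\<bar>) \<le> (h j)\<^sup>2 / w j + w j * (d j)\<^sup>2"
      using wj by (simp add: power_divide power_mult_distrib)
    moreover have "0 \<le> \<bar>h j\<bar> * \<bar>d j\<bar>" by simp
    ultimately have "\<bar>h j\<bar> * \<bar>d j\<bar> \<le> (h j)\<^sup>2 / w j + w j * (d j)\<^sup>2" by linarith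
    then show "norm (h j * d j) \<le> (h j)\<^sup>2 / w j + w j * (d j)\<^sup>2" by (simp add: abs_mult)
  qed
  have hn: "(weighted_norm (\<lambda>j. 1 / w j) h)\<^sup>2 = (\<Sum>j. (h j)\<^sup>2 / w j)"
    using w by (simp add: weighted_norm_def suminf_nonneg[OF sh] less_imp_le)
  show "(\<Sum>j. h j * d j)\<^sup>2 \<le> (weighted_norm (\<lambda>j. 1 / w j) h)\<^sup>2 * (weighted_norm w d)\<^sup>2"
  proof (rule LIMSEQ_le_const2)
    show "(\<lambda>k. (\<Sum>j<k. h j * d j)\<^sup>2) \<longlonglongrightarrow> (\<Sum>j. h j * d j)\<^sup>2"
      by (intro tendsto_power summable_LIMSEQ s)
    have "(\<Sum>j<k. h j * d j)\<^sup>2 \<le> (weighted_norm (\<lambda>j. 1 / w j) h)\<^sup>2 * (weighted_norm w d)\<^sup>2" for k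
    proof -
      have "(\<Sum>j<k. d j * h j)\<^sup>2 \<le> (weighted_norm w d)\<^sup>2 * (\<Sum>j<k. (h j)\<^sup>2 / w j)"
        by (rule weighted_partial_sum_bounds(1)[OF w sd wi])
      also have "\<dots> \<le> (weighted_norm w d)\<^sup>2 * (\<Sum>j. (h j)\<^sup>2 / w j)"
        by (intro mult_left_mono sum_le_suminf sh) (use w in \<open>auto simp: less_imp_le\<close>)
      finally show ?thesis by (simp add: hn mult.commute)
    qed
    then show "\<exists>N. \<forall>k\<ge>N. (\<Sum>j<k. h j * d j)\<^sup>2 \<le> (weighted_norm (\<lambda>j. 1 / w j) h)\<^sup>2 * (weighted_norm w d)\<^sup>2"
      by blast
  qed
qed

text \<open>Young's inequality turns the products x y and x^4 y into pure powers, so that an eighth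
  moment of \<open>x\<close> and a second moment of \<open>y\<close> suffice.\<close>

lemma quadratic_terms_le:
  fixes x y q r R :: real
  assumes x: "x \<ge> 0" and y: "y \<ge> 0" and q: "q \<ge> 0" and r: "0 \<le> r" "r \<le> R"
  shows "q * (4 * r * (x * y) + 64 * r ^ 3 * (x ^ 4 * y)) \<le> q * (4 * R + 64 * R ^ 3) * (1 + x ^ 8 + y\<^sup>2)"
proof -
  have x2: "x\<^sup>2 \<le> 1 + x ^ 8"
  proof (cases "x \<le> 1")
    case True
    then have "x\<^sup>2 \<le> 1" using x by (simp add: power_le_one)
    then show ?thesis using zero_le_power[OF x, of 8] by linarith
  next
    case False
    then have "x\<^sup>2 \<le> x ^ 8" by (intro power_increasing) auto
    then show ?thesis by linarith
  qed
  have "2 * x * y \<le> x\<^sup>2 + y\<^sup>2" by (rule sum_squares_bound)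
  moreover have "0 \<le> x * y" "0 \<le> y\<^sup>2" using x y by auto
  ultimately have 1: "x * y \<le> 1 + x ^ 8 + y\<^sup>2" using x2 by linarith
  have "2 * x ^ 4 * y \<le> (x ^ 4)\<^sup>2 + y\<^sup>2" by (rule sum_squares_bound)
  then have "2 * (x ^ 4 * y) \<le> x ^ 8 + y\<^sup>2" by (simp flip: power_mult)
  moreover have "0 \<le> x ^ 4 * y" using x y by auto
  ultimately have 2: "x ^ 4 * y \<le> 1 + x ^ 8 + y\<^sup>2" by linarith
  have "4 * r * (x * y) + 64 * r ^ 3 * (x ^ 4 * y) \<le> 4 * R * (1 + x ^ 8 + y\<^sup>2) + 64 * R ^ 3 * (1 + x ^ 8 + y\<^sup>2)"
    using 1 2 x y r by (intro add_mono mult_mono power_mono) auto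
  then show ?thesis
    using q mult_left_mono[of _ _ q] by (fastforce simp: algebra_simps)
qed

text \<open>Eventually \<open>\<gamma> j\<close> exceeds (j + 1)^3, so the series is dominated by
  that of the inverse cubes.\<close>

lemma summable_inverse_of_growth:
  fixes \<gamma> :: "nat \<Rightarrow> real"
  assumes pos: "\<And>j. \<gamma> j > 0" and growth: "(\<lambda>j. real (Suc j) ^ 3 / \<gamma> j) \<longlonglongrightarrow> 0"
  shows "summable (\<lambda>j. 1 / \<gamma> j)"
proof (rule summable_comparison_test_ev)
  show "summable (\<lambda>j. inverse (real (Suc j) ^ 3))"
    using inverse_power_summable[of 3, where 'a = real] summable_Suc_iff[of "\<lambda>j. inverse (real j ^ 3)"] by simp
  have "eventually (\<lambda>j. real (Suc j) ^ 3 / \<gamma> j < 1) sequentially"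
    using order_tendstoD(2)[OF growth, of 1] by simp
  then show "eventually (\<lambda>j. norm (1 / \<gamma> j) \<le> inverse (real (Suc j) ^ 3)) sequentially"
  proof eventually_elim
    case (elim j)
    then have "real (Suc j) ^ 3 < \<gamma> j" using pos[of j] by (simp add: divide_less_eq)
    then show ?case
      using pos[of j] by (simp add: inverse_eq_divide frac_le del: of_nat_Suc)
  qed
qed

text \<open>Positivity matters because 1 / 0 is 0: a vanishing dimension would otherwise pass for an
  infinite one.\<close>

lemma filterlim_at_top_of_inverse_smallo:
  fixes m :: "nat \<Rightarrow> nat"
  assumes pos: "\<And>n. n \<ge> 1 \<Longrightarrow> m n \<ge> 1" and small: "(\<lambda>n. 1 / real (m n)) \<in> o(\<lambda>_. 1)"
  shows "filterlim m at_top sequentially"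
  unfolding filterlim_at_top
proof
  fix K :: nat
  have "(\<lambda>n. 1 / real (m n)) \<longlonglongrightarrow> 0"
    using smalloD_tendsto[OF small] by simp
  then have "eventually (\<lambda>n. 1 / real (m n) < 1 / real (Suc K)) sequentially"
    by (rule order_tendstoD) simp
  then show "eventually (\<lambda>n. K \<le> m n) sequentially"
    using eventually_ge_at_top[of 1]
  proof eventually_elim
    case (elim n)
    then have "real (m n) > 0" using pos[of n] by simp
    then have "real (Suc K) < real (m n)" using elim(1) by (simp add: divide_less_eq less_divide_eq del: of_nat_Suc)
    then show ?case by simp
  qed
qed

section \<open>Moment bounds for the sample\<close>

text \<open>The model with the laws of \<open>Z\<close> and \<open>W\<close> written out as image
  measures. The growth of \<gamma> enters as summability of its inverse.\<close>

locale iv_sample = prob_space M for M :: "'a measure" +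
  fixes MZ :: "'z measure" and MW :: "'w measure"
    and Y U :: "'a \<Rightarrow> real" and Z :: "'a \<Rightarrow> 'z" and W :: "'a \<Rightarrow> 'w"
    and Ys :: "nat \<Rightarrow> 'a \<Rightarrow> real" and Zs :: "nat \<Rightarrow> 'a \<Rightarrow> 'z" and Ws :: "nat \<Rightarrow> 'a \<Rightarrow> 'w"
    and e :: "nat \<Rightarrow> 'z \<Rightarrow> real" and f :: "nat \<Rightarrow> 'w \<Rightarrow> real"
    and \<phi> :: "'z \<Rightarrow> real" and \<gamma> :: "nat \<Rightarrow> real" and \<sigma> \<eta> :: real
  assumes Y_meas: "Y \<in> M \<rightarrow>\<^sub>M borel"
    and Z_meas: "Z \<in> M \<rightarrow>\<^sub>M MZ"
    and W_meas: "W \<in> M \<rightarrow>\<^sub>M MW"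
    and e_basis: "orthonormal_basis (distr M MZ Z) e"
    and f_basis: "orthonormal_basis (distr M MW W) f"
    and \<gamma>_pos: "\<And>j. \<gamma> j > 0"
    and \<gamma>_summable: "summable (\<lambda>j. 1 / \<gamma> j)"
    and model: "AE \<omega> in M. Y \<omega> = \<phi> (Z \<omega>) + U \<omega>"
    and \<sigma>_pos: "\<sigma> > 0"
    and error: "error_class M W MW U \<sigma>"
    and moments: "moment_assumption M Z W MW e f \<eta>"
    and sample_indep: "indep_vars (\<lambda>_. borel \<Otimes>\<^sub>M MZ \<Otimes>\<^sub>M MW) (\<lambda>i \<omega>. (Ys i \<omega>, Zs i \<omega>, Ws i \<omega>)) UNIV"
    and sample_law: "\<And>i. distr M (borel \<Otimes>\<^sub>M MZ \<Otimes>\<^sub>M MW) (\<lambda>\<omega>. (Ys i \<omega>, Zs i \<omega>, Ws i \<omega>)) =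
                         distr M (borel \<Otimes>\<^sub>M MZ \<Otimes>\<^sub>M MW) (\<lambda>\<omega>. (Y \<omega>, Z \<omega>, W \<omega>))"
    and \<phi>_L2: "\<phi> \<in> L2_space (distr M MZ Z)"
begin

section \<open>Integrability and moments of a single observation\<close>

lemma eta_ge_1: "\<eta> \<ge> 1"
  using moments by (simp add: moment_assumption_def)

lemma e_L2: "e j \<in> L2_space (distr M MZ Z)" and f_L2: "f l \<in> L2_space (distr M MW W)"
  using e_basis f_basis by (auto simp: orthonormal_basis_def)

lemma e_meas: "e j \<in> borel_measurable MZ" and f_meas: "f l \<in> borel_measurable MW"
  using e_L2[of j] f_L2[of l] by (auto simp: L2_space_def)

lemma eZ_meas: "(\<lambda>\<omega>. e j (Z \<omega>)) \<in> borel_measurable M"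
  and fW_meas: "(\<lambda>\<omega>. f l (W \<omega>)) \<in> borel_measurable M"
  by (rule measurable_compose[OF Z_meas e_meas] measurable_compose[OF W_meas f_meas])+

lemma U_meas: "U \<in> borel_measurable M"
  using error by (auto simp: error_class_def)

lemma eZ_L2: "(\<lambda>\<omega>. e j (Z \<omega>)) \<in> L2_space M" and fW_L2: "(\<lambda>\<omega>. f l (W \<omega>)) \<in> L2_space M"
  and phiZ_L2: "(\<lambda>\<omega>. \<phi> (Z \<omega>)) \<in> L2_space M"
  by (rule L2_space_distr[OF Z_meas e_L2] L2_space_distr[OF W_meas f_L2] L2_space_distr[OF Z_meas \<phi>_L2])+

lemma expectation_e_e: "expectation (\<lambda>\<omega>. e i (Z \<omega>) * e j (Z \<omega>)) = (if i = j then 1 else 0)"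
  using e_basis L2_inner_distr[OF Z_meas e_meas[of i] e_meas[of j]] by (simp add: orthonormal_basis_def)

lemma expectation_f_f: "expectation (\<lambda>\<omega>. f i (W \<omega>) * f j (W \<omega>)) = (if i = j then 1 else 0)"
  using f_basis L2_inner_distr[OF W_meas f_meas[of i] f_meas[of j]] by (simp add: orthonormal_basis_def)

lemma integrable_e_f: "integrable M (\<lambda>\<omega>. e j (Z \<omega>) * f l (W \<omega>))"
  by (rule L2_space_integrable_mult[OF eZ_L2 fW_L2])

text \<open>The entry of the operator matrix in row \<open>l\<close> and column \<open>j\<close>,
  written as an expectation and independent of the dimension.\<close>

definition cross_moment :: "nat \<Rightarrow> nat \<Rightarrow> real" where
  "cross_moment l j = expectation (\<lambda>\<omega>. e j (Z \<omega>) * f l (W \<omega>))"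

text \<open>Both factors have second moment 1, and |a b| is at most half of a^2 + b^2.\<close>

lemma abs_cross_moment_le: "\<bar>cross_moment l j\<bar> \<le> 1"
proof -
  have ie: "integrable M (\<lambda>\<omega>. (e j (Z \<omega>))\<^sup>2)" and "integrable M (\<lambda>\<omega>. (f l (W \<omega>))\<^sup>2)"
    using eZ_L2[of j] fW_L2[of l] by (auto simp: L2_space_def)
  then have i: "integrable M (\<lambda>\<omega>. ((e j (Z \<omega>))\<^sup>2 + (f l (W \<omega>))\<^sup>2) / 2)" by auto
  have "\<bar>cross_moment l j\<bar> \<le> expectation (\<lambda>\<omega>. ((e j (Z \<omega>))\<^sup>2 + (f l (W \<omega>))\<^sup>2) / 2)"
    unfolding cross_moment_def
  proof (rule order_trans[OF integral_abs_bound integral_mono[OF integrable_abs[OF integrable_e_f] i]])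
    fix \<omega>
    show "\<bar>e j (Z \<omega>) * f l (W \<omega>)\<bar> \<le> ((e j (Z \<omega>))\<^sup>2 + (f l (W \<omega>))\<^sup>2) / 2"
      using sum_squares_bound[of "\<bar>e j (Z \<omega>)\<bar>" "\<bar>f l (W \<omega>)\<bar>"] by (simp add: abs_mult)
  qed
  also have "\<dots> = (expectation (\<lambda>\<omega>. (e j (Z \<omega>))\<^sup>2) + expectation (\<lambda>\<omega>. (f l (W \<omega>))\<^sup>2)) / 2"
    using ie \<open>integrable M (\<lambda>\<omega>. (f l (W \<omega>))\<^sup>2)\<close> by simp
  also have "\<dots> = 1"
    using expectation_e_e[of j j] expectation_f_f[of l l] by (simp add: power2_eq_square)
  finally show ?thesis .
qed

lemma operator_matrix_entry:
  assumes "l < k" "j < k"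
  shows "operator_matrix (distr M MW W) e f (cond_exp_operator M Z W MW) k $$ (l, j) = cross_moment l j"
  using assms L2_inner_cond_exp_fun[OF W_meas eZ_meas f_meas integrable_e_f, of j l]
  by (simp add: operator_matrix_def cond_exp_operator_def cross_moment_def)

lemma nn_expectation_U4_le:
  assumes F [measurable]: "F \<in> borel_measurable MW"
  shows "(\<integral>\<^sup>+\<omega>. F (W \<omega>) * ennreal (U \<omega> ^ 4) \<partial>M) \<le> ennreal (\<sigma> ^ 4) * (\<integral>\<^sup>+\<omega>. F (W \<omega>) \<partial>M)"
proof (rule nn_expectation_mult_le[OF W_meas _ F])
  show "(\<lambda>\<omega>. ennreal (U \<omega> ^ 4)) \<in> borel_measurable M"
    using U_meas by simp
  show "AE \<omega> in M. nn_cond_exp M (sigma_of M W MW) (\<lambda>\<omega>. ennreal (U \<omega> ^ 4)) \<omega> \<le> ennreal (\<sigma> ^ 4)"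
    using error by (simp add: error_class_def)
qed

lemma nn_expectation_e2_le:
  assumes F [measurable]: "F \<in> borel_measurable MW"
  shows "(\<integral>\<^sup>+\<omega>. F (W \<omega>) * ennreal ((e j (Z \<omega>))\<^sup>2) \<partial>M) \<le> ennreal (\<eta>\<^sup>2) * (\<integral>\<^sup>+\<omega>. F (W \<omega>) \<partial>M)"
proof (rule nn_expectation_mult_le[OF W_meas _ F])
  show "(\<lambda>\<omega>. ennreal ((e j (Z \<omega>))\<^sup>2)) \<in> borel_measurable M"
    using eZ_meas by simp
  show "AE \<omega> in M. nn_cond_exp M (sigma_of M W MW) (\<lambda>\<omega>. ennreal ((e j (Z \<omega>))\<^sup>2)) \<omega> \<le> ennreal (\<eta>\<^sup>2)"
    using moments by (simp add: moment_assumption_def)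
qed

lemma U_L2: "U \<in> L2_space M"
proof -
  have U4: "(\<integral>\<^sup>+\<omega>. ennreal (U \<omega> ^ 4) \<partial>M) \<le> ennreal (\<sigma> ^ 4)"
    using nn_expectation_U4_le[of "\<lambda>_. 1"] by (simp add: emeasure_space_1)
  have "integrable M (\<lambda>\<omega>. U \<omega> ^ 4)"
    by (rule integrable_of_nn_bound(1)[OF _ _ U4]) (use U_meas in auto)
  then have "integrable M (\<lambda>\<omega>. (U \<omega>)\<^sup>2)"
    by (rule integrable_power_mono[OF U_meas]) auto
  then show ?thesis using U_meas by (simp add: L2_space_def)
qed

lemma Y_L2: "Y \<in> L2_space M"
proof -
  have "(\<lambda>\<omega>. \<phi> (Z \<omega>) + U \<omega>) \<in> L2_space M" by (rule L2_space_add[OF phiZ_L2 U_L2])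
  then have "integrable M (\<lambda>\<omega>. (\<phi> (Z \<omega>) + U \<omega>)\<^sup>2)" by (simp add: L2_space_def)
  moreover have "AE \<omega> in M. (\<phi> (Z \<omega>) + U \<omega>)\<^sup>2 = (Y \<omega>)\<^sup>2" using model by eventually_elim simp
  ultimately have "integrable M (\<lambda>\<omega>. (Y \<omega>)\<^sup>2)"
    using integrable_cong_AE_imp Y_meas borel_measurable_power by blast
  then show ?thesis using Y_meas by (simp add: L2_space_def)
qed

lemma basis_coeff_regression:
  "basis_coeff (distr M MW W) f (cond_exp_fun M W MW Y) l = expectation (\<lambda>\<omega>. Y \<omega> * f l (W \<omega>))"
  unfolding basis_coeff_def
  by (rule L2_inner_cond_exp_fun[OF W_meas Y_meas f_meas L2_space_integrable_mult[OF Y_L2 fW_L2]])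

section \<open>Moments of the products of basis functions\<close>

lemma centred_product_moments_ge_3:
  assumes "k \<ge> 3"
  shows "(\<integral>\<^sup>+\<omega>. ennreal (\<bar>e j (Z \<omega>) * f l (W \<omega>) - cross_moment l j\<bar> ^ k) \<partial>M) \<le> ennreal (\<eta> ^ k * fact k)"
  using moments assms unfolding moment_assumption_def cross_moment_def by blast

text \<open>Bernstein's argument also needs order 2, which comes from order 4 by X^2 \<le> 1 + X^4.
  The constant is fitted to this: 1 + 4! \<eta>^4 is at most 32 \<eta>^4, which is 2! times the
  square of 4 \<eta>^2.\<close>

lemma centred_product_moments:
  assumes "k \<ge> 2"
  shows "(\<integral>\<^sup>+\<omega>. ennreal (\<bar>e j (Z \<omega>) * f l (W \<omega>) - cross_moment l j\<bar> ^ k) \<partial>M) \<le> ennreal ((4 * \<eta>\<^sup>2) ^ k * fact k)"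
proof -
  have \<eta>2: "\<eta> \<le> \<eta>\<^sup>2" "1 \<le> \<eta> ^ 4" using eta_ge_1 self_le_power[of \<eta> 2] by auto
  show ?thesis
  proof (cases "k = 2")
    case True
    define X where "X \<omega> = e j (Z \<omega>) * f l (W \<omega>) - cross_moment l j" for \<omega>
    have [measurable]: "X \<in> borel_measurable M"
      unfolding X_def [abs_def] using eZ_meas fW_meas by simp
    have "(\<integral>\<^sup>+\<omega>. ennreal (\<bar>X \<omega>\<bar>\<^sup>2) \<partial>M) \<le> (\<integral>\<^sup>+\<omega>. 1 + ennreal (\<bar>X \<omega>\<bar> ^ 4) \<partial>M)"
    proof (rule nn_integral_mono)
      fix \<omega>
      have "\<bar>X \<omega>\<bar>\<^sup>2 \<le> 1 + \<bar>X \<omega>\<bar> ^ 4"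
      proof -
        have "2 * (X \<omega>)\<^sup>2 \<le> X \<omega> ^ 4 + 1"
          using sum_squares_bound[of "(X \<omega>)\<^sup>2" 1] by (simp flip: power_mult)
        moreover have "0 \<le> (X \<omega>)\<^sup>2" by simp
        ultimately have "(X \<omega>)\<^sup>2 \<le> 1 + X \<omega> ^ 4" by linarith
        then show ?thesis by simp
      qed
      then show "ennreal (\<bar>X \<omega>\<bar>\<^sup>2) \<le> 1 + ennreal (\<bar>X \<omega>\<bar> ^ 4)"
        by (metis ennreal_1 ennreal_leI ennreal_plus zero_le_one zero_le_power abs_ge_zero)
    qed
    also have "\<dots> = 1 + (\<integral>\<^sup>+\<omega>. ennreal (\<bar>X \<omega>\<bar> ^ 4) \<partial>M)"
      by (subst nn_integral_add) (auto simp: emeasure_space_1)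
    also have "\<dots> \<le> 1 + ennreal (\<eta> ^ 4 * fact 4)"
      unfolding X_def by (intro add_left_mono centred_product_moments_ge_3) simp
    also have "\<dots> = ennreal (1 + \<eta> ^ 4 * fact 4)"
      using eta_ge_1 by simp
    also have "\<dots> \<le> ennreal ((4 * \<eta>\<^sup>2) ^ 2 * fact 2)"
      using \<eta>2 by (intro ennreal_leI) (simp add: power_mult_distrib fact_numeral flip: power_mult)
    finally show ?thesis using True by (simp add: X_def)
  next
    case False
    have "\<eta> ^ k * fact k \<le> (4 * \<eta>\<^sup>2) ^ k * fact k"
      using \<eta>2 eta_ge_1 by (intro mult_right_mono power_mono) auto
    moreover have "k \<ge> 3" using assms False by simp
    ultimately show ?thesis
      by (blast intro: order_trans[OF centred_product_moments_ge_3] ennreal_leI)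
  qed
qed

text \<open>The product is its centred version plus a mean of modulus at most 1. The convexity bound
  \<open>power4_add_le\<close> gives the constant 8 * 4! + 8 = 200.\<close>

lemma nn_expectation_e4_f4_le:
  "(\<integral>\<^sup>+\<omega>. ennreal (f l (W \<omega>) ^ 4) * ennreal (e j (Z \<omega>) ^ 4) \<partial>M) \<le> ennreal (200 * \<eta> ^ 4)"
proof -
  define X where "X \<omega> = e j (Z \<omega>) * f l (W \<omega>) - cross_moment l j" for \<omega>
  have [measurable]: "X \<in> borel_measurable M"
    unfolding X_def [abs_def] using eZ_meas fW_meas by simp
  have "(\<integral>\<^sup>+\<omega>. ennreal (f l (W \<omega>) ^ 4) * ennreal (e j (Z \<omega>) ^ 4) \<partial>M)
    \<le> (\<integral>\<^sup>+\<omega>. 8 * ennreal (\<bar>X \<omega>\<bar> ^ 4) + 8 \<partial>M)"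
  proof (rule nn_integral_mono)
    fix \<omega>
    have "cross_moment l j ^ 4 \<le> 1"
      using power_mono[OF abs_cross_moment_le[of l j], of 4] by simp
    then have "f l (W \<omega>) ^ 4 * e j (Z \<omega>) ^ 4 \<le> 8 * \<bar>X \<omega>\<bar> ^ 4 + 8"
      using power4_add_le[of "X \<omega>" "cross_moment l j"]
      by (simp add: X_def mult.commute flip: power_mult_distrib)
    then have "ennreal (f l (W \<omega>) ^ 4 * e j (Z \<omega>) ^ 4) \<le> ennreal (8 * \<bar>X \<omega>\<bar> ^ 4 + 8)"
      by (rule ennreal_leI)
    then show "ennreal (f l (W \<omega>) ^ 4) * ennreal (e j (Z \<omega>) ^ 4) \<le> 8 * ennreal (\<bar>X \<omega>\<bar> ^ 4) + 8"
      by (simp add: ennreal_mult)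
  qed
  also have "\<dots> = 8 * (\<integral>\<^sup>+\<omega>. ennreal (\<bar>X \<omega>\<bar> ^ 4) \<partial>M) + 8"
    by (subst nn_integral_add) (auto simp: emeasure_space_1 nn_integral_cmult)
  also have "(\<integral>\<^sup>+\<omega>. ennreal (\<bar>X \<omega>\<bar> ^ 4) \<partial>M) \<le> ennreal (\<eta> ^ 4 * fact 4)"
    unfolding X_def by (rule centred_product_moments_ge_3) simp
  also have "8 * ennreal (\<eta> ^ 4 * fact 4) + 8 = ennreal (8 * (\<eta> ^ 4 * fact 4) + 8)"
    using eta_ge_1 by (simp add: ennreal_mult)
  also have "\<dots> \<le> ennreal (200 * \<eta> ^ 4)"
    using eta_ge_1 by (intro ennreal_leI) (simp add: fact_numeral)
  finally show ?thesis by (simp add: add_right_mono mult_left_mono)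
qed

section \<open>Transfer to the sample and moments of the matrix error\<close>

lemma sample_nn_integral:
  assumes G: "G \<in> borel_measurable (borel \<Otimes>\<^sub>M MZ \<Otimes>\<^sub>M MW)"
  shows "(\<integral>\<^sup>+\<omega>. ennreal (G (Ys i \<omega>, Zs i \<omega>, Ws i \<omega>)) \<partial>M) = (\<integral>\<^sup>+\<omega>. ennreal (G (Y \<omega>, Z \<omega>, W \<omega>)) \<partial>M)"
proof -
  have S: "(\<lambda>\<omega>. (Ys i \<omega>, Zs i \<omega>, Ws i \<omega>)) \<in> M \<rightarrow>\<^sub>M (borel \<Otimes>\<^sub>M MZ \<Otimes>\<^sub>M MW)"
    using sample_indep by (simp add: indep_vars_def)
  have D: "(\<lambda>\<omega>. (Y \<omega>, Z \<omega>, W \<omega>)) \<in> M \<rightarrow>\<^sub>M (borel \<Otimes>\<^sub>M MZ \<Otimes>\<^sub>M MW)"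
    using Y_meas Z_meas W_meas by simp
  have G': "(\<lambda>x. ennreal (G x)) \<in> borel_measurable (borel \<Otimes>\<^sub>M MZ \<Otimes>\<^sub>M MW)" using G by simp
  have G'': "(\<lambda>x. ennreal (G x)) \<in> borel_measurable (distr M (borel \<Otimes>\<^sub>M MZ \<Otimes>\<^sub>M MW) T)" for T
    using G' by (simp only: measurable_distr_eq1)
  show ?thesis
    unfolding nn_integral_distr[OF S G'', symmetric] nn_integral_distr[OF D G'', symmetric] sample_law ..
qed

lemma sample_expectation:
  assumes G: "G \<in> borel_measurable (borel \<Otimes>\<^sub>M MZ \<Otimes>\<^sub>M MW)"
  shows "expectation (\<lambda>\<omega>. G (Ys i \<omega>, Zs i \<omega>, Ws i \<omega>)) = (expectation (\<lambda>\<omega>. G (Y \<omega>, Z \<omega>, W \<omega>)) :: real)"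
proof -
  have S: "(\<lambda>\<omega>. (Ys i \<omega>, Zs i \<omega>, Ws i \<omega>)) \<in> M \<rightarrow>\<^sub>M (borel \<Otimes>\<^sub>M MZ \<Otimes>\<^sub>M MW)"
    using sample_indep by (simp add: indep_vars_def)
  have D: "(\<lambda>\<omega>. (Y \<omega>, Z \<omega>, W \<omega>)) \<in> M \<rightarrow>\<^sub>M (borel \<Otimes>\<^sub>M MZ \<Otimes>\<^sub>M MW)"
    using Y_meas Z_meas W_meas by simp
  show ?thesis
    unfolding integral_distr[OF S G, symmetric] integral_distr[OF D G, symmetric] sample_law ..
qed

lemma sample_indep_compose:
  assumes G: "G \<in> borel_measurable (borel \<Otimes>\<^sub>M MZ \<Otimes>\<^sub>M MW)"
  shows "indep_vars (\<lambda>_. borel) (\<lambda>i \<omega>. G (Ys i \<omega>, Zs i \<omega>, Ws i \<omega>) :: real) I"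
proof -
  have "indep_vars (\<lambda>_. borel) (\<lambda>i \<omega>. G (Ys i \<omega>, Zs i \<omega>, Ws i \<omega>)) UNIV"
    using sample_indep by (rule indep_vars_compose2[where Y = "\<lambda>_. G"]) (rule G)
  then show ?thesis by (rule indep_vars_subset) simp
qed

lemma sample_measurable:
  assumes G: "G \<in> borel_measurable (borel \<Otimes>\<^sub>M MZ \<Otimes>\<^sub>M MW)"
  shows "(\<lambda>\<omega>. G (Ys i \<omega>, Zs i \<omega>, Ws i \<omega>) :: real) \<in> borel_measurable M"
proof (rule measurable_compose[OF _ G])
  show "(\<lambda>\<omega>. (Ys i \<omega>, Zs i \<omega>, Ws i \<omega>)) \<in> M \<rightarrow>\<^sub>M (borel \<Otimes>\<^sub>M MZ \<Otimes>\<^sub>M MW)"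
    using sample_indep by (simp add: indep_vars_def)
qed

text \<open>An entry of the sample matrix minus the true one; neither part refers to the
  dimension.\<close>

definition matrix_error :: "nat \<Rightarrow> nat \<Rightarrow> nat \<Rightarrow> 'a \<Rightarrow> real" where
  "matrix_error n l j \<omega> = (1 / real n) * (\<Sum>i<n. f l (Ws i \<omega>) * e j (Zs i \<omega>)) - cross_moment l j"

lemma centred_product_measurable:
  "(\<lambda>(y, z, w). e j z * f l w - c) \<in> borel_measurable (borel \<Otimes>\<^sub>M MZ \<Otimes>\<^sub>M MW)"
  unfolding split_beta
  by (intro borel_measurable_diff borel_measurable_times borel_measurable_const
      measurable_compose[OF measurable_compose[OF measurable_snd measurable_fst] e_meas]
      measurable_compose[OF measurable_compose[OF measurable_snd measurable_snd] f_meas])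

lemma sqrt_matrix_error:
  assumes "n > 0"
  shows "sqrt (real n) * matrix_error n l j \<omega>
    = (\<Sum>i<n. e j (Zs i \<omega>) * f l (Ws i \<omega>) - cross_moment l j) / sqrt (real n)"
proof -
  have "matrix_error n l j \<omega> = (\<Sum>i<n. e j (Zs i \<omega>) * f l (Ws i \<omega>) - cross_moment l j) / real n"
    using assms by (simp add: matrix_error_def sum_subtractf field_simps)
  also have "\<dots> = (\<Sum>i<n. e j (Zs i \<omega>) * f l (Ws i \<omega>) - cross_moment l j) / (sqrt (real n) * sqrt (real n))"
    by simp
  finally show ?thesis using assms by (simp del: real_sqrt_mult_self)
qed

text \<open>Scaled by the root of n, an entry is a normalized sum of independent centred products,
  to which the Bernstein bound applies with B = 4 \<eta>^2.\<close>

lemma nn_expectation_matrix_error_le: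
  assumes n: "n > 0"
  shows "(\<integral>\<^sup>+\<omega>. ennreal (\<bar>sqrt (real n) * matrix_error n l j \<omega>\<bar> ^ p) \<partial>M)
    \<le> ennreal ((8 * \<eta>\<^sup>2) ^ p * fact p * (2 * exp (1 / 2)))"
proof -
  define G where "G = (\<lambda>(y :: real, z, w). e j z * f l w - cross_moment l j)"
  have G: "G \<in> borel_measurable (borel \<Otimes>\<^sub>M MZ \<Otimes>\<^sub>M MW)"
    unfolding G_def by (rule centred_product_measurable)
  have Gk: "(\<lambda>x. \<bar>G x\<bar> ^ k) \<in> borel_measurable (borel \<Otimes>\<^sub>M MZ \<Otimes>\<^sub>M MW)" for k using G by simp
  have "(\<integral>\<^sup>+\<omega>. ennreal (\<bar>(\<Sum>i<n. G (Ys i \<omega>, Zs i \<omega>, Ws i \<omega>)) / sqrt (real (card {..<n}))\<bar> ^ p) \<partial>M)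
    \<le> ennreal ((2 * (4 * \<eta>\<^sup>2)) ^ p * fact p * (2 * exp (1 / 2)))"
  proof (rule nn_expectation_normalized_sum_power_le)
    show "indep_vars (\<lambda>_. borel) (\<lambda>i \<omega>. G (Ys i \<omega>, Zs i \<omega>, Ws i \<omega>)) {..<n}"
      by (rule sample_indep_compose[OF G])
    show "(\<integral>\<^sup>+\<omega>. ennreal (\<bar>G (Ys i \<omega>, Zs i \<omega>, Ws i \<omega>)\<bar> ^ k) \<partial>M) \<le> ennreal ((4 * \<eta>\<^sup>2) ^ k * fact k)"
      if "k \<ge> 2" for i k
      using sample_nn_integral[OF Gk, of i k] centred_product_moments[OF that, of j l] by (simp add: G_def)
    show "expectation (\<lambda>\<omega>. G (Ys i \<omega>, Zs i \<omega>, Ws i \<omega>)) = 0" for i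
      unfolding sample_expectation[OF G]
      using integrable_e_f[of j l] by (simp add: G_def cross_moment_def prob_space)
  qed (use n eta_ge_1 in \<open>auto simp: lessThan_empty_iff\<close>)
  then show ?thesis
    using sqrt_matrix_error[OF n, of l j] by (simp add: G_def)
qed

section \<open>Moments of the approximation residual\<close>

definition weight_sum :: real where
  "weight_sum = (\<Sum>j. 1 / \<gamma> j)"

lemma weight_sum_nonneg: "weight_sum \<ge> 0"
  unfolding weight_sum_def by (intro suminf_nonneg \<gamma>_summable) (use \<gamma>_pos in \<open>auto simp: less_imp_le\<close>)

text \<open>The value \<open>y\<close> is a separate argument, so that the same formula serves for
  \<open>Y\<close>, for the sample and for \<open>\<phi>\<close> itself.\<close>

definition residual :: "(nat \<Rightarrow> real) \<Rightarrow> nat \<Rightarrow> real \<Rightarrow> 'z \<Rightarrow> real" where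
  "residual c k y z = y - (\<Sum>j<k. c j * e j z)"

text \<open>Membership in the weighted space is demanded because the norm of a divergent series
  carries no information. The bound 1 holds for all large dimensions once the bias tends to
  0.\<close>

definition close_approximation :: "(nat \<Rightarrow> real) \<Rightarrow> nat \<Rightarrow> bool" where
  "close_approximation c k \<longleftrightarrow>
    basis_coeff (distr M MZ Z) e (\<lambda>z. residual c k (\<phi> z) z) \<in> weighted_space \<gamma> \<and>
    weighted_norm \<gamma> (basis_coeff (distr M MZ Z) e (\<lambda>z. residual c k (\<phi> z) z)) \<le> 1"

lemma residual_L2: "(\<lambda>z. residual c k (\<phi> z) z) \<in> L2_space (distr M MZ Z)"
  unfolding residual_def by (intro L2_space_diff \<phi>_L2 L2_space_sum L2_space_mult e_L2)

lemma residual_phi_measurable: "(\<lambda>\<omega>. residual c k (\<phi> (Z \<omega>)) (Z \<omega>)) \<in> borel_measurable M"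
  using L2_space_distr[OF Z_meas residual_L2] by (simp add: L2_space_def)

text \<open>The pointwise majorants of the expansion, with the weighted norm estimated by 1.\<close>

lemma residual_AE_bounds:
  assumes "close_approximation c k"
  shows "AE \<omega> in M. ennreal ((residual c k (\<phi> (Z \<omega>)) (Z \<omega>))\<^sup>2) \<le> (\<Sum>j. ennreal ((e j (Z \<omega>))\<^sup>2 / \<gamma> j))"
    and "AE \<omega> in M. ennreal (residual c k (\<phi> (Z \<omega>)) (Z \<omega>) ^ 4)
      \<le> ennreal weight_sum * (\<Sum>j. ennreal (e j (Z \<omega>) ^ 4 / \<gamma> j))"
proof -
  define N where "N = weighted_norm \<gamma> (basis_coeff (distr M MZ Z) e (\<lambda>z. residual c k (\<phi> z) z))"
  have N: "N \<le> 1" using assms by (simp add: close_approximation_def N_def)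
  have w: "basis_coeff (distr M MZ Z) e (\<lambda>z. residual c k (\<phi> z) z) \<in> weighted_space \<gamma>"
    using assms by (simp add: close_approximation_def)
  have "0 \<le> N"
    unfolding N_def weighted_norm_def using w \<gamma>_pos
    by (intro real_sqrt_ge_zero suminf_nonneg) (auto simp: weighted_space_def less_imp_le)
  then have N2: "N\<^sup>2 \<le> 1" "N ^ 4 \<le> 1" using N by (auto intro: power_le_one)
  note b = weighted_expansion_AE_le[OF e_basis residual_L2 \<gamma>_pos \<gamma>_summable w]
  show "AE \<omega> in M. ennreal ((residual c k (\<phi> (Z \<omega>)) (Z \<omega>))\<^sup>2) \<le> (\<Sum>j. ennreal ((e j (Z \<omega>))\<^sup>2 / \<gamma> j))"
    using AE_distrD[OF Z_meas b(1)]
  proof eventually_elim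
    case (elim \<omega>)
    also have "ennreal ((weighted_norm \<gamma> (basis_coeff (distr M MZ Z) e (\<lambda>z. residual c k (\<phi> z) z)))\<^sup>2)
        * (\<Sum>j. ennreal ((e j (Z \<omega>))\<^sup>2 / \<gamma> j)) \<le> 1 * (\<Sum>j. ennreal ((e j (Z \<omega>))\<^sup>2 / \<gamma> j))"
      using N2 by (intro mult_right_mono) (auto simp: N_def)
    finally show ?case by simp
  qed
  show "AE \<omega> in M. ennreal (residual c k (\<phi> (Z \<omega>)) (Z \<omega>) ^ 4)
      \<le> ennreal weight_sum * (\<Sum>j. ennreal (e j (Z \<omega>) ^ 4 / \<gamma> j))"
    using AE_distrD[OF Z_meas b(2)]
  proof eventually_elim
    case (elim \<omega>)
    also have "ennreal (weighted_norm \<gamma> (basis_coeff (distr M MZ Z) e (\<lambda>z. residual c k (\<phi> z) z)) ^ 4 * (\<Sum>j. 1 / \<gamma> j))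
        * (\<Sum>j. ennreal (e j (Z \<omega>) ^ 4 / \<gamma> j)) \<le> ennreal weight_sum * (\<Sum>j. ennreal (e j (Z \<omega>) ^ 4 / \<gamma> j))"
      using mult_right_mono[OF N2(2) weight_sum_nonneg]
      by (intro mult_right_mono ennreal_leI) (auto simp: N_def weight_sum_def)
    finally show ?case .
  qed
qed

text \<open>The conditional second moment is derived from the fourth by u^2 \<le> u^4 / (2
  \<sigma>^2) + \<sigma>^2 / 2; this balance makes the two contributions add up to
  \<sigma>^2.\<close>

lemma nn_expectation_U2_le:
  assumes F [measurable]: "F \<in> borel_measurable MW"
  shows "(\<integral>\<^sup>+\<omega>. F (W \<omega>) * ennreal ((U \<omega>)\<^sup>2) \<partial>M) \<le> ennreal (\<sigma>\<^sup>2) * (\<integral>\<^sup>+\<omega>. F (W \<omega>) \<partial>M)"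
proof -
  note [measurable] = U_meas W_meas
  have pw: "ennreal ((U \<omega>)\<^sup>2) \<le> ennreal (1 / (2 * \<sigma>\<^sup>2)) * ennreal (U \<omega> ^ 4) + ennreal (\<sigma>\<^sup>2 / 2)" for \<omega>
  proof -
    have "2 * (U \<omega>)\<^sup>2 * \<sigma>\<^sup>2 \<le> U \<omega> ^ 4 + \<sigma> ^ 4"
      using sum_squares_bound[of "(U \<omega>)\<^sup>2" "\<sigma>\<^sup>2"] by (simp flip: power_mult)
    then have "(U \<omega>)\<^sup>2 \<le> (U \<omega> ^ 4 + \<sigma> ^ 4) / (2 * \<sigma>\<^sup>2)"
      using \<sigma>_pos by (simp add: pos_le_divide_eq mult_ac)
    also have "\<dots> = 1 / (2 * \<sigma>\<^sup>2) * U \<omega> ^ 4 + \<sigma>\<^sup>2 / 2"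
      using \<sigma>_pos by (simp add: field_simps power4_eq_xxxx power2_eq_square)
    finally show ?thesis
      by (simp add: ennreal_leI flip: ennreal_mult ennreal_plus)
  qed
  have "(\<integral>\<^sup>+\<omega>. F (W \<omega>) * ennreal ((U \<omega>)\<^sup>2) \<partial>M)
    \<le> (\<integral>\<^sup>+\<omega>. ennreal (1 / (2 * \<sigma>\<^sup>2)) * (F (W \<omega>) * ennreal (U \<omega> ^ 4)) + ennreal (\<sigma>\<^sup>2 / 2) * F (W \<omega>) \<partial>M)"
  proof (rule nn_integral_mono)
    fix \<omega>
    show "F (W \<omega>) * ennreal ((U \<omega>)\<^sup>2) \<le> ennreal (1 / (2 * \<sigma>\<^sup>2)) * (F (W \<omega>) * ennreal (U \<omega> ^ 4)) + ennreal (\<sigma>\<^sup>2 / 2) * F (W \<omega>)"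
      using mult_left_mono[OF pw[of \<omega>], of "F (W \<omega>)"] by (simp add: distrib_left mult_ac)
  qed
  also have "\<dots> = ennreal (1 / (2 * \<sigma>\<^sup>2)) * (\<integral>\<^sup>+\<omega>. F (W \<omega>) * ennreal (U \<omega> ^ 4) \<partial>M) + ennreal (\<sigma>\<^sup>2 / 2) * (\<integral>\<^sup>+\<omega>. F (W \<omega>) \<partial>M)"
    by (simp add: nn_integral_add nn_integral_cmult)
  also have "\<dots> \<le> ennreal (1 / (2 * \<sigma>\<^sup>2)) * (ennreal (\<sigma> ^ 4) * (\<integral>\<^sup>+\<omega>. F (W \<omega>) \<partial>M)) + ennreal (\<sigma>\<^sup>2 / 2) * (\<integral>\<^sup>+\<omega>. F (W \<omega>) \<partial>M)"
    by (intro add_right_mono mult_left_mono nn_expectation_U4_le F) simp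
  also have "\<dots> = (ennreal (1 / (2 * \<sigma>\<^sup>2)) * ennreal (\<sigma> ^ 4) + ennreal (\<sigma>\<^sup>2 / 2)) * (\<integral>\<^sup>+\<omega>. F (W \<omega>) \<partial>M)"
    by (simp add: distrib_right mult.assoc)
  also have "ennreal (1 / (2 * \<sigma>\<^sup>2)) * ennreal (\<sigma> ^ 4) + ennreal (\<sigma>\<^sup>2 / 2) = ennreal (1 / (2 * \<sigma>\<^sup>2) * \<sigma> ^ 4 + \<sigma>\<^sup>2 / 2)"
    using \<sigma>_pos by (simp flip: ennreal_mult ennreal_plus)
  also have "1 / (2 * \<sigma>\<^sup>2) * \<sigma> ^ 4 + \<sigma>\<^sup>2 / 2 = \<sigma>\<^sup>2"
    using \<sigma>_pos by (simp add: field_simps power4_eq_xxxx power2_eq_square)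
  finally show ?thesis .
qed

text \<open>The majorant is a weighted sum of squares of \<open>e j\<close>, each with conditional
  mean at most \<eta>^2.\<close>

lemma nn_expectation_residual_phi2_le:
  assumes close: "close_approximation c k" and F [measurable]: "F \<in> borel_measurable MW"
  shows "(\<integral>\<^sup>+\<omega>. F (W \<omega>) * ennreal ((residual c k (\<phi> (Z \<omega>)) (Z \<omega>))\<^sup>2) \<partial>M)
    \<le> ennreal (weight_sum * \<eta>\<^sup>2) * (\<integral>\<^sup>+\<omega>. F (W \<omega>) \<partial>M)"
proof -
  have "(\<integral>\<^sup>+\<omega>. F (W \<omega>) * ennreal ((residual c k (\<phi> (Z \<omega>)) (Z \<omega>))\<^sup>2) \<partial>M)
    \<le> (\<integral>\<^sup>+\<omega>. F (W \<omega>) * (\<Sum>j. ennreal ((e j (Z \<omega>))\<^sup>2 / \<gamma> j)) \<partial>M)"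
  proof (rule nn_integral_mono_AE)
    show "AE \<omega> in M. F (W \<omega>) * ennreal ((residual c k (\<phi> (Z \<omega>)) (Z \<omega>))\<^sup>2) \<le> F (W \<omega>) * (\<Sum>j. ennreal ((e j (Z \<omega>))\<^sup>2 / \<gamma> j))"
      using residual_AE_bounds(1)[OF close] by eventually_elim (simp add: mult_left_mono)
  qed
  also have "\<dots> \<le> ennreal (\<Sum>j. 1 / \<gamma> j) * (ennreal (\<eta>\<^sup>2) * (\<integral>\<^sup>+\<omega>. F (W \<omega>) \<partial>M))"
  proof (rule nn_integral_weighted_suminf_le)
    show "(\<lambda>\<omega>. F (W \<omega>)) \<in> borel_measurable M" by (rule measurable_compose[OF W_meas F])
    show "(\<lambda>\<omega>. (e j (Z \<omega>))\<^sup>2) \<in> borel_measurable M" for j using eZ_meas by simp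
    show "(\<integral>\<^sup>+\<omega>. F (W \<omega>) * ennreal ((e j (Z \<omega>))\<^sup>2) \<partial>M) \<le> ennreal (\<eta>\<^sup>2) * (\<integral>\<^sup>+\<omega>. F (W \<omega>) \<partial>M)" for j
      by (rule nn_expectation_e2_le[OF F])
  qed (use \<gamma>_pos \<gamma>_summable in auto)
  also have "\<dots> = ennreal (weight_sum * \<eta>\<^sup>2) * (\<integral>\<^sup>+\<omega>. F (W \<omega>) \<partial>M)"
    using weight_sum_nonneg by (simp add: weight_sum_def ennreal_mult mult.assoc)
  finally show ?thesis .
qed

lemma residual_Y_eq:
  "AE \<omega> in M. residual c k (Y \<omega>) (Z \<omega>) = U \<omega> + residual c k (\<phi> (Z \<omega>)) (Z \<omega>)"
  using model by eventually_elim (simp add: residual_def)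

text \<open>Error and residual are bounded conditionally on \<open>W\<close>, so the combination of
  the \<open>f l\<close> factors out, and orthonormality evaluates its second moment to the sum of
  squares of \<open>a\<close>. No factor of the dimension appears.\<close>

lemma nn_expectation_residual2_le:
  assumes close: "close_approximation c k"
  shows "(\<integral>\<^sup>+\<omega>. ennreal ((residual c k (Y \<omega>) (Z \<omega>) * (\<Sum>l<k. a l * f l (W \<omega>)))\<^sup>2) \<partial>M)
    \<le> ennreal (2 * (\<sigma>\<^sup>2 + weight_sum * \<eta>\<^sup>2) * (\<Sum>l<k. (a l)\<^sup>2))"
proof -
  define F where "F w = ennreal ((\<Sum>l<k. a l * f l w)\<^sup>2)" for w
  have F: "F \<in> borel_measurable MW"
    unfolding F_def [abs_def] using f_meas by simp
  note FW = measurable_compose[OF W_meas F]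
  have "expectation (\<lambda>\<omega>. (\<Sum>l<k. a l * f l (W \<omega>))\<^sup>2) = expectation (\<lambda>\<omega>. \<Sum>l<k. \<Sum>i<k. a l * a i * (f l (W \<omega>) * f i (W \<omega>)))"
    by (intro Bochner_Integration.integral_cong refl) (simp add: power2_eq_square sum_product mult_ac)
  also have "\<dots> = (\<Sum>l<k. \<Sum>i<k. a l * a i * expectation (\<lambda>\<omega>. f l (W \<omega>) * f i (W \<omega>)))"
    using L2_space_integrable_mult[OF fW_L2 fW_L2] by (simp add: Bochner_Integration.integral_sum)
  also have "\<dots> = (\<Sum>l<k. (a l)\<^sup>2)"
    by (simp add: expectation_f_f if_distrib[of "(*) _"] power2_eq_square cong: if_cong)
  finally have E: "expectation (\<lambda>\<omega>. (\<Sum>l<k. a l * f l (W \<omega>))\<^sup>2) = (\<Sum>l<k. (a l)\<^sup>2)" .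
  have "(\<lambda>\<omega>. \<Sum>l<k. a l * f l (W \<omega>)) \<in> L2_space M"
    by (intro L2_space_sum L2_space_mult fW_L2)
  then have "(\<integral>\<^sup>+\<omega>. F (W \<omega>) \<partial>M) = ennreal (\<Sum>l<k. (a l)\<^sup>2)"
    unfolding F_def by (subst nn_integral_eq_integral) (auto simp: L2_space_def E)
  note IF = this
  note m = U_meas residual_phi_measurable[of c k]
  have "(\<integral>\<^sup>+\<omega>. ennreal ((residual c k (Y \<omega>) (Z \<omega>) * (\<Sum>l<k. a l * f l (W \<omega>)))\<^sup>2) \<partial>M)
    \<le> (\<integral>\<^sup>+\<omega>. 2 * (F (W \<omega>) * ennreal ((U \<omega>)\<^sup>2) + F (W \<omega>) * ennreal ((residual c k (\<phi> (Z \<omega>)) (Z \<omega>))\<^sup>2)) \<partial>M)"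
  proof (rule nn_integral_mono_AE)
    show "AE \<omega> in M. ennreal ((residual c k (Y \<omega>) (Z \<omega>) * (\<Sum>l<k. a l * f l (W \<omega>)))\<^sup>2)
      \<le> 2 * (F (W \<omega>) * ennreal ((U \<omega>)\<^sup>2) + F (W \<omega>) * ennreal ((residual c k (\<phi> (Z \<omega>)) (Z \<omega>))\<^sup>2))"
      using residual_Y_eq[of c k]
    proof eventually_elim
      case (elim \<omega>)
      define r where "r = residual c k (\<phi> (Z \<omega>)) (Z \<omega>)"
      define s where "s = (\<Sum>l<k. a l * f l (W \<omega>))\<^sup>2"
      have s0: "s \<ge> 0" by (simp add: s_def)
      have "(U \<omega> + r)\<^sup>2 * s \<le> 2 * ((U \<omega>)\<^sup>2 + r\<^sup>2) * s"
        using sum_squares_bound[of "U \<omega>" r] by (intro mult_right_mono) (auto simp: power2_sum s_def)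
      then have "ennreal ((U \<omega> + r)\<^sup>2 * s) \<le> ennreal (2 * (s * (U \<omega>)\<^sup>2 + s * r\<^sup>2))"
        by (intro ennreal_leI) (simp add: algebra_simps)
      also have "\<dots> = 2 * (ennreal s * ennreal ((U \<omega>)\<^sup>2) + ennreal s * ennreal (r\<^sup>2))"
        using s0 by (simp add: ennreal_mult)
      finally show ?case using elim by (simp add: F_def r_def s_def power_mult_distrib)
    qed
  qed
  also have "\<dots> = 2 * ((\<integral>\<^sup>+\<omega>. F (W \<omega>) * ennreal ((U \<omega>)\<^sup>2) \<partial>M) + (\<integral>\<^sup>+\<omega>. F (W \<omega>) * ennreal ((residual c k (\<phi> (Z \<omega>)) (Z \<omega>))\<^sup>2) \<partial>M))"
    using FW m by (simp add: nn_integral_cmult nn_integral_add)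
  also have "\<dots> \<le> 2 * (ennreal (\<sigma>\<^sup>2) * ennreal (\<Sum>l<k. (a l)\<^sup>2) + ennreal (weight_sum * \<eta>\<^sup>2) * ennreal (\<Sum>l<k. (a l)\<^sup>2))"
    using nn_expectation_U2_le[OF F] nn_expectation_residual_phi2_le[OF close F]
    unfolding IF by (intro mult_left_mono add_mono) auto
  also have "\<dots> = ennreal (2 * (\<sigma>\<^sup>2 * (\<Sum>l<k. (a l)\<^sup>2) + weight_sum * \<eta>\<^sup>2 * (\<Sum>l<k. (a l)\<^sup>2)))"
    using weight_sum_nonneg by (simp add: ennreal_mult sum_nonneg)
  finally show ?thesis by (simp add: algebra_simps)
qed

text \<open>The factor 8 comes from splitting a fourth power of a sum; the two summands belong to
  the error \<open>U\<close> and to the approximation residual.\<close>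

definition fourth_moment_bound :: real where
  "fourth_moment_bound = 8 * (\<sigma> ^ 4 * \<eta> ^ 4 + weight_sum\<^sup>2 * (200 * \<eta> ^ 4))"

lemma fourth_moment_bound_nonneg: "fourth_moment_bound \<ge> 0"
  by (simp add: fourth_moment_bound_def)

text \<open>The error is bounded conditionally on \<open>W\<close>. For the approximation residual
  the fourth-power majorant is integrated jointly with \<open>f l\<close>, through the moments of
  the products.\<close>

lemma nn_expectation_residual4_le:
  assumes close: "close_approximation c k"
  shows "(\<integral>\<^sup>+\<omega>. ennreal ((residual c k (Y \<omega>) (Z \<omega>) * f l (W \<omega>)) ^ 4) \<partial>M) \<le> ennreal fourth_moment_bound"
proof -
  define F where "F w = ennreal (f l w ^ 4)" for w
  have F: "F \<in> borel_measurable MW"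
    unfolding F_def [abs_def] using f_meas by simp
  note FW = measurable_compose[OF W_meas F]
  have IF: "(\<integral>\<^sup>+\<omega>. F (W \<omega>) \<partial>M) \<le> ennreal (\<eta> ^ 4)"
    using moments by (simp add: F_def moment_assumption_def)
  note m = U_meas residual_phi_measurable[of c k]
  have "(\<integral>\<^sup>+\<omega>. ennreal ((residual c k (Y \<omega>) (Z \<omega>) * f l (W \<omega>)) ^ 4) \<partial>M)
    \<le> (\<integral>\<^sup>+\<omega>. 8 * (F (W \<omega>) * ennreal (U \<omega> ^ 4) + F (W \<omega>) * ennreal (residual c k (\<phi> (Z \<omega>)) (Z \<omega>) ^ 4)) \<partial>M)"
  proof (rule nn_integral_mono_AE)
    show "AE \<omega> in M. ennreal ((residual c k (Y \<omega>) (Z \<omega>) * f l (W \<omega>)) ^ 4)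
      \<le> 8 * (F (W \<omega>) * ennreal (U \<omega> ^ 4) + F (W \<omega>) * ennreal (residual c k (\<phi> (Z \<omega>)) (Z \<omega>) ^ 4))"
      using residual_Y_eq[of c k]
    proof eventually_elim
      case (elim \<omega>)
      define r where "r = residual c k (\<phi> (Z \<omega>)) (Z \<omega>)"
      define s where "s = f l (W \<omega>) ^ 4"
      have s0: "s \<ge> 0" by (simp add: s_def)
      have "(U \<omega> + r) ^ 4 * s \<le> 8 * (U \<omega> ^ 4 + r ^ 4) * s"
        by (intro mult_right_mono power4_add_le) (simp add: s_def)
      then have "ennreal ((U \<omega> + r) ^ 4 * s) \<le> ennreal (8 * (s * U \<omega> ^ 4 + s * r ^ 4))"
        by (intro ennreal_leI) (simp add: algebra_simps)
      also have "\<dots> = 8 * (ennreal s * ennreal (U \<omega> ^ 4) + ennreal s * ennreal (r ^ 4))"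
        using s0 by (simp add: ennreal_mult)
      finally show ?case using elim by (simp add: F_def r_def s_def power_mult_distrib)
    qed
  qed
  also have "\<dots> = 8 * ((\<integral>\<^sup>+\<omega>. F (W \<omega>) * ennreal (U \<omega> ^ 4) \<partial>M) + (\<integral>\<^sup>+\<omega>. F (W \<omega>) * ennreal (residual c k (\<phi> (Z \<omega>)) (Z \<omega>) ^ 4) \<partial>M))"
    using FW m by (simp add: nn_integral_cmult nn_integral_add)
  also have "\<dots> \<le> 8 * (ennreal (\<sigma> ^ 4) * ennreal (\<eta> ^ 4) + ennreal weight_sum * (ennreal weight_sum * ennreal (200 * \<eta> ^ 4)))"
  proof (intro mult_left_mono add_mono)
    show "(\<integral>\<^sup>+\<omega>. F (W \<omega>) * ennreal (U \<omega> ^ 4) \<partial>M) \<le> ennreal (\<sigma> ^ 4) * ennreal (\<eta> ^ 4)"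
      by (rule order_trans[OF nn_expectation_U4_le[OF F] mult_left_mono[OF IF]]) simp
    have "(\<integral>\<^sup>+\<omega>. F (W \<omega>) * ennreal (residual c k (\<phi> (Z \<omega>)) (Z \<omega>) ^ 4) \<partial>M)
      \<le> (\<integral>\<^sup>+\<omega>. ennreal weight_sum * (F (W \<omega>) * (\<Sum>j. ennreal (e j (Z \<omega>) ^ 4 / \<gamma> j))) \<partial>M)"
    proof (rule nn_integral_mono_AE)
      show "AE \<omega> in M. F (W \<omega>) * ennreal (residual c k (\<phi> (Z \<omega>)) (Z \<omega>) ^ 4)
        \<le> ennreal weight_sum * (F (W \<omega>) * (\<Sum>j. ennreal (e j (Z \<omega>) ^ 4 / \<gamma> j)))"
        using residual_AE_bounds(2)[OF close]
      proof eventually_elim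
        case (elim \<omega>)
        show ?case using mult_left_mono[OF elim, of "F (W \<omega>)"] by (simp add: mult_ac)
      qed
    qed
    also have "\<dots> = ennreal weight_sum * (\<integral>\<^sup>+\<omega>. F (W \<omega>) * (\<Sum>j. ennreal (e j (Z \<omega>) ^ 4 / \<gamma> j)) \<partial>M)"
      using FW eZ_meas by (intro nn_integral_cmult) simp
    also have "\<dots> \<le> ennreal weight_sum * (ennreal (\<Sum>j. 1 / \<gamma> j) * ennreal (200 * \<eta> ^ 4))"
    proof (intro mult_left_mono nn_integral_weighted_suminf_le)
      show "(\<lambda>\<omega>. F (W \<omega>)) \<in> borel_measurable M" by (rule FW)
      show "(\<lambda>\<omega>. e j (Z \<omega>) ^ 4) \<in> borel_measurable M" for j using eZ_meas by simp
      show "(\<integral>\<^sup>+\<omega>. F (W \<omega>) * ennreal (e j (Z \<omega>) ^ 4) \<partial>M) \<le> ennreal (200 * \<eta> ^ 4)" for j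
        unfolding F_def by (rule nn_expectation_e4_f4_le)
    qed (use \<gamma>_pos \<gamma>_summable in auto)
    finally show "(\<integral>\<^sup>+\<omega>. F (W \<omega>) * ennreal (residual c k (\<phi> (Z \<omega>)) (Z \<omega>) ^ 4) \<partial>M)
      \<le> ennreal weight_sum * (ennreal weight_sum * ennreal (200 * \<eta> ^ 4))"
      by (simp add: weight_sum_def)
  qed simp
  also have "\<dots> = ennreal fourth_moment_bound"
  proof -
    have "8 * (ennreal a * ennreal b + ennreal g * (ennreal g * ennreal K)) = ennreal (8 * (a * b + g\<^sup>2 * K))"
      if "a \<ge> 0" "b \<ge> 0" "g \<ge> 0" "K \<ge> 0" for a b g K :: real
      using that by (simp add: ennreal_mult power2_eq_square mult.assoc)
    from this[of "\<sigma> ^ 4" "\<eta> ^ 4" weight_sum "200 * \<eta> ^ 4"] show ?thesis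
      using weight_sum_nonneg by (simp only: fourth_moment_bound_def) simp
  qed
  finally show ?thesis .
qed

text \<open>A coordinate of the sample vector minus the sample matrix applied to
  \<open>c\<close>.\<close>

definition score :: "nat \<Rightarrow> (nat \<Rightarrow> real) \<Rightarrow> nat \<Rightarrow> nat \<Rightarrow> 'a \<Rightarrow> real" where
  "score n c k l \<omega> = (1 / real n) * (\<Sum>i<n. residual c k (Ys i \<omega>) (Zs i \<omega>) * f l (Ws i \<omega>))"

section \<open>Moments of the score\<close>

lemma residual_sample_measurable:
  "(\<lambda>(y, z, w). residual c k y z * (\<Sum>l\<in>L. a l * f l w)) \<in> borel_measurable (borel \<Otimes>\<^sub>M MZ \<Otimes>\<^sub>M MW)"
  unfolding split_beta residual_def
  by (intro borel_measurable_diff borel_measurable_times borel_measurable_const borel_measurable_sum measurable_fst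
      measurable_compose[OF measurable_compose[OF measurable_snd measurable_fst] e_meas]
      measurable_compose[OF measurable_compose[OF measurable_snd measurable_snd] f_meas])

lemma residual_product_integrable: "integrable M (\<lambda>\<omega>. residual c k (Y \<omega>) (Z \<omega>) * f l (W \<omega>))"
  unfolding residual_def
  by (rule L2_space_integrable_mult[OF L2_space_diff[OF Y_L2 L2_space_sum[OF L2_space_mult[OF eZ_L2]]] fW_L2])

text \<open>The fourth moment of a centred sum grows like the square of n, which the scaling by the
  root of n cancels.\<close>

lemma nn_expectation_score4_le:
  assumes close: "close_approximation c k" and n: "n > 0"
    and centred: "expectation (\<lambda>\<omega>. residual c k (Y \<omega>) (Z \<omega>) * f l (W \<omega>)) = 0"
  shows "(\<integral>\<^sup>+\<omega>. ennreal ((sqrt (real n) * score n c k l \<omega>) ^ 4) \<partial>M) \<le> ennreal (3 * fourth_moment_bound)"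
proof -
  define G where "G = (\<lambda>(y, z, w). residual c k y z * f l w)"
  have G: "G \<in> borel_measurable (borel \<Otimes>\<^sub>M MZ \<Otimes>\<^sub>M MW)"
    using residual_sample_measurable[of c k "\<lambda>_. 1" "{l}"] by (simp add: G_def)
  have G4: "(\<lambda>x. G x ^ 4) \<in> borel_measurable (borel \<Otimes>\<^sub>M MZ \<Otimes>\<^sub>M MW)" using G by simp
  define X where "X i \<omega> = G (Ys i \<omega>, Zs i \<omega>, Ws i \<omega>)" for i \<omega>
  have X4: "(\<integral>\<^sup>+\<omega>. ennreal (X i \<omega> ^ 4) \<partial>M) \<le> ennreal fourth_moment_bound" for i
    using nn_expectation_residual4_le[OF close, of l] sample_nn_integral[OF G4, of i] by (simp add: X_def G_def)
  have mX: "X i \<in> borel_measurable M" for i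
    unfolding X_def [abs_def] by (rule sample_measurable[OF G])
  have iX: "integrable M (\<lambda>\<omega>. X i \<omega> ^ 4)" "expectation (\<lambda>\<omega>. X i \<omega> ^ 4) \<le> fourth_moment_bound" for i
    by (rule integrable_of_nn_bound[OF _ _ X4 fourth_moment_bound_nonneg]; use mX in simp)+
  have "indep_vars (\<lambda>_. borel) X {..<n}"
    using sample_indep_compose[OF G, of "{..<n}"] by (simp add: X_def [abs_def])
  moreover have "expectation (X i) = 0" for i
    using sample_expectation[OF G, of i] centred by (simp add: X_def [abs_def] G_def)
  ultimately have S: "integrable M (\<lambda>\<omega>. (\<Sum>i<n. X i \<omega>) ^ 4)"
    "expectation (\<lambda>\<omega>. (\<Sum>i<n. X i \<omega>) ^ 4) \<le> 3 * (real n)\<^sup>2 * fourth_moment_bound"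
    using expectation_sum_power4_le[of "{..<n}" X fourth_moment_bound] iX fourth_moment_bound_nonneg by auto
  have eq: "(sqrt (real n) * score n c k l \<omega>) ^ 4 = (\<Sum>i<n. X i \<omega>) ^ 4 / (real n)\<^sup>2" for \<omega>
  proof -
    have "sqrt (real n) ^ 4 = (real n)\<^sup>2"
      using power_mult[of "sqrt (real n)" 2 2] by simp
    then show ?thesis
      using n by (simp add: score_def X_def G_def power_mult_distrib power_divide field_simps flip: power_add)
  qed
  show ?thesis
    unfolding eq
  proof (rule nn_bound_of_integrable)
    have "expectation (\<lambda>\<omega>. (\<Sum>i<n. X i \<omega>) ^ 4 / (real n)\<^sup>2) = expectation (\<lambda>\<omega>. (\<Sum>i<n. X i \<omega>) ^ 4) / (real n)\<^sup>2"
      by simp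
    also have "\<dots> \<le> 3 * (real n)\<^sup>2 * fourth_moment_bound / (real n)\<^sup>2" by (rule divide_right_mono[OF S(2)]) simp
    also have "\<dots> = 3 * fourth_moment_bound" using n by simp
    finally show "expectation (\<lambda>\<omega>. (\<Sum>i<n. X i \<omega>) ^ 4 / (real n)\<^sup>2) \<le> 3 * fourth_moment_bound" .
  qed (use S(1) in auto)
qed

text \<open>Exchanging the sums over coordinates and observations turns the combination into one
  average of independent centred scalars, whose variance is 1 / n of a single one. Bounding
  coordinates separately would cost a factor of the dimension.\<close>

lemma nn_expectation_score_combination_le:
  assumes close: "close_approximation c k" and n: "n > 0"
    and centred: "\<And>l. l < k \<Longrightarrow> expectation (\<lambda>\<omega>. residual c k (Y \<omega>) (Z \<omega>) * f l (W \<omega>)) = 0"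
  shows "(\<integral>\<^sup>+\<omega>. ennreal ((\<Sum>l<k. a l * score n c k l \<omega>)\<^sup>2) \<partial>M)
    \<le> ennreal (2 * (\<sigma>\<^sup>2 + weight_sum * \<eta>\<^sup>2) * ((\<Sum>l<k. (a l)\<^sup>2) / real n))"
proof -
  define B where "B = 2 * (\<sigma>\<^sup>2 + weight_sum * \<eta>\<^sup>2) * (\<Sum>l<k. (a l)\<^sup>2)"
  have B: "B \<ge> 0" using weight_sum_nonneg by (simp add: B_def sum_nonneg)
  define G where "G = (\<lambda>(y, z, w). residual c k y z * (\<Sum>l<k. a l * f l w))"
  have G: "G \<in> borel_measurable (borel \<Otimes>\<^sub>M MZ \<Otimes>\<^sub>M MW)"
    unfolding G_def by (rule residual_sample_measurable)
  have G2: "(\<lambda>x. (G x)\<^sup>2) \<in> borel_measurable (borel \<Otimes>\<^sub>M MZ \<Otimes>\<^sub>M MW)" using G by simp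
  define X where "X i \<omega> = G (Ys i \<omega>, Zs i \<omega>, Ws i \<omega>)" for i \<omega>
  have X2: "(\<integral>\<^sup>+\<omega>. ennreal ((X i \<omega>)\<^sup>2) \<partial>M) \<le> ennreal B" for i
    using nn_expectation_residual2_le[OF close, of a] sample_nn_integral[OF G2, of i] by (simp add: X_def G_def B_def)
  have mX: "X i \<in> borel_measurable M" for i
    unfolding X_def [abs_def] by (rule sample_measurable[OF G])
  have iX: "integrable M (\<lambda>\<omega>. (X i \<omega>)\<^sup>2)" "expectation (\<lambda>\<omega>. (X i \<omega>)\<^sup>2) \<le> B" for i
    by (rule integrable_of_nn_bound[OF _ _ X2 B]; use mX in simp)+
  have "indep_vars (\<lambda>_. borel) X {..<n}"
    using sample_indep_compose[OF G, of "{..<n}"] by (simp add: X_def [abs_def])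
  moreover have "expectation (X i) = 0" for i
  proof -
    have "expectation (\<lambda>\<omega>. G (Y \<omega>, Z \<omega>, W \<omega>)) = expectation (\<lambda>\<omega>. \<Sum>l<k. a l * (residual c k (Y \<omega>) (Z \<omega>) * f l (W \<omega>)))"
      by (simp add: G_def sum_distrib_left mult_ac)
    also have "\<dots> = 0"
      using centred residual_product_integrable by (simp add: Bochner_Integration.integral_sum)
    finally show ?thesis
      using sample_expectation[OF G, of i] by (simp add: X_def [abs_def])
  qed
  ultimately have S: "integrable M (\<lambda>\<omega>. (\<Sum>i<n. X i \<omega>)\<^sup>2)"
    "expectation (\<lambda>\<omega>. (\<Sum>i<n. X i \<omega>)\<^sup>2) \<le> real n * B"
    using expectation_sum_power2_le[of "{..<n}" X B] iX by auto
  have eq: "(\<Sum>l<k. a l * score n c k l \<omega>)\<^sup>2 = (\<Sum>i<n. X i \<omega>)\<^sup>2 / (real n)\<^sup>2" for \<omega>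
  proof -
    have "(\<Sum>l<k. a l * score n c k l \<omega>) = (\<Sum>l<k. \<Sum>i<n. a l * (residual c k (Ys i \<omega>) (Zs i \<omega>) * f l (Ws i \<omega>))) / real n"
      by (simp add: score_def sum_distrib_left sum_divide_distrib)
    also have "(\<Sum>l<k. \<Sum>i<n. a l * (residual c k (Ys i \<omega>) (Zs i \<omega>) * f l (Ws i \<omega>))) = (\<Sum>i<n. X i \<omega>)"
      by (subst sum.swap) (simp add: X_def G_def sum_distrib_left mult_ac)
    finally show ?thesis by (simp add: power_divide)
  qed
  have "(\<integral>\<^sup>+\<omega>. ennreal ((\<Sum>l<k. a l * score n c k l \<omega>)\<^sup>2) \<partial>M) \<le> ennreal (B / real n)"
    unfolding eq
  proof (rule nn_bound_of_integrable)
    have "expectation (\<lambda>\<omega>. (\<Sum>i<n. X i \<omega>)\<^sup>2 / (real n)\<^sup>2) = expectation (\<lambda>\<omega>. (\<Sum>i<n. X i \<omega>)\<^sup>2) / (real n)\<^sup>2"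
      by simp
    also have "\<dots> \<le> real n * B / (real n)\<^sup>2" by (rule divide_right_mono[OF S(2)]) simp
    also have "\<dots> = B / real n" using n by (simp add: power2_eq_square)
    finally show "expectation (\<lambda>\<omega>. (\<Sum>i<n. X i \<omega>)\<^sup>2 / (real n)\<^sup>2) \<le> B / real n" .
  qed (use S(1) in auto)
  then show ?thesis by (simp add: B_def)
qed

text \<open>The squared Frobenius norm divided by its order k^2 / n, so that its moments are bounded
  in both n and k; \<open>scaled_score\<close> is normalized likewise by k / n.\<close>

definition scaled_matrix_error :: "nat \<Rightarrow> nat \<Rightarrow> 'a \<Rightarrow> real" where
  "scaled_matrix_error n k \<omega> = real n / (real k)\<^sup>2 * (\<Sum>l<k. \<Sum>j<k. (matrix_error n l j \<omega>)\<^sup>2)"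

definition scaled_score :: "nat \<Rightarrow> (nat \<Rightarrow> real) \<Rightarrow> nat \<Rightarrow> 'a \<Rightarrow> real" where
  "scaled_score n c k \<omega> = real n / real k * (\<Sum>l<k. (score n c k l \<omega>)\<^sup>2)"

text \<open>Order 16 arises because the eighth moment of squared entries is needed.\<close>

definition matrix_moment_bound :: real where
  "matrix_moment_bound = (8 * \<eta>\<^sup>2) ^ 16 * fact 16 * (2 * exp (1 / 2))"

lemma matrix_moment_bound_nonneg: "matrix_moment_bound \<ge> 0"
  unfolding matrix_moment_bound_def by (intro mult_nonneg_nonneg zero_le_power) (use eta_ge_1 in auto)

lemma matrix_error_measurable: "matrix_error n l j \<in> borel_measurable M"
proof -
  have "(\<lambda>\<omega>. e j (Zs i \<omega>) * f l (Ws i \<omega>) - 0) \<in> borel_measurable M" for i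
    using sample_measurable[OF centred_product_measurable[of j l 0]] by simp
  then show ?thesis
    by (simp add: matrix_error_def [abs_def] mult.commute)
qed

lemma score_measurable: "score n c k l \<in> borel_measurable M"
proof -
  have "(\<lambda>\<omega>. residual c k (Ys i \<omega>) (Zs i \<omega>) * f l (Ws i \<omega>)) \<in> borel_measurable M" for i
    using sample_measurable[OF residual_sample_measurable[of c k "\<lambda>_. 1" "{l}"]] by simp
  then show ?thesis
    by (simp add: score_def [abs_def])
qed

lemma scaled_matrix_error_measurable: "scaled_matrix_error n k \<in> borel_measurable M"
  and scaled_score_measurable: "scaled_score n c k \<in> borel_measurable M"
  unfolding scaled_matrix_error_def [abs_def] scaled_score_def [abs_def]
  using matrix_error_measurable score_measurable by simp_all

lemma scaled_nonneg: "scaled_matrix_error n k \<omega> \<ge> 0" "scaled_score n c k \<omega> \<ge> 0"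
  by (auto simp: scaled_matrix_error_def scaled_score_def intro!: divide_nonneg_nonneg mult_nonneg_nonneg sum_nonneg)

text \<open>After scaling, the squared norm is the mean of the k^2 squared entries, so convexity
  reduces it to a single entry.\<close>

lemma nn_expectation_scaled_matrix_error_le:
  assumes n: "n > 0" and k: "k > 0"
  shows "(\<integral>\<^sup>+\<omega>. ennreal (scaled_matrix_error n k \<omega> ^ 8) \<partial>M) \<le> ennreal matrix_moment_bound"
proof -
  define u where "u i \<omega> = (sqrt (real n) * matrix_error n (fst i) (snd i) \<omega>)\<^sup>2" for i \<omega>
  have "(\<integral>\<^sup>+\<omega>. ennreal (((\<Sum>i\<in>{..<k} \<times> {..<k}. u i \<omega>) / real (card ({..<k} \<times> {..<k}))) ^ 8) \<partial>M) \<le> ennreal matrix_moment_bound"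
  proof (rule nn_integral_mean_power_le)
    fix i :: "nat \<times> nat"
    show "u i \<in> borel_measurable M" using matrix_error_measurable by (simp add: u_def [abs_def])
    have "u i \<omega> ^ 8 = \<bar>sqrt (real n) * matrix_error n (fst i) (snd i) \<omega>\<bar> ^ 16" for \<omega>
      by (simp add: u_def flip: power_mult)
    then show "(\<integral>\<^sup>+\<omega>. ennreal (u i \<omega> ^ 8) \<partial>M) \<le> ennreal matrix_moment_bound"
      using nn_expectation_matrix_error_le[OF n, of "fst i" "snd i" 16] by (simp add: matrix_moment_bound_def)
  qed (use k matrix_moment_bound_nonneg in auto)
  moreover have "(\<Sum>i\<in>{..<k} \<times> {..<k}. u i \<omega>) / real (card ({..<k} \<times> {..<k})) = scaled_matrix_error n k \<omega>" for \<omega>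
  proof -
    have "(\<Sum>i\<in>{..<k} \<times> {..<k}. u i \<omega>) = (\<Sum>l<k. \<Sum>j<k. u (l, j) \<omega>)"
      by (simp add: sum.cartesian_product)
    also have "\<dots> = real n * (\<Sum>l<k. \<Sum>j<k. (matrix_error n l j \<omega>)\<^sup>2)"
      by (simp add: u_def power_mult_distrib sum_distrib_left)
    finally show ?thesis
      by (simp add: scaled_matrix_error_def card_cartesian_product power2_eq_square[of "real k"])
  qed
  ultimately show ?thesis by simp
qed

lemma nn_expectation_scaled_score_le:
  assumes close: "close_approximation c k" and n: "n > 0" and k: "k > 0"
    and centred: "\<And>l. l < k \<Longrightarrow> expectation (\<lambda>\<omega>. residual c k (Y \<omega>) (Z \<omega>) * f l (W \<omega>)) = 0"
  shows "(\<integral>\<^sup>+\<omega>. ennreal ((scaled_score n c k \<omega>)\<^sup>2) \<partial>M) \<le> ennreal (3 * fourth_moment_bound)"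
proof -
  define u where "u l \<omega> = (sqrt (real n) * score n c k l \<omega>)\<^sup>2" for l \<omega>
  have "(\<integral>\<^sup>+\<omega>. ennreal (((\<Sum>l\<in>{..<k}. u l \<omega>) / real (card {..<k}))\<^sup>2) \<partial>M) \<le> ennreal (3 * fourth_moment_bound)"
  proof (rule nn_integral_mean_power_le)
    fix l assume l: "l \<in> {..<k}"
    show "u l \<in> borel_measurable M" using score_measurable by (simp add: u_def [abs_def])
    show "(\<integral>\<^sup>+\<omega>. ennreal ((u l \<omega>)\<^sup>2) \<partial>M) \<le> ennreal (3 * fourth_moment_bound)"
      using nn_expectation_score4_le[OF close n centred] l by (simp add: u_def flip: power_mult)
  qed (use k fourth_moment_bound_nonneg in auto)
  moreover have "(\<Sum>l\<in>{..<k}. u l \<omega>) / real (card {..<k}) = scaled_score n c k \<omega>" for \<omega>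
    by (simp add: scaled_score_def u_def power_mult_distrib sum_distrib_left sum_divide_distrib)
  ultimately show ?thesis by simp
qed

section \<open>Galerkin coefficients and the quantities of the pathwise bound\<close>

abbreviation T_matrix :: "nat \<Rightarrow> real mat" where
  "T_matrix k \<equiv> operator_matrix (distr M MW W) e f (cond_exp_operator M Z W MW) k"

text \<open>The basis coordinates of the Galerkin solution, kept as a vector.\<close>

definition galerkin_coeff :: "nat \<Rightarrow> real vec" where
  "galerkin_coeff k = inverse_mat (T_matrix k) *\<^sub>v Matrix.vec k (basis_coeff (distr M MW W) f (cond_exp_fun M W MW Y))"

lemma T_matrix_carrier: "T_matrix k \<in> carrier_mat k k"
  by (simp add: operator_matrix_def)

lemma galerkin_coeff:
  assumes "invertible_mat (T_matrix k)"
  shows "galerkin_coeff k \<in> carrier_vec k"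
    and "l < k \<Longrightarrow> (\<Sum>j<k. cross_moment l j * galerkin_coeff k $ j) = expectation (\<lambda>\<omega>. Y \<omega> * f l (W \<omega>))"
proof -
  define g where "g = Matrix.vec k (basis_coeff (distr M MW W) f (cond_exp_fun M W MW Y))"
  have g: "g \<in> carrier_vec k" by (simp add: g_def)
  note I = inverse_mat_mult_vec[OF T_matrix_carrier assms g]
  show c: "galerkin_coeff k \<in> carrier_vec k" using I(1) by (simp add: galerkin_coeff_def g_def)
  assume l: "l < k"
  have "T_matrix k *\<^sub>v galerkin_coeff k = g"
    using I(2) by (simp add: galerkin_coeff_def g_def)
  then have "(T_matrix k *\<^sub>v galerkin_coeff k) $ l = expectation (\<lambda>\<omega>. Y \<omega> * f l (W \<omega>))"
    using l by (simp add: g_def basis_coeff_regression)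
  moreover have "(T_matrix k *\<^sub>v galerkin_coeff k) $ l = (\<Sum>j<k. T_matrix k $$ (l, j) * galerkin_coeff k $ j)"
    using l c T_matrix_carrier[of k] by (simp add: scalar_prod_def atLeast0LessThan)
  ultimately show "(\<Sum>j<k. cross_moment l j * galerkin_coeff k $ j) = expectation (\<lambda>\<omega>. Y \<omega> * f l (W \<omega>))"
    using l by (simp add: operator_matrix_entry)
qed

text \<open>The Galerkin equations state that the residual is uncorrelated with the first
  \<open>k\<close> instrument functions. This is what centres every summand of the score, although
  the approximation is not exact.\<close>

lemma galerkin_centred:
  assumes "invertible_mat (T_matrix k)" "l < k"
  shows "expectation (\<lambda>\<omega>. residual (\<lambda>j. galerkin_coeff k $ j) k (Y \<omega>) (Z \<omega>) * f l (W \<omega>)) = 0"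
proof -
  have "expectation (\<lambda>\<omega>. residual (\<lambda>j. galerkin_coeff k $ j) k (Y \<omega>) (Z \<omega>) * f l (W \<omega>))
    = expectation (\<lambda>\<omega>. Y \<omega> * f l (W \<omega>) - (\<Sum>j<k. galerkin_coeff k $ j * (e j (Z \<omega>) * f l (W \<omega>))))"
    by (simp add: residual_def left_diff_distrib sum_distrib_right mult.assoc)
  also have "\<dots> = expectation (\<lambda>\<omega>. Y \<omega> * f l (W \<omega>)) - (\<Sum>j<k. galerkin_coeff k $ j * cross_moment l j)"
    using L2_space_integrable_mult[OF Y_L2 fW_L2] integrable_e_f
    by (subst Bochner_Integration.integral_diff) (auto simp: cross_moment_def)
  also have "\<dots> = 0"
    using galerkin_coeff(2)[OF assms] by (simp add: mult.commute)
  finally show ?thesis .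
qed

lemma sample_matrix_error:
  "frobenius_sq (sample_matrix e f k n (\<lambda>i. Zs i \<omega>) (\<lambda>i. Ws i \<omega>) - T_matrix k)
    = (\<Sum>l<k. \<Sum>j<k. (matrix_error n l j \<omega>)\<^sup>2)"
proof -
  define B where "B = sample_matrix e f k n (\<lambda>i. Zs i \<omega>) (\<lambda>i. Ws i \<omega>)"
  have "(B - T_matrix k) $$ (l, j) = matrix_error n l j \<omega>" if "l < k" "j < k" for l j
    using that operator_matrix_entry[OF that] T_matrix_carrier[of k]
    by (simp add: B_def sample_matrix_def matrix_error_def)
  moreover have "dim_row (B - T_matrix k) = k" "dim_col (B - T_matrix k) = k"
    using T_matrix_carrier[of k] by auto
  ultimately show ?thesis by (simp add: frobenius_sq_def B_def)
qed

lemma sample_score: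
  assumes c: "c \<in> carrier_vec k" and l: "l < k"
  shows "(sample_vector f k n (\<lambda>i. Ys i \<omega>) (\<lambda>i. Ws i \<omega>)
      - sample_matrix e f k n (\<lambda>i. Zs i \<omega>) (\<lambda>i. Ws i \<omega>) *\<^sub>v c) $ l = score n (\<lambda>j. c $ j) k l \<omega>"
proof -
  have "(sample_vector f k n (\<lambda>i. Ys i \<omega>) (\<lambda>i. Ws i \<omega>)
      - sample_matrix e f k n (\<lambda>i. Zs i \<omega>) (\<lambda>i. Ws i \<omega>) *\<^sub>v c) $ l
    = (1 / real n) * (\<Sum>i<n. Ys i \<omega> * f l (Ws i \<omega>))
      - (\<Sum>j<k. (1 / real n) * (\<Sum>i<n. f l (Ws i \<omega>) * e j (Zs i \<omega>)) * c $ j)"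
    using c l by (simp add: sample_vector_def sample_matrix_def scalar_prod_def atLeast0LessThan)
  also have "(\<Sum>j<k. (1 / real n) * (\<Sum>i<n. f l (Ws i \<omega>) * e j (Zs i \<omega>)) * c $ j)
    = (1 / real n) * (\<Sum>j<k. \<Sum>i<n. c $ j * e j (Zs i \<omega>) * f l (Ws i \<omega>))"
    by (simp add: sum_distrib_left sum_distrib_right mult_ac)
  also have "(\<Sum>j<k. \<Sum>i<n. c $ j * e j (Zs i \<omega>) * f l (Ws i \<omega>)) = (\<Sum>i<n. (\<Sum>j<k. c $ j * e j (Zs i \<omega>)) * f l (Ws i \<omega>))"
    by (subst sum.swap) (simp add: sum_distrib_right)
  finally show ?thesis
    by (simp only: score_def residual_def left_diff_distrib sum_subtractf right_diff_distrib)
qed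

section \<open>Risk of the estimator\<close>

lemma galerkin_residual:
  "residual (\<lambda>j. galerkin_coeff k $ j) k (\<phi> z) z
    = \<phi> z - galerkin_solution (distr M MW W) e f (cond_exp_operator M Z W MW) (cond_exp_fun M W MW Y) k z"
  by (simp add: residual_def galerkin_solution_def galerkin_coeff_def Let_def)

text \<open>Subtracting a finite expansion changes finitely many coefficients, which does not affect
  summability.\<close>

lemma residual_weighted:
  assumes "basis_coeff (distr M MZ Z) e \<phi> \<in> weighted_space \<gamma>"
  shows "basis_coeff (distr M MZ Z) e (\<lambda>z. residual c k (\<phi> z) z) \<in> weighted_space \<gamma>"
proof -
  have "eventually (\<lambda>j. \<gamma> j * (basis_coeff (distr M MZ Z) e (\<lambda>z. residual c k (\<phi> z) z) j)\<^sup>2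
      = \<gamma> j * (basis_coeff (distr M MZ Z) e \<phi> j)\<^sup>2) sequentially"
    using eventually_ge_at_top[of k]
    by eventually_elim (simp add: residual_def basis_coeff_diff_expansion[OF e_basis \<phi>_L2])
  then show ?thesis
    using assms summable_cong by (fastforce simp: weighted_space_def)
qed

text \<open>The error is minus the functional of the residual, so the duality of the weighted spaces
  applies.\<close>

lemma functional_error_le:
  assumes h: "h \<in> weighted_space (\<lambda>j. 1 / \<gamma> j)"
    and w: "basis_coeff (distr M MZ Z) e \<phi> \<in> weighted_space \<gamma>"
  shows "((\<Sum>j<k. h j * c j) - linear_functional (distr M MZ Z) e h \<phi>)\<^sup>2
    \<le> (weighted_norm (\<lambda>j. 1 / \<gamma> j) h)\<^sup>2 * (weighted_norm \<gamma> (basis_coeff (distr M MZ Z) e (\<lambda>z. residual c k (\<phi> z) z)))\<^sup>2"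
proof -
  define d where "d = basis_coeff (distr M MZ Z) e (\<lambda>z. residual c k (\<phi> z) z)"
  have d: "basis_coeff (distr M MZ Z) e \<phi> j = d j + (if j < k then c j else 0)" for j
    unfolding d_def residual_def basis_coeff_diff_expansion[OF e_basis \<phi>_L2] by simp
  note cs = weighted_Cauchy_Schwarz[OF \<gamma>_pos \<gamma>_summable h residual_weighted[OF w, of c k], folded d_def]
  \<comment> \<open>The series defining the functional is split into the residual series and a
    finite sum; both converge, so their values add.\<close>
  have "(\<lambda>j. h j * d j + (if j < k then h j * c j else 0)) sums ((\<Sum>j. h j * d j) + (\<Sum>j | j < k. h j * c j))"
    by (rule sums_add[OF summable_sums[OF cs(1)] sums_If_finite]) simp
  moreover have "(\<lambda>j. h j * d j + (if j < k then h j * c j else 0)) = (\<lambda>j. h j * basis_coeff (distr M MZ Z) e \<phi> j)"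
    by (auto simp: d distrib_left)
  ultimately have "linear_functional (distr M MZ Z) e h \<phi> = (\<Sum>j. h j * d j) + (\<Sum>j<k. h j * c j)"
    unfolding linear_functional_def using sums_unique by (fastforce simp: lessThan_def)
  then have "((\<Sum>j<k. h j * c j) - linear_functional (distr M MZ Z) e h \<phi>)\<^sup>2 = (\<Sum>j. h j * d j)\<^sup>2"
    by (simp add: power2_eq_square)
  then show ?thesis using cs(2) by (simp add: d_def)
qed

text \<open>The pathwise inequality with matrix error and score replaced by their scaled versions.
  All dependence on n and k then sits in \<open>q\<close>, \<open>b\<close> and 1 / k, and the
  remaining random factors have bounded moments. The constant 12 R + 192 R^3 is three times the one
  of \<open>quadratic_terms_le\<close>.\<close>

lemma estimator_pointwise_le:
  fixes h :: "nat \<Rightarrow> real" and L :: real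
  assumes n: "n > 0" and k: "k > 0" and inv: "invertible_mat (T_matrix k)"
    and s_def: "s = spectral_norm (inverse_mat (T_matrix k))"
    and a_def: "a = row_times_mat (Matrix.vec k h) (inverse_mat (T_matrix k))"
    and q_def: "q = (euclidean_norm a)\<^sup>2 / real n"
    and b_def: "b = (\<Sum>j<k. h j * galerkin_coeff k $ j) - L"
    and R: "real k ^ 3 * s\<^sup>2 \<le> R * real n" and s4: "4 * s\<^sup>2 \<le> real n"
  shows "\<bar>estimator e f h k n (\<lambda>i. Ys i \<omega>) (\<lambda>i. Zs i \<omega>) (\<lambda>i. Ws i \<omega>) - L\<bar>\<^sup>2
    \<le> 3 * (\<Sum>l<k. a $ l * score n (\<lambda>j. galerkin_coeff k $ j) k l \<omega>)\<^sup>2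
      + (q * (12 * R + 192 * R ^ 3) + 4 * L\<^sup>2 * R / real k) * scaled_matrix_error n k \<omega> ^ 8
      + q * (12 * R + 192 * R ^ 3) * (scaled_score n (\<lambda>j. galerkin_coeff k $ j) k \<omega>)\<^sup>2
      + (q * (12 * R + 192 * R ^ 3) + 3 * b\<^sup>2 + 4 * L\<^sup>2 * R / real k)"
proof -
  define c where "c = galerkin_coeff k"
  have c: "c \<in> carrier_vec k" unfolding c_def by (rule galerkin_coeff(1)[OF inv])
  define B where "B = sample_matrix e f k n (\<lambda>i. Zs i \<omega>) (\<lambda>i. Ws i \<omega>)"
  define w where "w = sample_vector f k n (\<lambda>i. Ys i \<omega>) (\<lambda>i. Ws i \<omega>)"
  have B: "B \<in> carrier_mat k k" and w: "w \<in> carrier_vec k"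
    by (auto simp: B_def w_def sample_matrix_def sample_vector_def)
  define V where "V = w - B *\<^sub>v c"
  have V: "V \<in> carrier_vec k" using w B c by (simp add: V_def)
  have Vl: "V $ l = score n (\<lambda>j. c $ j) k l \<omega>" if "l < k" for l
    using sample_score[OF c that] by (simp add: V_def B_def w_def)
  define x where "x = frobenius_sq (B - T_matrix k)"
  define y where "y = (euclidean_norm V)\<^sup>2"
  define X where "X = scaled_matrix_error n k \<omega>"
  define y' where "y' = scaled_score n (\<lambda>j. c $ j) k \<omega>"
  have X0: "X \<ge> 0" "y' \<ge> 0" by (auto simp: X_def y'_def scaled_nonneg)
  have nr: "real n > 0" and kr: "real k > 0" using n k by auto
  have xX: "x = (real k)\<^sup>2 / real n * X"
    using nr kr by (simp add: x_def B_def sample_matrix_error X_def scaled_matrix_error_def)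
  have yy: "y = real k / real n * y'"
    using nr kr V Vl by (simp add: y_def euclidean_norm_sq y'_def scaled_score_def)
  have aV: "a \<bullet> V = (\<Sum>l<k. a $ l * score n (\<lambda>j. c $ j) k l \<omega>)"
    using V Vl by (simp add: scalar_prod_def atLeast0LessThan)
  have hc: "Matrix.vec k h \<bullet> c = (\<Sum>j<k. h j * c $ j)"
    using c by (simp add: scalar_prod_def atLeast0LessThan)
  define r where "r = real k ^ 3 * s\<^sup>2 / real n"
  have r: "0 \<le> r" "r \<le> R" using R nr by (auto simp: r_def divide_le_eq)
  have q: "q \<ge> 0" using nr by (simp add: q_def)
  define E where "E = estimator e f h k n (\<lambda>i. Ys i \<omega>) (\<lambda>i. Zs i \<omega>) (\<lambda>i. Ws i \<omega>)"
  have "E = (if invertible_mat B \<and> spectral_norm (inverse_mat B) \<le> sqrt (real n)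
      then Matrix.vec k h \<bullet> (inverse_mat B *\<^sub>v w) else 0)"
    by (simp add: E_def estimator_def Let_def B_def w_def)
  then have "(E - L)\<^sup>2 \<le> 3 * ((a \<bullet> V)\<^sup>2 + (euclidean_norm a)\<^sup>2 * (4 * s\<^sup>2 * (x * y) + 64 * real n * s ^ 6 * (x ^ 4 * y))
      + (Matrix.vec k h \<bullet> c - L)\<^sup>2) + 4 * L\<^sup>2 * s\<^sup>2 * x"
    using thresholded_plugin_error_le[OF T_matrix_carrier inv B k _ c w s_def x_def a_def V_def y_def s4]
    by simp
  \<comment> \<open>Inserting the orders of \<open>s\<close>, \<open>x\<close> and \<open>y\<close>
    cancels every power of n and k: one factor 1 / n joins the length of \<open>a\<close> to form
    \<open>q\<close>, and only powers of \<open>r\<close> remain.\<close>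
  also have "(euclidean_norm a)\<^sup>2 * (4 * s\<^sup>2 * (x * y) + 64 * real n * s ^ 6 * (x ^ 4 * y))
      = q * (4 * r * (X * y') + 64 * r ^ 3 * (X ^ 4 * y'))"
  proof -
    have A: "(euclidean_norm a)\<^sup>2 = q * real n" using nr by (simp add: q_def)
    have s2: "s\<^sup>2 = r * real n / real k ^ 3" using nr kr by (simp add: r_def)
    have "s ^ 6 = (s\<^sup>2) ^ 3" by (simp flip: power_mult)
    then have s6: "s ^ 6 = (r * real n / real k ^ 3) ^ 3" using s2 by simp
    show ?thesis
      unfolding A s2 s6 xX yy using nr kr
      by (simp add: field_simps power_mult_distrib power_divide eval_nat_numeral)
  qed
  \<comment> \<open>Here one power of the dimension is left over, which makes the cost of a zero
    estimate vanish.\<close>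
  also have "4 * L\<^sup>2 * s\<^sup>2 * x = 4 * L\<^sup>2 * r / real k * X"
    unfolding xX r_def using nr kr by (simp add: field_simps eval_nat_numeral)
  finally have main: "(E - L)\<^sup>2 \<le> 3 * ((a \<bullet> V)\<^sup>2 + q * (4 * r * (X * y') + 64 * r ^ 3 * (X ^ 4 * y'))
      + (Matrix.vec k h \<bullet> c - L)\<^sup>2) + 4 * L\<^sup>2 * r / real k * X" .
  have t1: "q * (4 * r * (X * y') + 64 * r ^ 3 * (X ^ 4 * y')) \<le> q * (4 * R + 64 * R ^ 3) * (1 + X ^ 8 + y'\<^sup>2)"
    by (rule quadratic_terms_le[OF X0 q r])
  \<comment> \<open>The first power is raised to the eighth as well, so that a single moment of
    \<open>X\<close> is used throughout.\<close>
  have t2: "4 * L\<^sup>2 * r / real k * X \<le> 4 * L\<^sup>2 * R / real k * (1 + X ^ 8)"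
  proof (intro mult_mono divide_right_mono mult_left_mono r(2))
    show "X \<le> 1 + X ^ 8"
    proof (cases "X \<le> 1")
      case True
      then show ?thesis using zero_le_power[OF X0(1), of 8] by linarith
    next
      case False
      then have "X \<le> X ^ 8" by (intro self_le_power) auto
      then show ?thesis by linarith
    qed
  qed (use X0 r kr in auto)
  \<comment> \<open>Pure rearrangement over fresh variables, which spares the arithmetic the actual
    random terms.\<close>
  have "E' \<le> 3 * p + (q * (12 * R + 192 * R ^ 3) + l) * u + q * (12 * R + 192 * R ^ 3) * v + (q * (12 * R + 192 * R ^ 3) + 3 * z + l)"
    if "E' \<le> 3 * (p + t + z) + t'" "t \<le> q * (4 * R + 64 * R ^ 3) * (1 + u + v)" "t' \<le> l * (1 + u)" for E' p t t' u v z l :: real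
  proof -
    have "3 * (q * (4 * R + 64 * R ^ 3) * (1 + u + v)) = q * (12 * R + 192 * R ^ 3) + q * (12 * R + 192 * R ^ 3) * u + q * (12 * R + 192 * R ^ 3) * v"
      by (simp add: algebra_simps)
    moreover have "l * (1 + u) = l + l * u" by (simp add: algebra_simps)
    moreover have "(q * (12 * R + 192 * R ^ 3) + l) * u = q * (12 * R + 192 * R ^ 3) * u + l * u" by (simp add: distrib_right)
    ultimately show ?thesis using that by argo
  qed
  from this[OF main t1 t2] show ?thesis
    unfolding power2_abs E_def[symmetric] aV hc unfolding b_def X_def y'_def c_def by blast
qed

text \<open>Integration of the pathwise bound. Galerkin centring and closeness of the approximation
  bound the score moments, and the sample matrix has its own bound, all free of n and k.\<close>

lemma estimator_risk_le:
  fixes h :: "nat \<Rightarrow> real" and L :: real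
  assumes n: "n > 0" and k: "k > 0" and inv: "invertible_mat (T_matrix k)"
    and close: "close_approximation (\<lambda>j. galerkin_coeff k $ j) k"
    and s_def: "s = spectral_norm (inverse_mat (T_matrix k))"
    and a_def: "a = row_times_mat (Matrix.vec k h) (inverse_mat (T_matrix k))"
    and q_def: "q = (euclidean_norm a)\<^sup>2 / real n"
    and b_def: "b = (\<Sum>j<k. h j * galerkin_coeff k $ j) - L"
    and R: "real k ^ 3 * s\<^sup>2 \<le> R * real n" and s4: "4 * s\<^sup>2 \<le> real n"
  shows "(\<integral>\<^sup>+\<omega>. ennreal (\<bar>estimator e f h k n (\<lambda>i. Ys i \<omega>) (\<lambda>i. Zs i \<omega>) (\<lambda>i. Ws i \<omega>) - L\<bar>\<^sup>2) \<partial>M)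
    \<le> ennreal (3 * (2 * (\<sigma>\<^sup>2 + weight_sum * \<eta>\<^sup>2) * q)
      + (q * (12 * R + 192 * R ^ 3) + 4 * L\<^sup>2 * R / real k) * matrix_moment_bound
      + q * (12 * R + 192 * R ^ 3) * (3 * fourth_moment_bound)
      + (q * (12 * R + 192 * R ^ 3) + 3 * b\<^sup>2 + 4 * L\<^sup>2 * R / real k))"
proof -
  define c where "c j = galerkin_coeff k $ j" for j
  have cl: "close_approximation c k" using close by (simp add: c_def [abs_def])
  have centred: "expectation (\<lambda>\<omega>. residual c k (Y \<omega>) (Z \<omega>) * f l (W \<omega>)) = 0" if "l < k" for l
    using galerkin_centred[OF inv that] by (simp add: c_def [abs_def])
  have adim: "dim_vec a = k"
    using inverse_mat(1)[OF T_matrix_carrier inv] by (simp add: a_def row_times_mat_def)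
  have qs: "q = (\<Sum>l<k. (a $ l)\<^sup>2) / real n" by (simp add: q_def euclidean_norm_sq adim)
  have q: "q \<ge> 0" by (simp add: q_def)
  have "0 \<le> real k ^ 3 * s\<^sup>2" by simp
  then have "0 \<le> R * real n" using R by linarith
  then have R0: "R \<ge> 0" using n by (simp add: zero_le_mult_iff)
  have "(\<integral>\<^sup>+\<omega>. ennreal (\<bar>estimator e f h k n (\<lambda>i. Ys i \<omega>) (\<lambda>i. Zs i \<omega>) (\<lambda>i. Ws i \<omega>) - L\<bar>\<^sup>2) \<partial>M)
    \<le> (\<integral>\<^sup>+\<omega>. ennreal (3 * (\<Sum>l<k. a $ l * score n c k l \<omega>)\<^sup>2
      + (q * (12 * R + 192 * R ^ 3) + 4 * L\<^sup>2 * R / real k) * scaled_matrix_error n k \<omega> ^ 8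
      + q * (12 * R + 192 * R ^ 3) * (scaled_score n c k \<omega>)\<^sup>2
      + (q * (12 * R + 192 * R ^ 3) + 3 * b\<^sup>2 + 4 * L\<^sup>2 * R / real k)) \<partial>M)"
    unfolding c_def
    by (intro nn_integral_mono ennreal_leI estimator_pointwise_le[OF n k inv s_def a_def q_def b_def R s4])
  also have "\<dots> \<le> ennreal (3 * (2 * (\<sigma>\<^sup>2 + weight_sum * \<eta>\<^sup>2) * q)
      + (q * (12 * R + 192 * R ^ 3) + 4 * L\<^sup>2 * R / real k) * matrix_moment_bound
      + q * (12 * R + 192 * R ^ 3) * (3 * fourth_moment_bound)
      + (q * (12 * R + 192 * R ^ 3) + 3 * b\<^sup>2 + 4 * L\<^sup>2 * R / real k))"
  proof (rule nn_expectation_affine3_le)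
    show "(\<lambda>\<omega>. (\<Sum>l<k. a $ l * score n c k l \<omega>)\<^sup>2) \<in> borel_measurable M"
      by (intro borel_measurable_power borel_measurable_sum borel_measurable_times borel_measurable_const score_measurable)
    show "(\<lambda>\<omega>. scaled_matrix_error n k \<omega> ^ 8) \<in> borel_measurable M"
      by (intro borel_measurable_power scaled_matrix_error_measurable)
    show "(\<lambda>\<omega>. (scaled_score n c k \<omega>)\<^sup>2) \<in> borel_measurable M"
      by (intro borel_measurable_power scaled_score_measurable)
    show "(\<integral>\<^sup>+\<omega>. ennreal ((\<Sum>l<k. a $ l * score n c k l \<omega>)\<^sup>2) \<partial>M) \<le> ennreal (2 * (\<sigma>\<^sup>2 + weight_sum * \<eta>\<^sup>2) * q)"
      unfolding qs by (rule nn_expectation_score_combination_le[OF cl n centred])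
    show "(\<integral>\<^sup>+\<omega>. ennreal (scaled_matrix_error n k \<omega> ^ 8) \<partial>M) \<le> ennreal matrix_moment_bound"
      by (rule nn_expectation_scaled_matrix_error_le[OF n k])
    show "(\<integral>\<^sup>+\<omega>. ennreal ((scaled_score n c k \<omega>)\<^sup>2) \<partial>M) \<le> ennreal (3 * fourth_moment_bound)"
      by (rule nn_expectation_scaled_score_le[OF cl n k centred])
  qed (use q R0 weight_sum_nonneg matrix_moment_bound_nonneg fourth_moment_bound_nonneg in
      \<open>auto intro!: add_nonneg_nonneg mult_nonneg_nonneg divide_nonneg_nonneg\<close>)
  finally show ?thesis .
qed

end

section \<open>Mean square consistency\<close>

theorem proposition3p1:
  fixes M :: "'a measure" and MZ :: "'z measure" and MW :: "'w measure"
    and Y U :: "'a \<Rightarrow> real" and Z :: "'a \<Rightarrow> 'z" and W :: "'a \<Rightarrow> 'w"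
    and Ys :: "nat \<Rightarrow> 'a \<Rightarrow> real" and Zs :: "nat \<Rightarrow> 'a \<Rightarrow> 'z" and Ws :: "nat \<Rightarrow> 'a \<Rightarrow> 'w"
    and PZ :: "'z measure" and PW :: "'w measure"
    and T :: "('z \<Rightarrow> real) \<Rightarrow> 'w \<Rightarrow> real" and g :: "'w \<Rightarrow> real"
    and e :: "nat \<Rightarrow> 'z \<Rightarrow> real" and f :: "nat \<Rightarrow> 'w \<Rightarrow> real"
    and \<phi> :: "'z \<Rightarrow> real" and h \<gamma> :: "nat \<Rightarrow> real" and \<sigma> \<eta> :: real
    and m :: "nat \<Rightarrow> nat"
  assumes prob: "prob_space M"
    and Y_meas: "Y \<in> M \<rightarrow>\<^sub>M borel"
    and Z_meas: "Z \<in> M \<rightarrow>\<^sub>M MZ"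
    and W_meas: "W \<in> M \<rightarrow>\<^sub>M MW"
    and PZ: "PZ = distr M MZ Z"
    and PW: "PW = distr M MW W"
    and T: "T = cond_exp_operator M Z W MW"
    and g: "g = cond_exp_fun M W MW Y"
    and T_compact: "compact_L2_operator PZ PW T"
    and T_injective: "injective_L2_operator PZ PW T"
    and e_basis: "orthonormal_basis PZ e"
    and f_basis: "orthonormal_basis PW f"
    and T_nonsingular: "\<And>k. k \<ge> 1 \<Longrightarrow> invertible_mat (operator_matrix PW e f T k)"
    and \<gamma>_pos: "\<And>j. \<gamma> j > 0"
    and \<gamma>_mono: "mono \<gamma>"
    and \<gamma>_first: "\<gamma> 0 = 1"
    and \<gamma>_growth: "(\<lambda>j. real (Suc j) ^ 3 / \<gamma> j) \<longlonglongrightarrow> 0"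
    and model: "AE \<omega> in M. Y \<omega> = \<phi> (Z \<omega>) + U \<omega>"
    and \<sigma>_pos: "\<sigma> > 0"
    and error: "error_class M W MW U \<sigma>"
    and moments: "moment_assumption M Z W MW e f \<eta>"
    and sample_indep: "prob_space.indep_vars M (\<lambda>_. borel \<Otimes>\<^sub>M MZ \<Otimes>\<^sub>M MW)
                         (\<lambda>i \<omega>. (Ys i \<omega>, Zs i \<omega>, Ws i \<omega>)) UNIV"
    and sample_law: "\<And>i. distr M (borel \<Otimes>\<^sub>M MZ \<Otimes>\<^sub>M MW) (\<lambda>\<omega>. (Ys i \<omega>, Zs i \<omega>, Ws i \<omega>)) =
                         distr M (borel \<Otimes>\<^sub>M MZ \<Otimes>\<^sub>M MW) (\<lambda>\<omega>. (Y \<omega>, Z \<omega>, W \<omega>))"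
    and \<phi>_L2: "\<phi> \<in> L2_space PZ"
    and \<phi>_weighted: "basis_coeff PZ e \<phi> \<in> weighted_space \<gamma>"
    and h_weighted: "h \<in> weighted_space (\<lambda>j. 1 / \<gamma> j)"
    and m_pos: "\<And>n. n \<ge> 1 \<Longrightarrow> m n \<ge> 1"
    and m_unbounded: "(\<lambda>n. 1 / real (m n)) \<in> o(\<lambda>_. 1)"
    and m_small: "(\<lambda>n. real (m n)) \<in> o(\<lambda>n. real n)"
    and h_rate: "(\<lambda>n. (euclidean_norm (row_times_mat (Matrix.vec (m n) h)
                   (inverse_mat (operator_matrix PW e f T (m n)))))\<^sup>2) \<in> o(\<lambda>n. real n)"
    and T_rate: "(\<lambda>n. real (m n) ^ 3 *
                   (spectral_norm (inverse_mat (operator_matrix PW e f T (m n))))\<^sup>2)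
                   \<in> O(\<lambda>n. real n)"
    and bias: "(\<lambda>k. weighted_norm \<gamma> (basis_coeff PZ e
                 (\<lambda>z. \<phi> z - galerkin_solution PW e f T g k z))) \<longlonglongrightarrow> 0"
  shows "(\<lambda>n. \<integral>\<^sup>+ \<omega>. ennreal (\<bar>estimator e f h (m n) n (\<lambda>i. Ys i \<omega>) (\<lambda>i. Zs i \<omega>) (\<lambda>i. Ws i \<omega>)
                - linear_functional PZ e h \<phi>\<bar>\<^sup>2) \<partial>M) \<longlonglongrightarrow> 0"
proof -
  note defs = PZ PW T g
  have \<gamma>_summable: "summable (\<lambda>j. 1 / \<gamma> j)"
    by (rule summable_inverse_of_growth[OF \<gamma>_pos \<gamma>_growth])
  interpret iv_sample M MZ MW Y U Z W Ys Zs Ws e f \<phi> \<gamma> \<sigma> \<eta>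
    by (intro iv_sample.intro iv_sample_axioms.intro prob Y_meas Z_meas W_meas e_basis[unfolded defs]
        f_basis[unfolded defs] \<gamma>_pos \<gamma>_summable model \<sigma>_pos error moments sample_indep sample_law
        \<phi>_L2[unfolded defs])
  have weighted: "basis_coeff (distr M MZ Z) e \<phi> \<in> weighted_space \<gamma>"
    using \<phi>_weighted by (simp add: defs)
  define L where "L = linear_functional PZ e h \<phi>"
  define A where "A k = operator_matrix PW e f T k" for k
  have A_eq: "A k = T_matrix k" for k by (simp add: A_def defs)
  define s where "s n = spectral_norm (inverse_mat (A (m n)))" for n
  define a where "a n = row_times_mat (Matrix.vec (m n) h) (inverse_mat (A (m n)))" for n
  define q where "q n = (euclidean_norm (a n))\<^sup>2 / real n" for n
  define c where "c k j = galerkin_coeff k $ j" for k j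
  define b where "b n = (\<Sum>j<m n. h j * c (m n) j) - L" for n
  define N where "N k = weighted_norm \<gamma> (basis_coeff (distr M MZ Z) e (\<lambda>z. residual (c k) k (\<phi> z) z))" for k
  define H where "H = weighted_norm (\<lambda>j. 1 / \<gamma> j) h"

  have m_top: "filterlim m at_top sequentially"
    by (rule filterlim_at_top_of_inverse_smallo[OF m_pos m_unbounded])
  have inv_m: "(\<lambda>n. 1 / real (m n)) \<longlonglongrightarrow> 0"
    using smalloD_tendsto[OF m_unbounded] by simp
  have q0: "q \<longlonglongrightarrow> 0"
    using smalloD_tendsto[OF h_rate] by (simp add: q_def [abs_def] a_def A_def)
  have N0: "N \<longlonglongrightarrow> 0"
    using bias by (simp add: N_def [abs_def] c_def [abs_def] galerkin_residual defs)
  \<comment> \<open>The bias tends to 0 along all dimensions; since \<open>m\<close> is unbounded in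
    the limit, so does its value at the chosen one.\<close>
  then have Nm: "(\<lambda>n. N (m n)) \<longlonglongrightarrow> 0"
    by (rule filterlim_compose[OF _ m_top])
  have b_le: "(b n)\<^sup>2 \<le> H\<^sup>2 * (N (m n))\<^sup>2" for n
    using functional_error_le[OF h_weighted weighted, where k = "m n" and c = "c (m n)"] by (simp add: b_def L_def H_def N_def defs)
  have HN: "(\<lambda>n. H\<^sup>2 * (N (m n))\<^sup>2) \<longlonglongrightarrow> H\<^sup>2 * 0\<^sup>2"
    by (intro tendsto_intros Nm)
  have b0: "(\<lambda>n. (b n)\<^sup>2) \<longlonglongrightarrow> 0"
  proof (rule tendsto_sandwich[OF _ _ tendsto_const])
    show "eventually (\<lambda>n. (b n)\<^sup>2 \<le> H\<^sup>2 * (N (m n))\<^sup>2) sequentially" using b_le by simp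
    show "(\<lambda>n. H\<^sup>2 * (N (m n))\<^sup>2) \<longlonglongrightarrow> 0" using HN by simp
  qed simp

  \<comment> \<open>The constant of the O-condition on the matrix; it holds from some sample size
    on.\<close>
  obtain R where R: "R > 0"
    "eventually (\<lambda>n. norm (real (m n) ^ 3 * (s n)\<^sup>2) \<le> R * norm (real n)) sequentially"
    using landau_o.bigE[OF T_rate] by (auto simp: s_def A_def)
  define K where "K = 12 * R + 192 * R ^ 3"
  \<comment> \<open>The risk bound as a function of n: every summand contains \<open>q\<close>, the
    squared bias \<open>b\<close> or 1 / m, each of which tends to 0.\<close>
  define \<rho> where "\<rho> n = 3 * (2 * (\<sigma>\<^sup>2 + weight_sum * \<eta>\<^sup>2) * q n)
      + (q n * K + 4 * L\<^sup>2 * R * (1 / real (m n))) * matrix_moment_bound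
      + q n * K * (3 * fourth_moment_bound)
      + (q n * K + 3 * (b n)\<^sup>2 + 4 * L\<^sup>2 * R * (1 / real (m n)))" for n
  have "\<rho> \<longlonglongrightarrow> 3 * (2 * (\<sigma>\<^sup>2 + weight_sum * \<eta>\<^sup>2) * 0)
      + (0 * K + 4 * L\<^sup>2 * R * 0) * matrix_moment_bound
      + 0 * K * (3 * fourth_moment_bound)
      + (0 * K + 3 * 0 + 4 * L\<^sup>2 * R * 0)"
    unfolding \<rho>_def [abs_def] by (intro tendsto_intros q0 inv_m b0)
  then have \<rho>0: "(\<lambda>n. ennreal (\<rho> n)) \<longlonglongrightarrow> ennreal 0"
    by (intro tendsto_ennrealI) simp

  have "eventually (\<lambda>n. N (m n) < 1) sequentially"
    by (rule order_tendstoD(2)[OF Nm]) simp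
  \<comment> \<open>A dimension of at least 4 R yields 4 R \<le> m^3. Combined with the bound m^3
    s^2 \<le> R n, this gives 4 s^2 \<le> n, so that a well-behaved sample matrix passes the
    threshold.\<close>
  moreover have "eventually (\<lambda>n. m n \<ge> nat \<lceil>4 * R\<rceil>) sequentially"
    using m_top unfolding filterlim_at_top by blast
  ultimately have risk: "eventually (\<lambda>n. (\<integral>\<^sup>+ \<omega>. ennreal (\<bar>estimator e f h (m n) n (\<lambda>i. Ys i \<omega>) (\<lambda>i. Zs i \<omega>) (\<lambda>i. Ws i \<omega>)
      - L\<bar>\<^sup>2) \<partial>M) \<le> ennreal (\<rho> n)) sequentially"
    using R(2) eventually_ge_at_top[of 1]
  proof eventually_elim
    case (elim n)
    have n: "n > 0" and k: "m n > 0" using elim(4) m_pos[of n] by auto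
    have inv: "invertible_mat (T_matrix (m n))"
      using T_nonsingular[of "m n"] k by (simp add: defs)
    have close: "close_approximation (\<lambda>j. galerkin_coeff (m n) $ j) (m n)"
      using elim(1) residual_weighted[OF weighted] by (simp add: close_approximation_def N_def c_def [abs_def])
    have r: "real (m n) ^ 3 * (s n)\<^sup>2 \<le> R * real n" using elim(3) by simp
    have "4 * R \<le> real (m n)" using elim(2) by linarith
    also have "\<dots> \<le> real (m n) ^ 3" using k by (intro self_le_power) auto
    finally have "(4 * R) * (s n)\<^sup>2 \<le> real (m n) ^ 3 * (s n)\<^sup>2" by (rule mult_right_mono) simp
    then have "R * (4 * (s n)\<^sup>2) \<le> R * real n" using r by simp
    then have s4: "4 * (s n)\<^sup>2 \<le> real n" using R(1) by simp
    show ?case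
      using estimator_risk_le[OF n k inv close s_def[of n, unfolded A_eq] a_def[of n, unfolded A_eq] q_def
          b_def[of n, unfolded c_def] r s4]
      by (simp add: \<rho>_def K_def)
  qed
  have "(\<lambda>n. \<integral>\<^sup>+ \<omega>. ennreal (\<bar>estimator e f h (m n) n (\<lambda>i. Ys i \<omega>) (\<lambda>i. Zs i \<omega>) (\<lambda>i. Ws i \<omega>) - L\<bar>\<^sup>2) \<partial>M)
      \<longlonglongrightarrow> 0"
    by (rule tendsto_sandwich[OF _ risk tendsto_const]) (use \<rho>0 in auto)
  then show ?thesis unfolding L_def .
qed

end
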